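(* Let $n\ge5$ be odd and let $\mathcal{C}_n$ be the set of all $n$-cycles in $\mathrm{Sym}(n)$. Let $S\subseteq\mathrm{Alt}(n)$ be such that there are no $\pi,\sigma\in S$ with $\pi\sigma^{-1}\in\mathcal{C}_n$. Then $|S|\le\frac{(n-1)!}{2}$, and equality holds if and only if $S$ is a coset of a point-stabilizer in $\mathrm{Alt}(n)$, i.e. $S=\{\pi\in\mathrm{Alt}(n):\pi(i)=j\}$ for some $i,j\in[n]$.
   Context: $\mathrm{Alt}(n)$ acts naturally on $[n]=\{1,\dots,n\}$. *)

theory Defs
  imports Complex_Main "HOL-Algebra.Sym_Groups" "HOL-Algebra.Group_Action"
begin

definition n_cycles :: "nat \<Rightarrow> (nat \<Rightarrow> nat) set" where
  "n_cycles n = {cycle_of_list cs | cs. cycle cs \<and> length cs = n \<and> set cs \<subseteq> {1..n}}"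

text \<open>The action is the natural one: a permutation \<open>p\<close> sends the point \<open>i\<close> to \<open>p i\<close>.\<close>

definition point_stabilizer :: "nat \<Rightarrow> nat \<Rightarrow> (nat \<Rightarrow> nat) set" where
  "point_stabilizer n i = stabilizer (alt_group n) (\<lambda>p. p) i"

text \<open>No side is prescribed for the coset. Left and right cosets give the same family of sets,
  because a left coset of one point stabilizer is a right coset of another one.\<close>

definition is_point_stabilizer_coset :: "nat \<Rightarrow> (nat \<Rightarrow> nat) set \<Rightarrow> bool" where
  "is_point_stabilizer_coset n S \<longleftrightarrow>
     (\<exists>i \<in> {1..n}. \<exists>g \<in> carrier (alt_group n).
        S = g <#\<^bsub>alt_group n\<^esub> point_stabilizer n i \<or>
        S = point_stabilizer n i #>\<^bsub>alt_group n\<^esub> g)"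

end

theory Submission
  imports Defs "HOL-Combinatorics.Multiset_Permutations"
begin

text \<open>
  Let \<open>\<chi>\<^sub>k\<close> be the character of the \<open>k\<close>-th exterior power of the standard representation of the
  symmetric group. The alternating sum of the \<open>\<chi>\<^sub>k(g)\<close> is the determinant of \<open>1 - g\<close>, so it
  vanishes unless \<open>g\<close> is an \<open>n\<close>-cycle. Hence the energies \<open>Q\<^sub>k = \<Sum>\<^sub>p\<^sub>,\<^sub>q \<chi>\<^sub>k(p q\<^sup>-\<^sup>1)\<close> of a cycle-free
  family satisfy \<open>\<Sum> (-1)\<^sup>k Q\<^sub>k = 0\<close>. They are nonnegative, and Bessel's inequality gives
  \<open>\<Sum> d\<^sub>k Q\<^sub>k \<le> n! |S|\<close> with \<open>d\<^sub>k\<close> the binomial coefficient of \<open>n - 1\<close> over \<open>k\<close>. Adding \<open>n - 1\<close>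
  times the first relation to the second makes the coefficients of \<open>Q\<^sub>1\<close> and \<open>Q\<^sub>n\<^sub>-\<^sub>2\<close> vanish, those
  of \<open>Q\<^sub>0 = Q\<^sub>n\<^sub>-\<^sub>1 = |S|\<^sup>2\<close> equal to \<open>n\<close>, and all others positive; this is the bound.

  In the case of equality the indicator of \<open>S\<close> on the alternating group is an affine function of
  \<open>\<Sum>\<^sub>i p\<^sub>i\<^sub>,\<^sub>s\<^sub>(\<^sub>i\<^sub>)\<close>, where \<open>p\<^sub>i\<^sub>j\<close> is the proportion of members of \<open>S\<close> that send \<open>i\<close> to \<open>j\<close>. Comparing
  second and third moments, which only needs 3-transitivity of the alternating group, shows that
  some \<open>p\<^sub>i\<^sub>j\<close> exceeds \<open>(n - 3)/(n - 1)\<close>. A member of \<open>S\<close> not sending \<open>i\<close> to \<open>j\<close> would exclude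
  \<open>(n - 2)!\<close> permutations that do, which contradicts this density.
\<close>

section \<open>Signs of permutations on subsets\<close>

text \<open>The characters are realised by matrices indexed by subsets of \<open>V\<close>, the
  basis of the exterior algebra of the permutation module; a linear order on \<open>V\<close> fixes
  the signs. Contraction with the functional that is 1 on all basis vectors has the exterior algebra
  of the standard representation as its kernel, and n times the projection onto it is an integer
  matrix, \<open>laplace\<close>. Schur's lemma becomes a statement about few orbits, because a
  transposition inside \<open>I - J\<close> makes most entries of a commuting matrix vanish. The
  multiple n - 1 of the alternating relation is the best one: a multiple t gives the coefficient n -
  1 - t at k = 1 and 1 + t at k = 0, so t = n - 1 is the largest choice that keeps all coefficients
  nonnegative. Oddness of n gives k = 1 and k = n - 2 the same sign, likewise k = 0 and k = n - 1,
  and it makes the n-cycles even. In the equality case a two-valued affine function of matrix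
  entries must be recognised as a coset. The obstacle is to find a large entry: the squares of the
  centered entries are weights with sum 1, and the third moment is the average of the entries under
  these weights.\<close>

definition ord_sign :: "'a::linorder \<Rightarrow> 'a \<Rightarrow> real" where
  "ord_sign a b = (if b < a then 1 else -1)"

lemma ord_sign_square [simp]: "ord_sign a b * ord_sign a b = 1"
  by (simp add: ord_sign_def)

lemma ord_sign_swap: "a \<noteq> b \<Longrightarrow> ord_sign a b = - ord_sign b a"
  by (auto simp: ord_sign_def)

text \<open>The set \<open>J\<close> stands for the wedge product of its elements in increasing order:
  \<open>position_sign a J\<close> is the sign of moving \<open>a\<close> to the last place, and \<open>perm_sign_on g J\<close> is the sign of sorting the image of the product under \<open>g\<close>.\<close>

definition position_sign :: "'a::linorder \<Rightarrow> 'a set \<Rightarrow> real" where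
  "position_sign a J = (\<Prod>b\<in>J - {a}. ord_sign a b)"

definition perm_sign_on :: "('a::linorder \<Rightarrow> 'a) \<Rightarrow> 'a set \<Rightarrow> real" where
  "perm_sign_on g J = (\<Prod>e\<in>{e. e \<subseteq> J \<and> card e = 2}. ord_sign (g (Max e)) (g (Min e)))"

lemma position_sign_square [simp]: "position_sign a J * position_sign a J = 1"
  by (simp add: position_sign_def flip: prod.distrib)

lemma position_sign_insert:
  assumes "finite J" "b \<notin> J" "a \<noteq> b"
  shows "position_sign a (insert b J) = ord_sign a b * position_sign a J"
proof -
  have "insert b J - {a} = insert b (J - {a})" using assms by auto
  then show ?thesis using assms by (simp add: position_sign_def)
qed

lemma perm_sign_on_empty [simp]: "perm_sign_on g {} = 1"
proof -
  have "{e::'a set. e \<subseteq> {} \<and> card e = 2} = {}" by auto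
  then show ?thesis by (simp only: perm_sign_on_def prod.empty)
qed

text \<open>The new pairs are \<open>{a, b}\<close> with \<open>b\<close> in \<open>J\<close>. The
  product of the order signs before and after \<open>g\<close> is symmetric in \<open>a\<close> and
  \<open>b\<close>, so \<open>a\<close> need not be the largest element and inductions over finite
  sets may insert points in any order.\<close>

lemma perm_sign_on_insert:
  assumes "finite J" "a \<notin> J" "inj_on g (insert a J)"
  shows "perm_sign_on g (insert a J) =
    perm_sign_on g J * (\<Prod>b\<in>J. ord_sign a b * ord_sign (g a) (g b))"
proof -
  let ?f = "\<lambda>e. ord_sign (g (Max e)) (g (Min e))"
  let ?P = "\<lambda>J. {e. e \<subseteq> J \<and> card e = 2}"
  have split: "?P (insert a J) = ?P J \<union> (\<lambda>b. {a, b}) ` J"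
  proof (intro equalityI subsetI)
    fix e assume e: "e \<in> ?P (insert a J)"
    show "e \<in> ?P J \<union> (\<lambda>b. {a, b}) ` J"
    proof (cases "a \<in> e")
      case True
      then obtain b where "e = {a, b}" "a \<noteq> b" using e by (auto simp: card_2_iff)
      then show ?thesis using e by auto
    next
      case False then show ?thesis using e by auto
    qed
  next
    fix e assume "e \<in> ?P J \<union> (\<lambda>b. {a, b}) ` J"
    then show "e \<in> ?P (insert a J)" using assms(2) by auto (metis card_2_iff)
  qed
  have "(\<Prod>e\<in>(\<lambda>b. {a, b}) ` J. ?f e) = (\<Prod>b\<in>J. ?f {a, b})"
  proof (subst prod.reindex)
    show "inj_on (\<lambda>b. {a, b}) J" using assms(2) by (auto simp: inj_on_def doubleton_eq_iff)
  qed simp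
  also have "\<dots> = (\<Prod>b\<in>J. ord_sign a b * ord_sign (g a) (g b))"
  proof (rule prod.cong[OF refl])
    fix b assume b: "b \<in> J"
    then have ne: "a \<noteq> b" and gne: "g a \<noteq> g b" using assms by (auto simp: inj_on_def)
    show "?f {a, b} = ord_sign a b * ord_sign (g a) (g b)"
    proof (cases "a < b")
      case True
      then have "Max {a, b} = b" "Min {a, b} = a" by (auto simp: max_def min_def)
      then show ?thesis using True gne by (auto simp: ord_sign_def)
    next
      case False
      then have "Max {a, b} = a" "Min {a, b} = b" using ne by (auto simp: max_def min_def)
      then show ?thesis using False ne by (auto simp: ord_sign_def)
    qed
  qed
  finally have img: "(\<Prod>e\<in>(\<lambda>b. {a, b}) ` J. ?f e) = \<dots>" .
  have "perm_sign_on g (insert a J) = prod ?f (?P J) * prod ?f ((\<lambda>b. {a, b}) ` J)"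
    unfolding perm_sign_on_def split
    by (rule prod.union_disjoint) (use assms in auto)
  then show ?thesis by (simp only: img perm_sign_on_def)
qed

lemma perm_sign_on_square [simp]: "perm_sign_on g J * perm_sign_on g J = 1"
  by (simp add: perm_sign_on_def flip: prod.distrib)

lemma perm_sign_on_square_left [simp]: "perm_sign_on g J * (perm_sign_on g J * x) = x"
  by (simp flip: mult.assoc)

lemma perm_sign_on_fixed:
  assumes "finite J" "\<And>x. x \<in> J \<Longrightarrow> g x = x"
  shows "perm_sign_on g J = 1"
  using assms
proof (induction J rule: finite_induct)
  case (insert a J)
  then have "inj_on g (insert a J)" by (metis inj_on_cong inj_on_id2)
  then show ?case using insert by (simp add: perm_sign_on_insert)
qed simp

text \<open>The cocycle identity behind the action of permutations on the exterior algebra, in which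
  \<open>J\<close> goes to its image with the sign \<open>perm_sign_on g J\<close>.\<close>

lemma perm_sign_on_compose:
  assumes "finite J" "inj_on h J" "inj_on g (h ` J)"
  shows "perm_sign_on (g \<circ> h) J = perm_sign_on g (h ` J) * perm_sign_on h J"
  using assms
proof (induction J rule: finite_induct)
  case (insert a J)
  have hJ: "inj_on h J" and ha: "h a \<notin> h ` J" using insert by auto
  have gh: "inj_on (g \<circ> h) (insert a J)" using insert.prems by (rule comp_inj_on)
  have gJ: "inj_on g (h ` J)" using insert.prems(2) by (rule inj_on_subset) auto
  have "perm_sign_on g (h ` insert a J)
      = perm_sign_on g (h ` J) * (\<Prod>b\<in>h ` J. ord_sign (h a) b * ord_sign (g (h a)) (g b))"
    using insert ha by (simp add: perm_sign_on_insert)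
  also have "(\<Prod>b\<in>h ` J. ord_sign (h a) b * ord_sign (g (h a)) (g b))
      = (\<Prod>b\<in>J. ord_sign (h a) (h b) * ord_sign (g (h a)) (g (h b)))"
    by (simp add: prod.reindex[OF hJ])
  finally have e1: "perm_sign_on g (h ` insert a J) = perm_sign_on g (h ` J) * \<dots>" .
  \<comment> \<open>The order sign of \<open>h a\<close> and \<open>h b\<close> occurs in both
    factors and squares to 1.\<close>
  have e2: "(\<Prod>b\<in>J. ord_sign a b * ord_sign ((g \<circ> h) a) ((g \<circ> h) b))
    = (\<Prod>b\<in>J. ord_sign (h a) (h b) * ord_sign (g (h a)) (g (h b)))
      * (\<Prod>b\<in>J. ord_sign a b * ord_sign (h a) (h b))"
    unfolding prod.distrib[symmetric]
    by (rule prod.cong) (auto simp: ord_sign_def)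
  have IH: "perm_sign_on (g \<circ> h) J = perm_sign_on g (h ` J) * perm_sign_on h J"
    using insert.IH hJ gJ by blast
  note step = perm_sign_on_insert[OF insert.hyps]
  show ?case
    unfolding step[OF gh] step[OF insert.prems(1)] e1 IH e2 by (simp only: mult_ac)
qed simp

text \<open>For \<open>c\<close> other than \<open>a\<close> and \<open>b\<close>, the pairs of
  \<open>c\<close> with \<open>a\<close> and with \<open>b\<close> contribute equal signs, which
  cancel; only the pair \<open>{a, b}\<close> is left.\<close>

lemma perm_sign_on_transpose:
  assumes "finite J" "a \<in> J" "b \<in> J" "a \<noteq> b"
  shows "perm_sign_on (Transposition.transpose a b) J = -1"
proof -
  let ?t = "Transposition.transpose a b"
  define K where "K = J - {a, b}"
  have J: "J = insert a (insert b K)" and K: "finite K" "a \<notin> K" "b \<notin> K"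
    using assms by (auto simp: K_def)
  have inj: "inj_on ?t A" for A by (rule inj_on_subset[of _ UNIV]) auto
  have fixK: "?t c = c" if "c \<in> K" for c using that K by (metis transpose_apply_other)
  have "perm_sign_on ?t K = 1" using K fixK by (intro perm_sign_on_fixed)
  moreover have "(\<Prod>c\<in>K. ord_sign b c * ord_sign (?t b) (?t c)) = (\<Prod>c\<in>K. ord_sign b c * ord_sign a c)"
    by (rule prod.cong) (auto simp: fixK)
  moreover have "(\<Prod>c\<in>K. ord_sign a c * ord_sign (?t a) (?t c)) = (\<Prod>c\<in>K. ord_sign b c * ord_sign a c)"
    by (rule prod.cong) (auto simp: fixK)
  moreover have "(\<Prod>c\<in>K. ord_sign b c * ord_sign a c) * (\<Prod>c\<in>K. ord_sign b c * ord_sign a c) = 1"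
    unfolding prod.distrib[symmetric] by (rule prod.neutral) (auto simp: ord_sign_def)
  moreover have "ord_sign a b * ord_sign b a = -1" using assms(4) by (auto simp: ord_sign_def)
  ultimately show ?thesis
    unfolding J using K assms(4) inj by (simp add: perm_sign_on_insert)
qed

text \<open>Entry in row \<open>I\<close> and column \<open>J\<close> of the interior product with
  the functional that is 1 on every basis vector. At most one summand is nonzero; the form as a sum
  lets the entry be expanded linearly.\<close>

definition contraction :: "'a::linorder set \<Rightarrow> 'a set \<Rightarrow> real" where
  "contraction I J = (\<Sum>a\<in>J. if I = J - {a} then position_sign a J else 0)"

text \<open>Equivariance of the contraction, one term at a time: the pairs through \<open>a\<close>
  are exactly what distinguishes the sign of \<open>g\<close> on \<open>J\<close> from its sign on
  \<open>J - {a}\<close>.\<close>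

lemma position_sign_image:
  assumes "finite J" "inj_on g J" "a \<in> J"
  shows "position_sign (g a) (g ` J) =
    perm_sign_on g J * perm_sign_on g (J - {a}) * position_sign a J"
proof -
  have J: "J = insert a (J - {a})" using assms by auto
  have "perm_sign_on g J = perm_sign_on g (J - {a}) *
      (\<Prod>b\<in>J - {a}. ord_sign a b * ord_sign (g a) (g b))"
    using assms by (subst J, subst perm_sign_on_insert) (auto simp: insert_absorb)
  moreover have "position_sign (g a) (g ` J) = (\<Prod>b\<in>J - {a}. ord_sign (g a) (g b))"
  proof -
    have "g ` J - {g a} = g ` (J - {a})" using assms by (auto simp: inj_on_def)
    moreover have "inj_on g (J - {a})" using assms(2) by (rule inj_on_subset) auto
    ultimately show ?thesis by (simp add: position_sign_def prod.reindex)
  qed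
  moreover have "(\<Prod>b\<in>J - {a}. ord_sign a b) * (\<Prod>b\<in>J - {a}. ord_sign a b) = 1"
    by (simp flip: prod.distrib)
  ultimately show ?thesis
    by (simp add: position_sign_def prod.distrib mult_ac)
qed

section \<open>The contraction on the exterior algebra\<close>

definition kernel_mult :: "'a set \<Rightarrow> ('a set \<Rightarrow> 'a set \<Rightarrow> real) \<Rightarrow> ('a set \<Rightarrow> 'a set \<Rightarrow> real) \<Rightarrow> 'a set \<Rightarrow> 'a set \<Rightarrow> real" where
  "kernel_mult V A B I J = (\<Sum>K\<in>Pow V. A I K * B K J)"

lemma kernel_mult_assoc:
  assumes "finite V"
  shows "kernel_mult V (kernel_mult V A B) C = kernel_mult V A (kernel_mult V B C)"
proof (intro ext)
  fix I J
  show "kernel_mult V (kernel_mult V A B) C I J = kernel_mult V A (kernel_mult V B C) I J"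
    unfolding kernel_mult_def sum_distrib_left sum_distrib_right
    by (subst sum.swap) (simp add: mult.assoc)
qed

lemma kernel_mult_cong:
  assumes "\<And>K. K \<subseteq> V \<Longrightarrow> A I K = A' I K" "\<And>K. K \<subseteq> V \<Longrightarrow> B K J = B' K J"
  shows "kernel_mult V A B I J = kernel_mult V A' B' I J"
  unfolding kernel_mult_def by (rule sum.cong) (use assms in auto)

locale signed_subsets =
  fixes V :: "'a::linorder set"
  assumes fin: "finite V"
begin

abbreviation kernel_prod (infixl \<open>\<bullet>\<close> 70) where "A \<bullet> B \<equiv> kernel_mult V A B"

abbreviation D :: "'a set \<Rightarrow> 'a set \<Rightarrow> real" where "D \<equiv> contraction"

abbreviation Dt :: "'a set \<Rightarrow> 'a set \<Rightarrow> real" where "Dt \<equiv> (\<lambda>I J. contraction J I)"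

text \<open>\<open>Dt\<close> is right exterior multiplication by the sum of all basis vectors. The
  full Hodge Laplacian \<open>D Dt + Dt D\<close> is the scalar \<open>card V\<close>; for nonempty
  \<open>V\<close>, this half of it has the kernel of \<open>D\<close> as its image, that is, the
  exterior algebra of the sum-zero vectors.\<close>

definition laplace :: "'a set \<Rightarrow> 'a set \<Rightarrow> real" where "laplace = D \<bullet> Dt"

lemma fin_sub [simp]: "J \<subseteq> V \<Longrightarrow> finite J"
  using fin by (rule finite_subset[rotated])

text \<open>Indexed by the element added to \<open>I\<close> instead of the one deleted from
  \<open>J\<close>, which suits products with \<open>D\<close> on the left.\<close>

lemma contraction_alt:
  assumes "I \<subseteq> V" "J \<subseteq> V"
  shows "D I J = (\<Sum>a\<in>V - I. if J = insert a I then position_sign a J else 0)"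
proof (cases "\<exists>a\<in>V - I. J = insert a I")
  case True
  then obtain a where a: "a \<in> V - I" "J = insert a I" by auto
  have "D I J = (\<Sum>b\<in>J. if b = a then position_sign a J else 0)"
    unfolding contraction_def by (rule sum.cong) (use a in auto)
  also have "\<dots> = position_sign a J" using a assms by (simp)
  also have "\<dots> = (\<Sum>b\<in>V - I. if b = a then position_sign a J else 0)"
    using a assms fin by (simp)
  also have "\<dots> = (\<Sum>a\<in>V - I. if J = insert a I then position_sign a J else 0)"
    by (rule sum.cong) (use a in auto)
  finally show ?thesis .
next
  case False
  have "D I J = 0" unfolding contraction_def
    by (rule sum.neutral) (use False assms in auto)
  moreover have "(\<Sum>a\<in>V - I. if J = insert a I then position_sign a J else 0) = 0"
    by (rule sum.neutral) (use False in auto)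
  ultimately show ?thesis by simp
qed

lemma contraction_mult_right:
  assumes "I \<subseteq> V"
  shows "(D \<bullet> A) I J = (\<Sum>a\<in>V - I. position_sign a (insert a I) * A (insert a I) J)"
proof -
  have "(D \<bullet> A) I J = (\<Sum>K\<in>Pow V. \<Sum>a\<in>V - I. if K = insert a I then position_sign a K * A K J else 0)"
    unfolding kernel_mult_def
  proof (rule sum.cong[OF refl])
    fix K assume "K \<in> Pow V"
    then show "D I K * A K J = (\<Sum>a\<in>V - I. if K = insert a I then position_sign a K * A K J else 0)"
      using assms by (simp add: contraction_alt sum_distrib_right if_distrib[of "\<lambda>x. x * _"] cong: if_cong)
  qed
  also have "\<dots> = (\<Sum>a\<in>V - I. \<Sum>K\<in>Pow V. if K = insert a I then position_sign a K * A K J else 0)"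
    by (rule sum.swap)
  also have "\<dots> = (\<Sum>a\<in>V - I. position_sign a (insert a I) * A (insert a I) J)"
    by (rule sum.cong) (use assms fin in \<open>auto\<close>)
  finally show ?thesis .
qed

lemma contraction_transpose_mult_right:
  assumes "I \<subseteq> V"
  shows "(Dt \<bullet> A) I J = (\<Sum>b\<in>I. position_sign b I * A (I - {b}) J)"
proof -
  have "(Dt \<bullet> A) I J = (\<Sum>K\<in>Pow V. \<Sum>b\<in>I. if K = I - {b} then position_sign b I * A K J else 0)"
    unfolding kernel_mult_def contraction_def
    by (simp add: sum_distrib_right if_distrib[of "\<lambda>x. x * _"] cong: if_cong)
  also have "\<dots> = (\<Sum>b\<in>I. \<Sum>K\<in>Pow V. if K = I - {b} then position_sign b I * A K J else 0)"
    by (rule sum.swap)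
  also have "\<dots> = (\<Sum>b\<in>I. position_sign b I * A (I - {b}) J)"
    by (rule sum.cong) (use assms fin in \<open>auto\<close>)
  finally show ?thesis .
qed

text \<open>Adding \<open>a\<close> and then \<open>b\<close> has the opposite sign of adding
  \<open>b\<close> and then \<open>a\<close>, so the double sum equals its own negative.\<close>

lemma contraction_twice:
  assumes "I \<subseteq> V" "J \<subseteq> V"
  shows "(D \<bullet> D) I J = 0"
proof -
  let ?F = "\<lambda>a b. if a \<noteq> b \<and> J = insert b (insert a I)
      then position_sign a (insert a I) * position_sign b (insert b (insert a I)) else 0"
  have anti: "?F a b = - ?F b a" if "a \<in> V - I" "b \<in> V - I" for a b
  proof (cases "a = b")
    case False
    have "finite I" using assms by simp
    then have "position_sign b (insert b (insert a I)) = ord_sign b a * position_sign b (insert b I)"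
      and "position_sign a (insert a (insert b I)) = ord_sign a b * position_sign a (insert a I)"
      using that False position_sign_insert[of "insert b I" a b] position_sign_insert[of "insert a I" b a]
      by (auto simp: insert_commute)
    then show ?thesis using False by (simp add: insert_commute ord_sign_swap[of a b])
  qed simp
  have "(D \<bullet> D) I J = (\<Sum>a\<in>V - I. position_sign a (insert a I) * D (insert a I) J)"
    using assms by (simp add: contraction_mult_right)
  also have "\<dots> = (\<Sum>a\<in>V - I. \<Sum>b\<in>V - I. ?F a b)"
  proof (rule sum.cong[OF refl])
    fix a assume a: "a \<in> V - I"
    then have "D (insert a I) J = (\<Sum>b\<in>V - insert a I. if J = insert b (insert a I) then position_sign b J else 0)"
      using assms by (subst contraction_alt) auto
    then have "position_sign a (insert a I) * D (insert a I) J = (\<Sum>b\<in>V - insert a I. ?F a b)"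
      by (simp only: sum_distrib_left) (rule sum.cong, auto)
    also have "\<dots> = (\<Sum>b\<in>V - I. ?F a b)"
      by (rule sum.mono_neutral_left) (use fin in auto)
    finally show "position_sign a (insert a I) * D (insert a I) J = (\<Sum>b\<in>V - I. ?F a b)" .
  qed
  finally have eq: "(D \<bullet> D) I J = (\<Sum>a\<in>V - I. \<Sum>b\<in>V - I. ?F a b)" .
  also have "\<dots> = (\<Sum>a\<in>V - I. \<Sum>b\<in>V - I. - ?F b a)"
    by (intro sum.cong refl anti)
  also have "\<dots> = - (\<Sum>a\<in>V - I. \<Sum>b\<in>V - I. ?F b a)"
    by (simp only: sum_negf)
  also have "(\<Sum>a\<in>V - I. \<Sum>b\<in>V - I. ?F b a) = (\<Sum>a\<in>V - I. \<Sum>b\<in>V - I. ?F a b)"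
    by (rule sum.swap)
  finally show ?thesis using eq by linarith
qed

text \<open>The anticommutator of an interior product and an exterior multiplication is the value of
  the functional at the vector. On the diagonal the two orders count the points outside and inside
  \<open>I\<close>; the terms \<open>?F a b\<close>, which replace \<open>b\<close> by
  \<open>a\<close>, cancel.\<close>

lemma laplace_sum:
  assumes I: "I \<subseteq> V" and J: "J \<subseteq> V"
  shows "laplace I J + (Dt \<bullet> D) I J = (if I = J then real (card V) else 0)"
proof -
  let ?p = position_sign
  let ?F = "\<lambda>a b. if J = insert a (I - {b}) then ?p a (insert a I) * ?p b (insert a I) else 0"
  have finI: "finite I" and finJ: "finite J" using assms by auto
  have "laplace I J = (\<Sum>a\<in>V - I. ?p a (insert a I) * D J (insert a I))"
    using I by (simp add: laplace_def contraction_mult_right)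
  also have "\<dots> = (\<Sum>a\<in>V - I. (if J = I then 1 else 0) + (\<Sum>b\<in>I. ?F a b))"
  proof (rule sum.cong[OF refl])
    fix a assume a: "a \<in> V - I"
    have "D J (insert a I) = (if J = I then ?p a (insert a I) else 0)
        + (\<Sum>b\<in>I. if J = insert a I - {b} then ?p b (insert a I) else 0)"
      unfolding contraction_def using a finI by simp
    moreover have "(\<Sum>b\<in>I. if J = insert a I - {b} then ?p b (insert a I) else 0)
      = (\<Sum>b\<in>I. if J = insert a (I - {b}) then ?p b (insert a I) else 0)"
      by (rule sum.cong) (use a in \<open>auto simp: insert_Diff_if\<close>)
    ultimately show "?p a (insert a I) * D J (insert a I) = (if J = I then 1 else 0) + (\<Sum>b\<in>I. ?F a b)"
      by (simp add: distrib_left sum_distrib_left if_distrib[of "\<lambda>x. _ * x"] cong: if_cong)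
  qed
  finally have L: "laplace I J = (if J = I then real (card (V - I)) else 0) + (\<Sum>a\<in>V - I. \<Sum>b\<in>I. ?F a b)"
    by (simp add: sum.distrib)
  have "(Dt \<bullet> D) I J = (\<Sum>b\<in>I. ?p b I * D (I - {b}) J)"
    using I by (simp add: contraction_transpose_mult_right)
  also have "\<dots> = (\<Sum>b\<in>I. (if J = I then 1 else 0) - (\<Sum>a\<in>V - I. ?F a b))"
  proof (rule sum.cong[OF refl])
    fix b assume b: "b \<in> I"
    have V: "V - (I - {b}) = insert b (V - I)" using b I by auto
    have "D (I - {b}) J = (\<Sum>a\<in>V - (I - {b}). if J = insert a (I - {b}) then ?p a J else 0)"
      using I J by (intro contraction_alt) auto
    also have "\<dots> = (if J = I then ?p b J else 0) + (\<Sum>a\<in>V - I. if J = insert a (I - {b}) then ?p a J else 0)"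
      unfolding V using b fin by (subst sum.insert) (auto simp: insert_absorb)
    finally have "?p b I * D (I - {b}) J = (if J = I then 1 else 0) +
        (\<Sum>a\<in>V - I. if J = insert a (I - {b}) then ?p b I * ?p a J else 0)"
      by (simp add: distrib_left sum_distrib_left if_distrib[of "\<lambda>x. _ * x"] cong: if_cong)
    also have "(\<Sum>a\<in>V - I. if J = insert a (I - {b}) then ?p b I * ?p a J else 0) = (\<Sum>a\<in>V - I. - ?F a b)"
    proof (rule sum.cong[OF refl])
      fix a assume a: "a \<in> V - I"
      then have ab: "a \<noteq> b" using b by auto
      have "insert a I = insert b (insert a (I - {b}))" using b by auto
      then have "?p a (insert a I) = ord_sign a b * ?p a (insert a (I - {b}))"
        using a ab finI by (simp add: position_sign_insert)
      moreover have "?p b (insert a I) = ord_sign b a * ?p b I"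
        using a ab finI by (simp add: position_sign_insert)
      ultimately show "(if J = insert a (I - {b}) then ?p b I * ?p a J else 0) = - ?F a b"
        using ab by (simp add: ord_sign_swap[of a b])
    qed
    finally show "?p b I * D (I - {b}) J = (if J = I then 1 else 0) - (\<Sum>a\<in>V - I. ?F a b)"
      by (simp add: sum_negf)
  qed
  finally have U: "(Dt \<bullet> D) I J = (if J = I then real (card I) else 0) - (\<Sum>a\<in>V - I. \<Sum>b\<in>I. ?F a b)"
    by (simp add: sum_subtractf sum.swap[of _ I])
  have "real (card (V - I)) + real (card I) = real (card V)"
    using I fin card_mono[OF fin I] by (simp add: card_Diff_subset)
  with L U show ?thesis by auto
qed

lemma laplace_commute: "laplace I J = laplace J I"
  by (simp add: laplace_def kernel_mult_def mult.commute)

lemma laplace_diag: "I \<subseteq> V \<Longrightarrow> laplace I I = real (card V - card I)"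
proof -
  assume I: "I \<subseteq> V"
  have "D I (insert a I) = position_sign a (insert a I)" if "a \<in> V - I" for a
  proof -
    have "D I (insert a I) = (\<Sum>b\<in>insert a I. if b = a then position_sign a (insert a I) else 0)"
      unfolding contraction_def by (rule sum.cong) (use that in auto)
    then show ?thesis using I by (simp)
  qed
  then show ?thesis using I fin
    by (simp add: laplace_def contraction_mult_right card_Diff_subset)
qed

lemma contraction_nonzeroE:
  assumes "D I J \<noteq> 0"
  obtains a where "a \<in> J" "I = J - {a}"
proof -
  obtain a where a: "a \<in> J" "(if I = J - {a} then position_sign a J else 0) \<noteq> 0"
    using sum.not_neutral_contains_not_neutral[OF assms[unfolded contraction_def]] .
  show ?thesis
  proof (rule that[OF a(1)])
    show "I = J - {a}" using a(2) by (rule contrapos_np) simp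
  qed
qed

lemma contraction_card:
  assumes "D I J \<noteq> 0" "J \<subseteq> V"
  shows "card J = Suc (card I)"
proof -
  obtain a where "a \<in> J" "I = J - {a}" using contraction_nonzeroE[OF assms(1)] .
  then show ?thesis using assms(2) by (simp add: card_Suc_Diff1 del: card_Diff_insert)
qed

lemma laplace_card:
  assumes "laplace I J \<noteq> 0"
  shows "card I = card J"
proof -
  obtain K where "K \<subseteq> V" "D I K \<noteq> 0" "D J K \<noteq> 0"
    using sum.not_neutral_contains_not_neutral[OF assms[unfolded laplace_def kernel_mult_def]]
    by auto
  then show ?thesis using contraction_card[of I K] contraction_card[of J K] by simp
qed

text \<open>Replace the middle factor \<open>Dt D\<close> by \<open>card V - laplace\<close>; the
  correction term then contains \<open>D D = 0\<close>.\<close>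

lemma laplace_idem:
  assumes "I \<subseteq> V" "J \<subseteq> V"
  shows "(laplace \<bullet> laplace) I J = card V * laplace I J"
proof -
  have "(laplace \<bullet> laplace) I J = (D \<bullet> ((Dt \<bullet> D) \<bullet> Dt)) I J"
    unfolding laplace_def by (simp only: kernel_mult_assoc[OF fin])
  also have "\<dots> = (D \<bullet> (\<lambda>P Q. card V * Dt P Q - (laplace \<bullet> Dt) P Q)) I J"
  proof (rule kernel_mult_cong[OF refl])
    fix P assume P: "P \<subseteq> V"
    have "((Dt \<bullet> D) \<bullet> Dt) P J = ((\<lambda>P Q. (if P = Q then real (card V) else 0) - laplace P Q) \<bullet> Dt) P J"
      by (rule kernel_mult_cong) (use laplace_sum P in \<open>auto simp: algebra_simps\<close>)
    also have "\<dots> = card V * Dt P J - (laplace \<bullet> Dt) P J"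
      using P fin by (simp add: kernel_mult_def left_diff_distrib sum_subtractf
          if_distrib[of "\<lambda>x. x * _"] cong: if_cong)
    finally show "((Dt \<bullet> D) \<bullet> Dt) P J = card V * Dt P J - (laplace \<bullet> Dt) P J" .
  qed
  also have "\<dots> = card V * laplace I J - (D \<bullet> (laplace \<bullet> Dt)) I J"
    unfolding laplace_def kernel_mult_def[of V D]
    by (simp add: right_diff_distrib sum_subtractf sum_distrib_left mult.left_commute)
  also have "(D \<bullet> (laplace \<bullet> Dt)) I J = ((D \<bullet> D) \<bullet> (Dt \<bullet> Dt)) I J"
    unfolding laplace_def by (simp only: kernel_mult_assoc[OF fin])
  also have "\<dots> = ((\<lambda>_ _. 0) \<bullet> (Dt \<bullet> Dt)) I J"
    by (rule kernel_mult_cong) (use contraction_twice assms in auto)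
  also have "\<dots> = 0" by (simp add: kernel_mult_def)
  finally show ?thesis by simp
qed

end

section \<open>Invariant kernels\<close>

text \<open>The four regions of the two Venn diagrams have equal sizes, so bijections between them
  can be glued. Hence three cardinalities classify the orbits of pairs of subsets.\<close>

lemma permutes_two_subsets:
  assumes fin: "finite V" and sub: "I \<subseteq> V" "J \<subseteq> V" "I' \<subseteq> V" "J' \<subseteq> V"
    and c: "card I = card I'" "card J = card J'" "card (I \<inter> J) = card (I' \<inter> J')"
  shows "\<exists>g. g permutes V \<and> g ` I = I' \<and> g ` J = J'"
proof -
  have f: "finite X" if "X \<subseteq> V" for X using that fin by (rule finite_subset)
  have f': "finite I" "finite J" "finite I'" "finite J'" using f sub by auto
  have c1: "card (I - J) = card (I' - J')"
    using f' c by (simp add: card_Diff_subset_Int)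
  have c2: "card (J - I) = card (J' - I')"
    using f' c by (simp add: card_Diff_subset_Int Int_commute)
  have c3: "card (V - (I \<union> J)) = card (V - (I' \<union> J'))"
  proof -
    have "card (I \<union> J) = card (I' \<union> J')"
      using card_Un_Int[of I J] card_Un_Int[of I' J'] f' c by simp
    then show ?thesis using f' sub fin by (simp add: card_Diff_subset)
  qed
  obtain g0 where g0: "bij_betw g0 (I \<inter> J) (I' \<inter> J')"
    using finite_same_card_bij[OF _ _ c(3)] f' by auto
  obtain g1 where g1: "bij_betw g1 (I - J) (I' - J')"
    using finite_same_card_bij[OF _ _ c1] f' by auto
  obtain g2 where g2: "bij_betw g2 (J - I) (J' - I')"
    using finite_same_card_bij[OF _ _ c2] f' by auto
  obtain g3 where g3: "bij_betw g3 (V - (I \<union> J)) (V - (I' \<union> J'))"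
    using finite_same_card_bij[OF _ _ c3] fin by auto
  define g where "g x = (if x \<in> I then if x \<in> J then g0 x else g1 x
      else if x \<in> J then g2 x else if x \<in> V then g3 x else x)" for x
  have b0: "bij_betw g (I \<inter> J) (I' \<inter> J')"
    using g0 by (rule bij_betw_cong[THEN iffD1, rotated]) (auto simp: g_def)
  have b1: "bij_betw g (I - J) (I' - J')"
    using g1 by (rule bij_betw_cong[THEN iffD1, rotated]) (auto simp: g_def)
  have b2: "bij_betw g (J - I) (J' - I')"
    using g2 by (rule bij_betw_cong[THEN iffD1, rotated]) (auto simp: g_def)
  have b3: "bij_betw g (V - (I \<union> J)) (V - (I' \<union> J'))"
    using g3 by (rule bij_betw_cong[THEN iffD1, rotated]) (auto simp: g_def)
  have bI: "bij_betw g (I \<inter> J \<union> (I - J)) (I' \<inter> J' \<union> (I' - J'))"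
    by (rule bij_betw_combine[OF b0 b1]) auto
  have bJ: "bij_betw g (I \<inter> J \<union> (J - I)) (I' \<inter> J' \<union> (J' - I'))"
    by (rule bij_betw_combine[OF b0 b2]) auto
  have bIJ: "bij_betw g (I \<inter> J \<union> (I - J) \<union> (J - I)) (I' \<inter> J' \<union> (I' - J') \<union> (J' - I'))"
    by (rule bij_betw_combine[OF bI b2]) auto
  have bV: "bij_betw g (I \<inter> J \<union> (I - J) \<union> (J - I) \<union> (V - (I \<union> J)))
      (I' \<inter> J' \<union> (I' - J') \<union> (J' - I') \<union> (V - (I' \<union> J')))"
    by (rule bij_betw_combine[OF bIJ b3]) auto
  have "I \<inter> J \<union> (I - J) \<union> (J - I) \<union> (V - (I \<union> J)) = V"
    "I' \<inter> J' \<union> (I' - J') \<union> (J' - I') \<union> (V - (I' \<union> J')) = V"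
    using sub by auto
  then have "g permutes V"
    using bV sub by (intro bij_imp_permutes) (auto simp: g_def)
  moreover have "I \<inter> J \<union> (I - J) = I" "I \<inter> J \<union> (J - I) = J"
    "I' \<inter> J' \<union> (I' - J') = I'" "I' \<inter> J' \<union> (J' - I') = J'" by auto
  then have "g ` I = I'" "g ` J = J'" using bI bJ by (auto simp: bij_betw_def)
  ultimately show ?thesis by blast
qed

context signed_subsets
begin

text \<open>Equivalent to commuting with the signed permutation matrices: \<open>M\<close> is an
  endomorphism of the exterior algebra as a representation.\<close>

definition invariant :: "('a set \<Rightarrow> 'a set \<Rightarrow> real) \<Rightarrow> bool" where
  "invariant M \<longleftrightarrow> (\<forall>g I J. g permutes V \<longrightarrow> I \<subseteq> V \<longrightarrow> J \<subseteq> V \<longrightarrow>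
     M (g ` I) (g ` J) = perm_sign_on g I * perm_sign_on g J * M I J)"

lemma invariantD:
  "invariant M \<Longrightarrow> g permutes V \<Longrightarrow> I \<subseteq> V \<Longrightarrow> J \<subseteq> V \<Longrightarrow>
     M (g ` I) (g ` J) = perm_sign_on g I * perm_sign_on g J * M I J"
  by (simp add: invariant_def)

lemma perm_inj_on: "g permutes V \<Longrightarrow> inj_on g A"
  by (meson inj_on_subset permutes_inj subset_UNIV)

lemma perm_image_sub: "g permutes V \<Longrightarrow> I \<subseteq> V \<Longrightarrow> g ` I \<subseteq> V"
  using permutes_image by fastforce

lemma bij_betw_image_Pow: "g permutes V \<Longrightarrow> bij_betw ((`) g) (Pow V) (Pow V)"
  by (rule bij_betw_Pow) (simp add: permutes_imp_bij)

lemma sum_Pow_perm: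
  assumes "g permutes V"
  shows "(\<Sum>K\<in>Pow V. f (g ` K)) = sum f (Pow V)"
  using sum.reindex_bij_betw[OF bij_betw_image_Pow[OF assms], of f] .

lemma invariant_transpose: "invariant M \<Longrightarrow> invariant (\<lambda>I J. M J I)"
  by (simp add: invariant_def)

lemma invariant_mult:
  assumes "invariant A" "invariant B"
  shows "invariant (A \<bullet> B)"
  unfolding invariant_def
proof (intro allI impI)
  fix g I J assume g: "g permutes V" and I: "I \<subseteq> V" and J: "J \<subseteq> V"
  have "(A \<bullet> B) (g ` I) (g ` J) = (\<Sum>K\<in>Pow V. A (g ` I) (g ` K) * B (g ` K) (g ` J))"
    unfolding kernel_mult_def using sum_Pow_perm[OF g] by (rule sym)
  also have "\<dots> = (\<Sum>K\<in>Pow V. perm_sign_on g I * perm_sign_on g J * (A I K * B K J))"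
  proof (rule sum.cong[OF refl])
    fix K assume "K \<in> Pow V"
    then show "A (g ` I) (g ` K) * B (g ` K) (g ` J) = perm_sign_on g I * perm_sign_on g J * (A I K * B K J)"
      using invariantD[OF assms(1) g I] invariantD[OF assms(2) g _ J] by (simp add: mult_ac)
  qed
  finally show "(A \<bullet> B) (g ` I) (g ` J) = perm_sign_on g I * perm_sign_on g J * (A \<bullet> B) I J"
    by (simp add: kernel_mult_def sum_distrib_left)
qed

lemma invariant_contraction: "invariant D"
  unfolding invariant_def
proof (intro allI impI)
  fix g I J assume g: "g permutes V" and I: "I \<subseteq> V" and J: "J \<subseteq> V"
  have inj: "inj_on g A" for A using g by (rule perm_inj_on)
  have "D (g ` I) (g ` J) = (\<Sum>a\<in>J. if g ` I = g ` J - {g a} then position_sign (g a) (g ` J) else 0)"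
    unfolding contraction_def by (simp add: sum.reindex[OF inj])
  also have "\<dots> = (\<Sum>a\<in>J. if I = J - {a} then perm_sign_on g I * perm_sign_on g J * position_sign a J else 0)"
  proof (rule sum.cong[OF refl])
    fix a assume a: "a \<in> J"
    have "g ` J - {g a} = g ` (J - {a})" using inj[of UNIV] by (auto simp: inj_on_def)
    then have "g ` I = g ` J - {g a} \<longleftrightarrow> I = J - {a}"
      using inj[of UNIV] by (simp add: inj_image_eq_iff)
    then show "(if g ` I = g ` J - {g a} then position_sign (g a) (g ` J) else 0)
        = (if I = J - {a} then perm_sign_on g I * perm_sign_on g J * position_sign a J else 0)"
      using position_sign_image[OF _ inj a] J by (simp add: mult_ac)
  qed
  finally show "D (g ` I) (g ` J) = perm_sign_on g I * perm_sign_on g J * D I J"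
    by (simp add: contraction_def sum_distrib_left if_distrib[of "\<lambda>x. _ * x"] cong: if_cong)
qed

lemma invariant_laplace: "invariant laplace"
  unfolding laplace_def
  by (intro invariant_mult invariant_contraction invariant_transpose[OF invariant_contraction])

text \<open>The transposition of \<open>a\<close> and \<open>b\<close> maps both sets to themselves,
  but has sign -1 on \<open>I\<close> and 1 on \<open>J\<close>.\<close>

lemma invariant_zero:
  assumes M: "invariant M" and I: "I \<subseteq> V" and J: "J \<subseteq> V" and ab: "a \<in> I - J" "b \<in> I - J" "a \<noteq> b"
  shows "M I J = 0"
proof -
  let ?t = "Transposition.transpose a b"
  have t: "?t permutes V" using ab I by (intro permutes_swap_id) auto
  have tI: "?t ` I = I" using ab by (intro transpose_image_eq) auto
  have "?t c = c" if "c \<in> J" for c using that ab by (metis DiffE transpose_apply_other)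
  then have tJ: "?t ` J = J" and "perm_sign_on ?t J = 1"
    using J by (auto simp: perm_sign_on_fixed)
  moreover have "perm_sign_on ?t I = -1"
    using ab I by (intro perm_sign_on_transpose) auto
  ultimately have "M I J = - M I J"
    using invariantD[OF M t I J] tI by simp
  then show ?thesis by simp
qed

lemma invariant_zero_right:
  assumes M: "invariant M" and I: "I \<subseteq> V" and J: "J \<subseteq> V" and ab: "a \<in> J - I" "b \<in> J - I" "a \<noteq> b"
  shows "M I J = 0"
  using invariant_zero[OF invariant_transpose[OF M] J I ab] .

text \<open>For each size of \<open>I\<close> the pairs considered form a single orbit, on which an
  invariant kernel is determined by one value. The offsets \<open>p\<close>, \<open>q\<close>,
  \<open>r\<close> prescribe the other two cardinalities without subtraction of natural
  numbers.\<close>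

lemma invariant_proportional:
  fixes p q r :: nat
  assumes M: "invariant M" and R: "invariant R"
    and ne: "\<And>I J. I \<subseteq> V \<Longrightarrow> J \<subseteq> V \<Longrightarrow> card J + p = card I + q \<Longrightarrow> card (I \<inter> J) + r = card I \<Longrightarrow> R I J \<noteq> 0"
  obtains \<gamma> :: "nat \<Rightarrow> real" where "\<And>I J. I \<subseteq> V \<Longrightarrow> J \<subseteq> V \<Longrightarrow> card J + p = card I + q \<Longrightarrow>
    card (I \<inter> J) + r = card I \<Longrightarrow> M I J = \<gamma> (card I) * R I J"
proof -
  have "\<exists>x. \<forall>I J. I \<subseteq> V \<longrightarrow> J \<subseteq> V \<longrightarrow> card I = k \<longrightarrow> card J + p = k + q \<longrightarrow> card (I \<inter> J) + r = k \<longrightarrow>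
    M I J = x * R I J" for k
  proof (cases "\<exists>I J. I \<subseteq> V \<and> J \<subseteq> V \<and> card I = k \<and> card J + p = k + q \<and> card (I \<inter> J) + r = k")
    case True
    then obtain I J where IJ: "I \<subseteq> V" "J \<subseteq> V" "card I = k" "card J + p = k + q" "card (I \<inter> J) + r = k" by blast
    have nz: "R I J \<noteq> 0" using ne IJ by simp
    show ?thesis
    proof (intro exI[of _ "M I J / R I J"] allI impI)
      fix I' J' assume IJ': "I' \<subseteq> V" "J' \<subseteq> V" "card I' = k" "card J' + p = k + q" "card (I' \<inter> J') + r = k"
      have "card I = card I'" "card J = card J'" "card (I \<inter> J) = card (I' \<inter> J')"
        using IJ IJ' by linarith+
      then obtain g where g: "g permutes V" "g ` I = I'" "g ` J = J'"
        using permutes_two_subsets[OF fin IJ(1,2) IJ'(1,2)] by auto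
      show "M I' J' = M I J / R I J * R I' J'"
        using invariantD[OF M g(1) IJ(1,2)] invariantD[OF R g(1) IJ(1,2)] g(2,3) nz
        by simp
    qed
  next
    case False
    then show ?thesis by blast
  qed
  from choice[OF allI[OF this]] obtain \<gamma> where \<gamma>: "\<forall>k I J. I \<subseteq> V \<longrightarrow> J \<subseteq> V \<longrightarrow>
      card I = k \<longrightarrow> card J + p = k + q \<longrightarrow> card (I \<inter> J) + r = k \<longrightarrow> M I J = \<gamma> k * R I J" ..
  show ?thesis by (rule that[of \<gamma>], rule \<gamma>[rule_format]) simp_all
qed

lemma contraction_square:
  assumes "J \<subseteq> V" "card J = Suc (card I)" "card (I \<inter> J) = card I" "I \<subseteq> V"
  shows "D I J * D I J = 1"
proof -
  have sub: "I \<subseteq> J" using card_subset_eq[of I "I \<inter> J"] assms by auto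
  then have "card (J - I) = 1" using assms by (simp add: card_Diff_subset)
  then obtain a where "J - I = {a}" by (auto simp: card_1_singleton_iff)
  then have a: "a \<notin> I" "J = insert a I" using sub by auto
  have "D I J = (\<Sum>b\<in>J. if b = a then position_sign a J else 0)"
    unfolding contraction_def by (rule sum.cong) (use a in auto)
  also have "\<dots> = position_sign a J" using a assms by simp
  finally show ?thesis by simp
qed

text \<open>The two sets differ by one exchange, so only \<open>I \<union> J\<close> can be the
  intermediate set and the sum defining \<open>laplace\<close> has a single nonzero term.\<close>

lemma laplace_exchange_nonzero:
  assumes "I \<subseteq> V" "J \<subseteq> V" "card J = card I" "Suc (card (I \<inter> J)) = card I"
  shows "laplace I J \<noteq> 0"
proof -
  have c: "card (I \<union> J) = Suc (card I)"
    using card_Un_Int[of I J] assms by simp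
  have un: "K = I \<union> J" if K: "K \<subseteq> V" "D I K * D J K \<noteq> 0" for K
  proof -
    have nz: "D I K \<noteq> 0" "D J K \<noteq> 0" using K(2) by auto
    obtain a where "I = K - {a}" using contraction_nonzeroE[OF nz(1)] .
    moreover obtain b where "J = K - {b}" using contraction_nonzeroE[OF nz(2)] .
    ultimately have "I \<union> J \<subseteq> K" by auto
    moreover have "card K = card (I \<union> J)" using contraction_card[of I K] K c by simp
    ultimately show ?thesis using K card_subset_eq[of K "I \<union> J"] by simp
  qed
  have "laplace I J = (\<Sum>K\<in>Pow V. if K = I \<union> J then D I (I \<union> J) * D J (I \<union> J) else 0)"
    unfolding laplace_def kernel_mult_def
  proof (rule sum.cong[OF refl])
    fix K assume "K \<in> Pow V"
    then show "D I K * D J K = (if K = I \<union> J then D I (I \<union> J) * D J (I \<union> J) else 0)"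
      using un[of K] by (cases "K = I \<union> J") auto
  qed
  also have "\<dots> = D I (I \<union> J) * D J (I \<union> J)" using assms fin by simp
  finally have L: "laplace I J = \<dots>" .
  have "D I (I \<union> J) * D I (I \<union> J) = 1" "D J (I \<union> J) * D J (I \<union> J) = 1"
    using assms c by (auto intro!: contraction_square simp: Int_absorb2)
  then show ?thesis unfolding L by auto
qed

text \<open>By \<open>invariant_zero\<close> and its mirror image, an invariant kernel lives on
  pairs for which both differences have at most one element. These are four orbit types per size of
  \<open>I\<close>, represented by the identity, \<open>laplace\<close>, \<open>D\<close> and
  \<open>Dt\<close>.\<close>

lemma invariant_decomposition:
  assumes M: "invariant M"
  obtains \<alpha> \<beta> \<gamma> \<delta> :: "nat \<Rightarrow> real" where "\<And>I J. I \<subseteq> V \<Longrightarrow> J \<subseteq> V \<Longrightarrow>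
    M I J = \<alpha> (card I) * (if I = J then 1 else 0) + \<beta> (card I) * laplace I J
      + \<gamma> (card I) * D I J + \<delta> (card I) * Dt I J"
proof -
  have id: "invariant (\<lambda>I J. if I = J then 1 else 0)"
    unfolding invariant_def
  proof (intro allI impI)
    fix g I J assume "g permutes V" "I \<subseteq> V" "J \<subseteq> V"
    then have "g ` I = g ` J \<longleftrightarrow> I = J" using perm_inj_on[of g UNIV] by (simp add: inj_image_eq_iff)
    then show "(if g ` I = g ` J then 1 else 0) = perm_sign_on g I * perm_sign_on g J * (if I = J then 1 else 0)"
      by simp
  qed
  have eqI: "I = J" if "I \<subseteq> V" "J \<subseteq> V" "card J = card I" "card (I \<inter> J) = card I" for I J
    using card_subset_eq[of I "I \<inter> J"] card_subset_eq[of J "I \<inter> J"] that by auto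
  obtain \<alpha> where \<alpha>: "\<And>I J. I \<subseteq> V \<Longrightarrow> J \<subseteq> V \<Longrightarrow> card J + 0 = card I + 0 \<Longrightarrow> card (I \<inter> J) + 0 = card I \<Longrightarrow>
      M I J = \<alpha> (card I) * (if I = J then 1 else 0)"
  proof (rule invariant_proportional[OF M id, of 0 0 0])
    fix I J assume "I \<subseteq> V" "J \<subseteq> V" "card J + 0 = card I + 0" "card (I \<inter> J) + 0 = card I"
    then show "(if I = J then 1 else 0::real) \<noteq> 0" using eqI[of I J] by simp
  qed blast
  obtain \<beta> where \<beta>: "\<And>I J. I \<subseteq> V \<Longrightarrow> J \<subseteq> V \<Longrightarrow> card J + 0 = card I + 0 \<Longrightarrow> card (I \<inter> J) + 1 = card I \<Longrightarrow>
      M I J = \<beta> (card I) * laplace I J"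
  proof (rule invariant_proportional[OF M invariant_laplace, of 0 0 1])
    fix I J assume "I \<subseteq> V" "J \<subseteq> V" "card J + 0 = card I + 0" "card (I \<inter> J) + 1 = card I"
    then show "laplace I J \<noteq> 0" using laplace_exchange_nonzero[of I J] by simp
  qed blast
  obtain \<gamma> where \<gamma>: "\<And>I J. I \<subseteq> V \<Longrightarrow> J \<subseteq> V \<Longrightarrow> card J + 0 = card I + 1 \<Longrightarrow> card (I \<inter> J) + 0 = card I \<Longrightarrow>
      M I J = \<gamma> (card I) * D I J"
  proof (rule invariant_proportional[OF M invariant_contraction, of 0 1 0])
    fix I J assume "I \<subseteq> V" "J \<subseteq> V" "card J + 0 = card I + 1" "card (I \<inter> J) + 0 = card I"
    then show "D I J \<noteq> 0" using contraction_square[of J I] by auto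
  qed blast
  obtain \<delta> where \<delta>: "\<And>I J. I \<subseteq> V \<Longrightarrow> J \<subseteq> V \<Longrightarrow> card J + 1 = card I + 0 \<Longrightarrow> card (I \<inter> J) + 1 = card I \<Longrightarrow>
      M I J = \<delta> (card I) * Dt I J"
  proof (rule invariant_proportional[OF M invariant_transpose[OF invariant_contraction], of 1 0 1])
    fix I J assume "I \<subseteq> V" "J \<subseteq> V" "card J + 1 = card I + 0" "card (I \<inter> J) + 1 = card I"
    then show "Dt I J \<noteq> 0" using contraction_square[of I J] by (auto simp: Int_commute)
  qed blast
  show ?thesis
  \<comment> \<open>\<open>laplace\<close> also has the diagonal entries \<open>card V - k\<close>,
    which the coefficient of the identity must compensate.\<close>
  proof (rule that[of "\<lambda>k. \<alpha> k - \<beta> k * real (card V - k)" \<beta> \<gamma> \<delta>])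
    fix I J assume I: "I \<subseteq> V" and J: "J \<subseteq> V"
    have ci: "card (I - J) + card (I \<inter> J) = card I" "card (J - I) + card (I \<inter> J) = card J"
      using card_Diff_subset_Int[of I J] card_Diff_subset_Int[of J I]
        card_mono[of I "I \<inter> J"] card_mono[of J "I \<inter> J"] I J by (auto simp: Int_commute)
    have D0: "D I J = 0" if "card J \<noteq> card I + 1" using contraction_card[OF _ J, of I] that by auto
    have Dt0: "Dt I J = 0" if "card I \<noteq> card J + 1" using contraction_card[OF _ I, of J] that by auto
    have L0: "laplace I J = 0" if "card I \<noteq> card J" using laplace_card[of I J] that by auto
    have big: "N I J = 0" if N: "invariant N" and "\<not> card (I - J) \<le> 1 \<or> \<not> card (J - I) \<le> 1" for N
      using that(2)
    proof
      assume "\<not> card (I - J) \<le> 1"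
      then obtain a b where "a \<in> I - J" "b \<in> I - J" "a \<noteq> b"
        using I by (auto simp: card_le_Suc0_iff_eq)
      then show ?thesis using invariant_zero[OF N I J] by blast
    next
      assume "\<not> card (J - I) \<le> 1"
      then obtain a b where "a \<in> J - I" "b \<in> J - I" "a \<noteq> b"
        using J by (auto simp: card_le_Suc0_iff_eq)
      then show ?thesis using invariant_zero_right[OF N I J] by blast
    qed
    consider "\<not> card (I - J) \<le> 1 \<or> \<not> card (J - I) \<le> 1"
      | "card (I - J) = 0" "card (J - I) = 0" | "card (I - J) = 1" "card (J - I) = 1"
      | "card (I - J) = 0" "card (J - I) = 1" | "card (I - J) = 1" "card (J - I) = 0" by linarith
    then show "M I J = (\<alpha> (card I) - \<beta> (card I) * real (card V - card I)) * (if I = J then 1 else 0)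
        + \<beta> (card I) * laplace I J + \<gamma> (card I) * D I J + \<delta> (card I) * Dt I J"
    proof cases
      case 1
      then have "I \<noteq> J" by auto
      then show ?thesis using big[OF M 1] big[OF invariant_laplace 1] big[OF invariant_contraction 1]
          big[OF invariant_transpose[OF invariant_contraction] 1] by simp
    next
      case 2
      then have "I = J" using eqI[OF I J] ci by simp
      moreover have "M I J = \<alpha> (card I) * (if I = J then 1 else 0)"
        using 2 ci by (intro \<alpha> I J) auto
      ultimately show ?thesis using laplace_diag[OF I] D0 Dt0 by (simp add: algebra_simps)
    next
      case 3
      then have "I \<noteq> J" by auto
      moreover have "M I J = \<beta> (card I) * laplace I J"
        using 3 ci by (intro \<beta> I J) auto
      ultimately show ?thesis using D0 Dt0 3 ci by simp
    next
      case 4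
      then have "I \<noteq> J" by auto
      moreover have "M I J = \<gamma> (card I) * D I J"
        using 4 ci by (intro \<gamma> I J) auto
      ultimately show ?thesis using L0 Dt0 4 ci by simp
    next
      case 5
      then have "I \<noteq> J" by auto
      moreover have "M I J = \<delta> (card I) * Dt I J"
        using 5 ci by (intro \<delta> I J) auto
      ultimately show ?thesis using L0 D0 5 ci by simp
    qed
  qed
qed

end

section \<open>Schur orthogonality for the exterior powers of the standard representation\<close>

context signed_subsets
begin

abbreviation Perms :: "('a \<Rightarrow> 'a) set" where "Perms \<equiv> {g. g permutes V}"

lemma contraction_laplace_zero:
  assumes "I \<subseteq> V" "J \<subseteq> V"
  shows "(D \<bullet> laplace) I J = 0" "(laplace \<bullet> Dt) I J = 0"
proof -
  have "(D \<bullet> laplace) I J = ((D \<bullet> D) \<bullet> Dt) I J"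
    unfolding laplace_def by (simp only: kernel_mult_assoc[OF fin])
  also have "\<dots> = 0" unfolding kernel_mult_def[of V "D \<bullet> D"]
    by (rule sum.neutral) (simp add: contraction_twice assms)
  finally show "(D \<bullet> laplace) I J = 0" .
  have "(laplace \<bullet> Dt) I J = (D \<bullet> (Dt \<bullet> Dt)) I J"
    unfolding laplace_def by (simp only: kernel_mult_assoc[OF fin])
  also have "\<dots> = 0" unfolding kernel_mult_def[of V D]
  proof (rule sum.neutral, rule ballI)
    fix K assume "K \<in> Pow V"
    have "(Dt \<bullet> Dt) K J = (D \<bullet> D) J K" by (simp add: kernel_mult_def mult.commute)
    then show "D I K * (Dt \<bullet> Dt) K J = 0" using contraction_twice assms \<open>K \<in> Pow V\<close> by simp
  qed
  finally show "(laplace \<bullet> Dt) I J = 0" .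
qed

text \<open>Schur's lemma: the commutant compressed to the kernel of the contraction is one-dimensional
  in each degree.\<close>

lemma laplace_sandwich:
  assumes M: "invariant M"
  obtains c :: "nat \<Rightarrow> real" where "\<And>I J. I \<subseteq> V \<Longrightarrow> J \<subseteq> V \<Longrightarrow>
    (laplace \<bullet> (M \<bullet> laplace)) I J = c (card I) * laplace I J"
proof -
  obtain \<alpha> \<beta> \<gamma> \<delta> :: "nat \<Rightarrow> real" where dec: "\<And>I J. I \<subseteq> V \<Longrightarrow> J \<subseteq> V \<Longrightarrow>
    M I J = \<alpha> (card I) * (if I = J then 1 else 0) + \<beta> (card I) * laplace I J
      + \<gamma> (card I) * D I J + \<delta> (card I) * Dt I J"
    by (rule invariant_decomposition[OF M]) blast
  let ?n = "real (card V)"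
  show ?thesis
  \<comment> \<open>Between two factors \<open>laplace\<close> the \<open>D\<close> and
    \<open>Dt\<close> terms vanish, the identity becomes \<open>?n * laplace\<close>, and
    \<open>laplace\<close> becomes \<open>?n * ?n * laplace\<close>.\<close>
  proof (rule that[of "\<lambda>k. ?n * (\<alpha> k + ?n * \<beta> k)"])
    fix I J assume I: "I \<subseteq> V" and J: "J \<subseteq> V"
    have MLap: "(M \<bullet> laplace) K J = (\<alpha> (card K) + ?n * \<beta> (card K)) * laplace K J + \<delta> (card K) * (Dt \<bullet> laplace) K J"
      if K: "K \<subseteq> V" for K
    proof -
      have "(M \<bullet> laplace) K J = (\<Sum>P\<in>Pow V. \<alpha> (card K) * (if P = K then laplace P J else 0)
        + \<beta> (card K) * (laplace K P * laplace P J) + \<gamma> (card K) * (D K P * laplace P J)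
        + \<delta> (card K) * (Dt K P * laplace P J))"
        unfolding kernel_mult_def
      proof (rule sum.cong[OF refl])
        fix P assume "P \<in> Pow V"
        then show "M K P * laplace P J = \<alpha> (card K) * (if P = K then laplace P J else 0)
          + \<beta> (card K) * (laplace K P * laplace P J) + \<gamma> (card K) * (D K P * laplace P J)
          + \<delta> (card K) * (Dt K P * laplace P J)"
          using dec[OF K, of P] by (cases "P = K") (simp_all add: algebra_simps)
      qed
      also have "\<dots> = \<alpha> (card K) * laplace K J + \<beta> (card K) * (laplace \<bullet> laplace) K J
          + \<gamma> (card K) * (D \<bullet> laplace) K J + \<delta> (card K) * (Dt \<bullet> laplace) K J"
        using K fin by (simp add: sum.distrib kernel_mult_def flip: sum_distrib_left)
      finally show ?thesis
        using laplace_idem[OF K J] contraction_laplace_zero(1)[OF K J] by (simp add: algebra_simps)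
    qed
    have "(laplace \<bullet> (M \<bullet> laplace)) I J = (\<Sum>K\<in>Pow V. (\<alpha> (card I) + ?n * \<beta> (card I)) * (laplace I K * laplace K J)
        + \<delta> (card I) * (laplace I K * (Dt \<bullet> laplace) K J))"
      unfolding kernel_mult_def[of V laplace "M \<bullet> laplace"]
    proof (rule sum.cong[OF refl])
      fix K assume K: "K \<in> Pow V"
      show "laplace I K * (M \<bullet> laplace) K J = (\<alpha> (card I) + ?n * \<beta> (card I)) * (laplace I K * laplace K J)
        + \<delta> (card I) * (laplace I K * (Dt \<bullet> laplace) K J)"
      \<comment> \<open>The coefficients of \<open>M\<close> belong to the row \<open>K\<close>;
        since \<open>laplace\<close> preserves cardinality, they may be read at
        \<open>I\<close>.\<close>
      proof (cases "laplace I K = 0")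
        case False
        then have "card K = card I" using laplace_card by simp
        then show ?thesis using MLap K by (simp add: algebra_simps)
      qed simp
    qed
    also have "\<dots> = (\<alpha> (card I) + ?n * \<beta> (card I)) * (laplace \<bullet> laplace) I J
        + \<delta> (card I) * (laplace \<bullet> (Dt \<bullet> laplace)) I J"
      by (simp add: sum.distrib kernel_mult_def[of V laplace] flip: sum_distrib_left)
    also have "(laplace \<bullet> (Dt \<bullet> laplace)) I J = ((laplace \<bullet> Dt) \<bullet> laplace) I J"
      by (simp only: kernel_mult_assoc[OF fin])
    also have "\<dots> = 0" unfolding kernel_mult_def[of V "laplace \<bullet> Dt"]
      by (rule sum.neutral) (simp add: contraction_laplace_zero I)
    finally show "(laplace \<bullet> (M \<bullet> laplace)) I J = ?n * (\<alpha> (card I) + ?n * \<beta> (card I)) * laplace I J"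
      using laplace_idem[OF I J] by (simp add: algebra_simps)
  qed
qed

lemma perm_card_image [simp]: "g permutes V \<Longrightarrow> card (g ` J) = card J"
  by (simp add: card_image perm_inj_on)

lemma finite_Perms: "finite Perms"
  using fin by (rule finite_permutations)

text \<open>The sum over the group of the conjugates of the matrix unit at \<open>(I, J)\<close>.\<close>

definition orbit_kernel :: "'a set \<Rightarrow> 'a set \<Rightarrow> 'a set \<Rightarrow> 'a set \<Rightarrow> real" where
  "orbit_kernel I J P Q = (\<Sum>g\<in>Perms. if g ` I = P \<and> g ` J = Q
     then perm_sign_on g I * perm_sign_on g J else 0)"

lemma invariant_orbit_kernel:
  assumes I: "I \<subseteq> V" and J: "J \<subseteq> V"
  shows "invariant (orbit_kernel I J)"
  unfolding invariant_def
proof (intro allI impI)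
  fix h P Q assume h: "h permutes V" and P: "P \<subseteq> V" and Q: "Q \<subseteq> V"
  let ?s = perm_sign_on
  have inj: "inj h" using h by (rule permutes_inj)
  have "orbit_kernel I J (h ` P) (h ` Q) = (\<Sum>g\<in>Perms. if (h \<circ> g) ` I = h ` P \<and> (h \<circ> g) ` J = h ` Q
     then ?s (h \<circ> g) I * ?s (h \<circ> g) J else 0)"
    unfolding orbit_kernel_def by (rule setum_permutations_compose_left[OF h])
  also have "\<dots> = (\<Sum>g\<in>Perms. ?s h P * ?s h Q * (if g ` I = P \<and> g ` J = Q then ?s g I * ?s g J else 0))"
  proof (rule sum.cong[OF refl])
    fix g assume g: "g \<in> Perms"
    have iff: "(h \<circ> g) ` K = h ` L \<longleftrightarrow> g ` K = L" for K L
      unfolding image_comp[symmetric] by (rule inj_image_eq_iff[OF inj])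
    have co: "?s (h \<circ> g) K = ?s h (g ` K) * ?s g K" if "K \<subseteq> V" for K
      using that g h by (intro perm_sign_on_compose) (auto intro: perm_inj_on)
    show "(if (h \<circ> g) ` I = h ` P \<and> (h \<circ> g) ` J = h ` Q then ?s (h \<circ> g) I * ?s (h \<circ> g) J else 0)
      = ?s h P * ?s h Q * (if g ` I = P \<and> g ` J = Q then ?s g I * ?s g J else 0)"
      unfolding iff co[OF I] co[OF J] by simp
  qed
  finally show "orbit_kernel I J (h ` P) (h ` Q) = ?s h P * ?s h Q * orbit_kernel I J P Q"
    unfolding orbit_kernel_def sum_distrib_left .
qed

lemma sum_orbit_kernel:
  assumes I: "I \<subseteq> V" and J: "J \<subseteq> V"
  shows "(\<Sum>P\<in>Pow V. \<Sum>Q\<in>Pow V. F P Q * orbit_kernel I J P Q)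
    = (\<Sum>g\<in>Perms. F (g ` I) (g ` J) * (perm_sign_on g I * perm_sign_on g J))"
proof -
  let ?s = "\<lambda>g. perm_sign_on g I * perm_sign_on g J"
  have "(\<Sum>P\<in>Pow V. \<Sum>Q\<in>Pow V. F P Q * orbit_kernel I J P Q)
    = (\<Sum>P\<in>Pow V. \<Sum>Q\<in>Pow V. \<Sum>g\<in>Perms. if g ` I = P \<and> g ` J = Q then F P Q * ?s g else 0)"
    unfolding orbit_kernel_def sum_distrib_left by (intro sum.cong refl) simp
  also have "\<dots> = (\<Sum>P\<in>Pow V. \<Sum>g\<in>Perms. \<Sum>Q\<in>Pow V. if g ` I = P \<and> g ` J = Q then F P Q * ?s g else 0)"
    by (intro sum.cong refl sum.swap)
  also have "\<dots> = (\<Sum>g\<in>Perms. \<Sum>P\<in>Pow V. \<Sum>Q\<in>Pow V. if g ` I = P \<and> g ` J = Q then F P Q * ?s g else 0)"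
    by (rule sum.swap)
  also have "\<dots> = (\<Sum>g\<in>Perms. F (g ` I) (g ` J) * ?s g)"
  proof (rule sum.cong[OF refl])
    fix g assume "g \<in> Perms"
    then have gI: "g ` I \<in> Pow V" and gJ: "g ` J \<in> Pow V"
      using I J perm_image_sub by auto
    have "(\<Sum>P\<in>Pow V. \<Sum>Q\<in>Pow V. if g ` I = P \<and> g ` J = Q then F P Q * ?s g else 0)
      = (\<Sum>P\<in>Pow V. if P = g ` I then (\<Sum>Q\<in>Pow V. if Q = g ` J then F P Q * ?s g else 0) else 0)"
      by (intro sum.cong refl) (auto simp: eq_commute intro!: sum.neutral sum.cong)
    also have "\<dots> = F (g ` I) (g ` J) * ?s g"
      using gI gJ fin by simp
    finally show "(\<Sum>P\<in>Pow V. \<Sum>Q\<in>Pow V. if g ` I = P \<and> g ` J = Q then F P Q * ?s g else 0)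
      = F (g ` I) (g ` J) * ?s g" .
  qed
  finally show ?thesis .
qed

definition level :: "nat \<Rightarrow> 'a set set" where
  "level k = {J \<in> Pow V. card J = k}"

lemma finite_level [simp]: "finite (level k)"
  using fin by (simp add: level_def)

lemma level_sub: "J \<in> level k \<Longrightarrow> J \<subseteq> V"
  by (auto simp: level_def)

text \<open>Since \<open>laplace\<close> is \<open>card V\<close> times a projection onto the exterior powers of the standard
  representation, this is \<open>card V\<close> times the character \<open>\<chi>\<^sub>k\<close>.\<close>

definition hook_char :: "nat \<Rightarrow> ('a \<Rightarrow> 'a) \<Rightarrow> real" where
  "hook_char k g = (\<Sum>J\<in>level k. laplace J (g ` J) * perm_sign_on g J)"

text \<open>Cyclicity of the trace merges the two factors \<open>laplace\<close> into
  \<open>card V * laplace\<close>; by invariance every permutation then contributes the same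
  value.\<close>

lemma trace_laplace_orbit_kernel:
  assumes I: "I \<subseteq> V" and J: "J \<subseteq> V"
  shows "(\<Sum>P\<in>Pow V. (laplace \<bullet> (orbit_kernel I J \<bullet> laplace)) P P)
    = card V * fact (card V) * laplace J I"
proof -
  let ?A = "orbit_kernel I J"
  have "(\<Sum>P\<in>Pow V. (laplace \<bullet> (?A \<bullet> laplace)) P P)
    = (\<Sum>P\<in>Pow V. \<Sum>Q\<in>Pow V. \<Sum>R\<in>Pow V. laplace R P * laplace P Q * ?A Q R)"
    unfolding kernel_mult_def sum_distrib_left by (simp only: mult_ac)
  also have "\<dots> = (\<Sum>Q\<in>Pow V. \<Sum>P\<in>Pow V. \<Sum>R\<in>Pow V. laplace R P * laplace P Q * ?A Q R)"
    by (rule sum.swap)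
  also have "\<dots> = (\<Sum>Q\<in>Pow V. \<Sum>R\<in>Pow V. \<Sum>P\<in>Pow V. laplace R P * laplace P Q * ?A Q R)"
    by (intro sum.cong refl sum.swap)
  also have "\<dots> = (\<Sum>Q\<in>Pow V. \<Sum>R\<in>Pow V. (card V * laplace R Q) * ?A Q R)"
  proof (intro sum.cong refl)
    fix Q R assume "Q \<in> Pow V" "R \<in> Pow V"
    then show "(\<Sum>P\<in>Pow V. laplace R P * laplace P Q * ?A Q R) = card V * laplace R Q * ?A Q R"
      using laplace_idem[of R Q] by (simp add: kernel_mult_def flip: sum_distrib_right)
  qed
  also have "\<dots> = (\<Sum>g\<in>Perms. (card V * laplace (g ` J) (g ` I)) * (perm_sign_on g I * perm_sign_on g J))"
    by (rule sum_orbit_kernel[OF I J])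
  also have "\<dots> = (\<Sum>g\<in>Perms. card V * laplace J I)"
  proof (rule sum.cong[OF refl])
    fix g assume "g \<in> Perms"
    then show "(card V * laplace (g ` J) (g ` I)) * (perm_sign_on g I * perm_sign_on g J) = card V * laplace J I"
      using invariantD[OF invariant_laplace _ J I, of g] by (simp add: mult_ac)
  qed
  also have "\<dots> = card V * fact (card V) * laplace J I"
    using fin by (simp add: card_permutations)
  finally show ?thesis .
qed

lemma orbit_kernel_card:
  assumes "orbit_kernel I J P Q \<noteq> 0"
  shows "card P = card I"
proof -
  obtain g where "g \<in> Perms" "(if g ` I = P \<and> g ` J = Q then perm_sign_on g I * perm_sign_on g J else 0) \<noteq> 0"
    using sum.not_neutral_contains_not_neutral[OF assms[unfolded orbit_kernel_def]] .
  then have "g permutes V" "g ` I = P" by (auto split: if_splits)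
  then show ?thesis using perm_card_image by metis
qed

text \<open>The trace of \<open>card V\<close> times a projection, hence \<open>card V\<close> times
  the dimension of the \<open>k\<close>-th exterior power of the standard representation.\<close>

definition level_trace :: "nat \<Rightarrow> real" where
  "level_trace k = (\<Sum>J\<in>level k. laplace J J)"

text \<open>Schur orthogonality of matrix coefficients: the constant of
  \<open>laplace_sandwich\<close> is found by comparing traces. It stays multiplied by
  \<open>level_trace k\<close>, which avoids a division.\<close>

lemma laplace_orbit_sandwich:
  assumes I: "I \<in> level k" and J: "J \<subseteq> V" and K: "K \<subseteq> V"
  shows "level_trace k * (laplace \<bullet> (orbit_kernel I J \<bullet> laplace)) I K
    = card V * fact (card V) * laplace J I * laplace I K"
proof -
  let ?B = "laplace \<bullet> (orbit_kernel I J \<bullet> laplace)"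
  have IV: "I \<subseteq> V" and cI: "card I = k" using I by (auto simp: level_def)
  obtain c where c: "\<And>P Q. P \<subseteq> V \<Longrightarrow> Q \<subseteq> V \<Longrightarrow> ?B P Q = c (card P) * laplace P Q"
    by (rule laplace_sandwich[OF invariant_orbit_kernel[OF IV J]]) blast
  \<comment> \<open>\<open>orbit_kernel I J\<close> has nonzero rows only at sets of the size of
    \<open>I\<close>, so the trace is concentrated on level \<open>k\<close>.\<close>
  have off: "?B P P = 0" if "P \<subseteq> V" "card P \<noteq> k" for P
    unfolding kernel_mult_def[of V laplace]
  proof (rule sum.neutral, rule ballI)
    fix Q assume "Q \<in> Pow V"
    show "laplace P Q * (orbit_kernel I J \<bullet> laplace) Q P = 0"
    proof (cases "card Q = k")
      case True then show ?thesis using laplace_card[of P Q] that by auto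
    next
      case False
      then have "(orbit_kernel I J \<bullet> laplace) Q P = 0"
        unfolding kernel_mult_def using orbit_kernel_card[of I J Q] cI by (intro sum.neutral) auto
      then show ?thesis by simp
    qed
  qed
  have "(\<Sum>P\<in>Pow V. ?B P P) = (\<Sum>P\<in>level k. ?B P P)"
    by (rule sum.mono_neutral_right) (use fin off in \<open>auto simp: level_def\<close>)
  also have "\<dots> = c k * level_trace k"
    unfolding level_trace_def sum_distrib_left by (rule sum.cong) (auto simp: c level_def)
  finally have "c k * level_trace k = card V * fact (card V) * laplace J I"
    using trace_laplace_orbit_kernel[OF IV J] by simp
  then show ?thesis using c[OF IV K] cI by (simp add: mult_ac)
qed

lemma hook_char_compose:
  assumes "g permutes V" "t permutes V"
  shows "hook_char l (g \<circ> t) = (\<Sum>J\<in>level l. laplace J (g ` t ` J) * perm_sign_on g (t ` J) * perm_sign_on t J)"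
  unfolding hook_char_def
proof (rule sum.cong[OF refl])
  fix J assume "J \<in> level l"
  then have "perm_sign_on (g \<circ> t) J = perm_sign_on g (t ` J) * perm_sign_on t J"
    using assms by (intro perm_sign_on_compose) (auto intro: perm_inj_on dest: level_sub)
  then show "laplace J ((g \<circ> t) ` J) * perm_sign_on (g \<circ> t) J
      = laplace J (g ` t ` J) * perm_sign_on g (t ` J) * perm_sign_on t J"
    by (simp add: image_comp)
qed

text \<open>Up to powers of \<open>card V\<close>, the convolution rule for real irreducible
  characters: the sum of \<open>\<chi>\<^sub>k(g) \<chi>\<^sub>l(g t)\<close> over \<open>g\<close>,
  times the dimension \<open>d\<^sub>k\<close>, is \<open>n! \<chi>\<^sub>k(t)\<close> if
  \<open>k = l\<close> and 0 otherwise. The sum over the group is taken entry by entry, where it is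
  an entry of a sandwiched \<open>orbit_kernel\<close>.\<close>

lemma hook_char_convolution:
  assumes t: "t permutes V"
  shows "level_trace k * (\<Sum>g\<in>Perms. hook_char k g * hook_char l (g \<circ> t))
    = (if k = l then (real (card V))\<^sup>2 * fact (card V) * hook_char k t else 0)"
proof -
  let ?s = perm_sign_on and ?L = laplace
  let ?B = "\<lambda>I J. ?L \<bullet> (orbit_kernel I J \<bullet> ?L)"
  let ?n = "real (card V)"
  have tJ: "t ` J \<subseteq> V" if "J \<in> level l" for J l
    using perm_image_sub[OF t level_sub[OF that]] .
  have "(\<Sum>g\<in>Perms. hook_char k g * hook_char l (g \<circ> t))
    = (\<Sum>g\<in>Perms. \<Sum>I\<in>level k. \<Sum>J\<in>level l. ?s t J * (?L I (g ` I) * ?L (g ` t ` J) J * (?s g I * ?s g (t ` J))))"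
  proof (rule sum.cong[OF refl])
    fix g assume "g \<in> Perms"
    then have e: "hook_char l (g \<circ> t) = (\<Sum>J\<in>level l. ?L (g ` t ` J) J * ?s g (t ` J) * ?s t J)"
      using hook_char_compose[of g t l] t by (simp add: laplace_commute)
    show "hook_char k g * hook_char l (g \<circ> t)
      = (\<Sum>I\<in>level k. \<Sum>J\<in>level l. ?s t J * (?L I (g ` I) * ?L (g ` t ` J) J * (?s g I * ?s g (t ` J))))"
      unfolding e unfolding hook_char_def sum_product by (simp only: mult_ac)
  qed
  also have "\<dots> = (\<Sum>I\<in>level k. \<Sum>g\<in>Perms. \<Sum>J\<in>level l. ?s t J * (?L I (g ` I) * ?L (g ` t ` J) J * (?s g I * ?s g (t ` J))))"
    by (rule sum.swap)
  also have "\<dots> = (\<Sum>I\<in>level k. \<Sum>J\<in>level l. \<Sum>g\<in>Perms. ?s t J * (?L I (g ` I) * ?L (g ` t ` J) J * (?s g I * ?s g (t ` J))))"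
    by (intro sum.cong refl sum.swap)
  also have "\<dots> = (\<Sum>I\<in>level k. \<Sum>J\<in>level l. ?s t J * ?B I (t ` J) I J)"
  proof (intro sum.cong refl)
    fix I J assume I: "I \<in> level k" and J: "J \<in> level l"
    have "?B I (t ` J) I J = (\<Sum>P\<in>Pow V. \<Sum>Q\<in>Pow V. (?L I P * ?L Q J) * orbit_kernel I (t ` J) P Q)"
      unfolding kernel_mult_def sum_distrib_left by (simp only: mult_ac)
    also have "\<dots> = (\<Sum>g\<in>Perms. ?L I (g ` I) * ?L (g ` t ` J) J * (?s g I * ?s g (t ` J)))"
      by (rule sum_orbit_kernel[OF level_sub[OF I] tJ[OF J]])
    finally show "(\<Sum>g\<in>Perms. ?s t J * (?L I (g ` I) * ?L (g ` t ` J) J * (?s g I * ?s g (t ` J))))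
        = ?s t J * ?B I (t ` J) I J"
      by (simp add: sum_distrib_left)
  qed
  finally have "level_trace k * (\<Sum>g\<in>Perms. hook_char k g * hook_char l (g \<circ> t))
      = (\<Sum>I\<in>level k. \<Sum>J\<in>level l. ?s t J * (level_trace k * ?B I (t ` J) I J))"
    by (simp only: sum_distrib_left mult.left_commute)
  also have "\<dots> = (\<Sum>I\<in>level k. \<Sum>J\<in>level l. ?s t J * (?n * fact (card V) * ?L (t ` J) I * ?L I J))"
  proof (intro sum.cong refl)
    fix I J assume I: "I \<in> level k" and J: "J \<in> level l"
    show "?s t J * (level_trace k * ?B I (t ` J) I J) = ?s t J * (?n * fact (card V) * ?L (t ` J) I * ?L I J)"
      using laplace_orbit_sandwich[OF I tJ[OF J] level_sub[OF J]] by simp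
  qed
  also have "\<dots> = (if k = l then ?n\<^sup>2 * fact (card V) * hook_char k t else 0)"
  proof (cases "k = l")
    case False
    \<comment> \<open>\<open>laplace\<close> does not mix sizes, so coefficients of different levels
      are orthogonal.\<close>
    have "?L I J = 0" if "I \<in> level k" "J \<in> level l" for I J
      using laplace_card[of I J] that False by (auto simp: level_def)
    then show ?thesis using False by simp
  next
    case True
    have "(\<Sum>I\<in>level k. \<Sum>J\<in>level l. ?s t J * (?n * fact (card V) * ?L (t ` J) I * ?L I J))
      = (\<Sum>J\<in>level l. \<Sum>I\<in>level k. ?s t J * (?n * fact (card V) * ?L (t ` J) I * ?L I J))"
      by (rule sum.swap)
    also have "\<dots> = (\<Sum>J\<in>level k. ?n\<^sup>2 * fact (card V) * (?L J (t ` J) * ?s t J))"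
      unfolding True[symmetric]
    proof (intro sum.cong refl)
      fix J assume J: "J \<in> level k"
      have "(\<Sum>I\<in>level k. ?L (t ` J) I * ?L I J) = (\<Sum>I\<in>Pow V. ?L (t ` J) I * ?L I J)"
      proof (rule sum.mono_neutral_left)
        show "\<forall>I\<in>Pow V - level k. ?L (t ` J) I * ?L I J = 0"
        proof
          fix I assume "I \<in> Pow V - level k"
          then have "card I \<noteq> card J" using J by (auto simp: level_def)
          then show "?L (t ` J) I * ?L I J = 0" using laplace_card[of I J] by auto
        qed
      qed (use fin in \<open>auto simp: level_def\<close>)
      also have "\<dots> = ?n * ?L (t ` J) J"
        using laplace_idem[OF tJ[OF J] level_sub[OF J]] by (simp add: kernel_mult_def)
      finally have e: "(\<Sum>I\<in>level k. ?L (t ` J) I * ?L I J) = ?n * ?L J (t ` J)"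
        by (simp add: laplace_commute)
      have "(\<Sum>I\<in>level k. ?s t J * (?n * fact (card V) * ?L (t ` J) I * ?L I J))
        = ?s t J * (?n * fact (card V)) * (\<Sum>I\<in>level k. ?L (t ` J) I * ?L I J)"
        by (simp add: sum_distrib_left mult_ac)
      then show "(\<Sum>I\<in>level k. ?s t J * (?n * fact (card V) * ?L (t ` J) I * ?L I J))
        = ?n\<^sup>2 * fact (card V) * (?L J (t ` J) * ?s t J)"
        unfolding e by (simp add: power2_eq_square mult_ac)
    qed
    finally show ?thesis using True by (simp add: hook_char_def sum_distrib_left)
  qed
  finally show ?thesis .
qed

end

section \<open>Invariant subsets and cycles\<close>

lemma perm_sign_on_cong:
  assumes "finite J" "\<And>x. x \<in> J \<Longrightarrow> g x = h x"
  shows "perm_sign_on g J = perm_sign_on h J"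
  unfolding perm_sign_on_def
proof (rule prod.cong[OF refl])
  fix e assume e: "e \<in> {e. e \<subseteq> J \<and> card e = 2}"
  then have "finite e" "e \<noteq> {}" using assms(1) finite_subset by auto
  then have "Max e \<in> J" "Min e \<in> J" using e Max_in Min_in by blast+
  then show "ord_sign (g (Max e)) (g (Min e)) = ord_sign (h (Max e)) (h (Min e))"
    using assms(2) by simp
qed

lemma perm_sign_on_eq_sign:
  assumes "finite B" "g permutes B"
  shows "perm_sign_on g B = of_int (sign g)"
  using assms(2,1)
proof (induction rule: permutes_induct)
  case id
  then show ?case using assms(1) by (simp add: perm_sign_on_fixed)
next
  case (swap a b p)
  have p: "p ` B = B" "inj_on p B" using swap.hyps(4) by (auto simp: permutes_image permutes_inj_on)
  have e1: "perm_sign_on (Transposition.transpose a b \<circ> p) B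
    = perm_sign_on (Transposition.transpose a b) B * perm_sign_on p B"
    using p by (subst perm_sign_on_compose) (auto simp: assms(1) intro: inj_on_subset)
  have e2: "sign (Transposition.transpose a b \<circ> p) = - sign p"
  proof (subst sign_compose)
    show "permutation p" using swap assms(1) by (auto simp: permutation_permutes)
  qed (use swap in \<open>simp_all add: sign_swap_id permutation_swap_id\<close>)
  show ?case unfolding e1 e2 using swap assms(1) by (simp add: perm_sign_on_transpose)
qed

lemma sign_cycle_of_list:
  assumes "cycle cs" "cs \<noteq> []"
  shows "sign (cycle_of_list cs) = (-1) ^ (length cs - 1)"
  using assms
proof (induction cs rule: cycle_of_list.induct)
  case (1 i j cs)
  have "sign (cycle_of_list (i # j # cs)) = - sign (cycle_of_list (j # cs))"
    unfolding cycle_of_list.simps(1) sign_compose[OF permutation_swap_id permutation_of_cycle]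
    using 1 by (simp add: sign_swap_id)
  moreover have "sign (cycle_of_list (j # cs)) = (-1) ^ length cs" using 1 by simp
  ultimately show ?case by (simp del: cycle_of_list.simps)
qed simp_all

lemma perm_sign_on_union:
  assumes "finite A" "finite B" "A \<inter> B = {}" "inj_on g (A \<union> B)"
  shows "perm_sign_on g (A \<union> B) = perm_sign_on g A * perm_sign_on g B *
    (\<Prod>a\<in>A. \<Prod>b\<in>B. ord_sign a b * ord_sign (g a) (g b))"
  using assms
proof (induction A rule: finite_induct)
  case (insert a A)
  have i1: "inj_on g (insert a (A \<union> B))" using insert.prems by simp
  have i2: "inj_on g (insert a A)" using i1 by (rule inj_on_subset) auto
  have i3: "inj_on g (A \<union> B)" using i1 by (rule inj_on_subset) auto
  have n: "a \<notin> A \<union> B" "finite (A \<union> B)" "A \<inter> B = {}" using insert by auto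
  have "perm_sign_on g (insert a (A \<union> B)) = perm_sign_on g (A \<union> B) *
      (\<Prod>b\<in>A \<union> B. ord_sign a b * ord_sign (g a) (g b))"
    by (rule perm_sign_on_insert[OF n(2,1) i1])
  also have "(\<Prod>b\<in>A \<union> B. ord_sign a b * ord_sign (g a) (g b)) =
      (\<Prod>b\<in>A. ord_sign a b * ord_sign (g a) (g b)) * (\<Prod>b\<in>B. ord_sign a b * ord_sign (g a) (g b))"
    using insert n by (intro prod.union_disjoint) auto
  also have "perm_sign_on g (A \<union> B) = perm_sign_on g A * perm_sign_on g B *
    (\<Prod>a\<in>A. \<Prod>b\<in>B. ord_sign a b * ord_sign (g a) (g b))"
    using insert.IH insert.prems(1) n i3 by blast
  finally show ?case
    using insert.hyps i2 by (simp add: perm_sign_on_insert mult_ac)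
qed simp

text \<open>Since \<open>g\<close> permutes the pairs with one point in \<open>A\<close> and one in
  \<open>B\<close>, the cross pairs contribute the same product before and after \<open>g\<close>,
  and the two multiply to 1.\<close>

lemma perm_sign_on_invariant_union:
  assumes "finite A" "finite B" "A \<inter> B = {}" "inj g" "g ` A = A" "g ` B = B"
  shows "perm_sign_on g (A \<union> B) = perm_sign_on g A * perm_sign_on g B"
proof -
  have inj: "inj_on g X" for X using assms(4) by (rule inj_on_subset) auto
  have inner: "(\<Prod>b\<in>B. ord_sign a (g b)) = (\<Prod>b\<in>B. ord_sign a b)" for a
    using prod.reindex[OF inj[of B], of "ord_sign a"] assms(6) by simp
  have "(\<Prod>a\<in>A. \<Prod>b\<in>B. ord_sign a b * ord_sign (g a) (g b))
    = (\<Prod>a\<in>A. \<Prod>b\<in>B. ord_sign a b) * (\<Prod>a\<in>A. (\<Prod>b\<in>B. ord_sign (g a) b))"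
    by (simp add: prod.distrib inner)
  also have "(\<Prod>a\<in>A. (\<Prod>b\<in>B. ord_sign (g a) b)) = (\<Prod>a\<in>A. \<Prod>b\<in>B. ord_sign a b)"
    using prod.reindex[OF inj[of A], of "\<lambda>a. \<Prod>b\<in>B. ord_sign a b"] assms(5) by simp
  also have "(\<Prod>a\<in>A. \<Prod>b\<in>B. ord_sign a b) * (\<Prod>a\<in>A. \<Prod>b\<in>B. ord_sign a b) = 1"
    by (simp flip: prod.distrib)
  finally show ?thesis using perm_sign_on_union[OF assms(1-3) inj] by simp
qed

text \<open>For an invariant \<open>J\<close>, the contribution of the principal minor at
  \<open>J\<close> to the determinant of \<open>1 - g\<close> on the permutation module.\<close>

definition signed_weight :: "('a::linorder \<Rightarrow> 'a) \<Rightarrow> 'a set \<Rightarrow> real" where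
  "signed_weight g J = (-1) ^ card J * perm_sign_on g J"

definition invariant_subsets :: "('a \<Rightarrow> 'a) \<Rightarrow> 'a set \<Rightarrow> 'a set set" where
  "invariant_subsets g W = {J. J \<subseteq> W \<and> g ` J = J}"

text \<open>\<open>B\<close> is the orbit of \<open>x\<close>, listed by \<open>support\<close> as a
  cycle. A cycle of length \<open>l\<close> has sign \<open>(-1) ^ (l - 1)\<close>, which against
  the factor \<open>(-1) ^ l\<close> leaves -1 for every \<open>l\<close>.\<close>

lemma orbit_properties:
  assumes fin: "finite W" and g: "permutation g" and W: "g ` W = W" and x: "x \<in> W"
  defines "B \<equiv> set (support g x)"
  shows "x \<in> B" "B \<subseteq> W" "g ` B = B" "\<And>J. g ` J = J \<Longrightarrow> J \<inter> B \<noteq> {} \<Longrightarrow> B \<subseteq> J"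
    "signed_weight g B = -1"
proof -
  have B: "B = range (\<lambda>i. (g ^^ i) x)" unfolding B_def by (rule support_set[OF g])
  show xB: "x \<in> B" unfolding B using range_eqI[of x "\<lambda>i. (g ^^ i) x" 0] by simp
  have pow: "(g ^^ i) y \<in> J" if "g ` J = J" "y \<in> J" for i y J
    using that by (induction i) auto
  show BW: "B \<subseteq> W" unfolding B using pow[OF W x] by auto
  have finB: "finite B" unfolding B_def by simp
  have "g ` B \<subseteq> B"
  proof
    fix y assume "y \<in> g ` B"
    then obtain i where "y = (g ^^ Suc i) x" unfolding B by auto
    then show "y \<in> B" unfolding B by (metis rangeI)
  qed
  moreover have "inj g" using g by (simp add: permutation_bijective bij_is_inj)
  ultimately show gB: "g ` B = B"
    using finB by (metis card_image card_subset_eq inj_on_subset subset_UNIV)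
  show "B \<subseteq> J" if J: "g ` J = J" and ne: "J \<inter> B \<noteq> {}" for J
  proof -
    obtain y i where y: "y \<in> J" "y = (g ^^ i) x" using ne unfolding B by auto
    let ?m = "least_power g x"
    have m: "(g ^^ ?m) x = x" "?m > 0" using least_power_of_permutation[OF g] by auto
    have mk: "(g ^^ (?m * k)) x = x" for k by (rule least_power_dvd[OF g, THEN iffD1]) simp
    \<comment> \<open>The point \<open>y\<close> lies \<open>i\<close> steps past \<open>x\<close>;
      going on to the multiple \<open>?m * i\<close> of the period returns to \<open>x\<close>. The
      subtraction is not truncated because \<open>?m > 0\<close>.\<close>
    have "(g ^^ (?m * i - i)) y = (g ^^ (?m * i - i + i)) x" unfolding y(2) by (simp add: funpow_add)
    also have "?m * i - i + i = ?m * i" using m(2) by simp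
    finally have "x \<in> J" using pow[OF J y(1), of "?m * i - i"] mk by simp
    then show ?thesis unfolding B using pow[OF J] by auto
  qed
  let ?cs = "support g x"
  have cyc: "cycle ?cs" by (rule cycle_of_permutation[OF g])
  have ne: "?cs \<noteq> []" using xB unfolding B_def by force
  have "perm_sign_on g B = perm_sign_on (cycle_of_list ?cs) B"
    unfolding B_def by (rule perm_sign_on_cong) (use cycle_restrict[OF g] in auto)
  also have "\<dots> = of_int (sign (cycle_of_list ?cs))"
    unfolding B_def by (rule perm_sign_on_eq_sign[OF _ cycle_permutes]) simp
  also have "\<dots> = (-1) ^ (length ?cs - 1)"
    unfolding sign_cycle_of_list[OF cyc ne] by simp
  finally have "perm_sign_on g B = (-1) ^ (length ?cs - 1)" .
  moreover have "card B = Suc (length ?cs - 1)"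
    unfolding B_def using distinct_card[OF cyc] ne by (cases ?cs) auto
  ultimately show "signed_weight g B = -1"
    by (simp add: signed_weight_def flip: power_add)
qed

text \<open>A sign-reversing pairing: an invariant set contains the orbit \<open>B\<close> or misses
  it, and adding \<open>B\<close> reverses the signed weight. The factor \<open>w\<close> allows one
  application to a weight depending on the size and another to a constant.\<close>

lemma invariant_subsets_toggle:
  assumes fin: "finite W" and g: "permutation g" and B: "B \<subseteq> W" "g ` B = B" "B \<noteq> {}"
    and orb: "\<And>J. g ` J = J \<Longrightarrow> J \<inter> B \<noteq> {} \<Longrightarrow> B \<subseteq> J" and wB: "signed_weight g B = -1"
  shows "(\<Sum>J\<in>invariant_subsets g W. w J * signed_weight g J)
    = (\<Sum>J\<in>invariant_subsets g (W - B). (w J - w (J \<union> B)) * signed_weight g J)"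
proof -
  let ?A = "invariant_subsets g (W - B)"
  have inj: "inj g" using g by (simp add: permutation_bijective bij_is_inj)
  have fA: "finite ?A" unfolding invariant_subsets_def using fin by auto
  have split: "invariant_subsets g W = ?A \<union> (\<lambda>J. J \<union> B) ` ?A"
  proof (intro equalityI subsetI)
    fix J assume J: "J \<in> invariant_subsets g W"
    show "J \<in> ?A \<union> (\<lambda>J. J \<union> B) ` ?A"
    proof (cases "J \<inter> B = {}")
      case True then show ?thesis using J by (auto simp: invariant_subsets_def)
    next
      case False
      then have "B \<subseteq> J" using orb J by (auto simp: invariant_subsets_def)
      moreover have "g ` (J - B) = J - B"
        using J B(2) image_set_diff[OF inj, of J B] by (simp add: invariant_subsets_def)
      ultimately have "J - B \<in> ?A" "J = (J - B) \<union> B" using J by (auto simp: invariant_subsets_def)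
      then show ?thesis by blast
    qed
  next
    fix J assume "J \<in> ?A \<union> (\<lambda>J. J \<union> B) ` ?A"
    then show "J \<in> invariant_subsets g W"
      using B by (auto simp: invariant_subsets_def image_Un)
  qed
  have disj: "?A \<inter> (\<lambda>J. J \<union> B) ` ?A = {}" using B(3) by (auto simp: invariant_subsets_def)
  have injU: "inj_on (\<lambda>J. J \<union> B) ?A" by (auto simp: inj_on_def invariant_subsets_def)
  have sw: "signed_weight g (J \<union> B) = - signed_weight g J" if "J \<in> ?A" for J
  proof -
    have J: "finite J" "finite B" "J \<inter> B = {}" "g ` J = J"
      using that fin B by (auto simp: invariant_subsets_def intro: finite_subset)
    have "signed_weight g (J \<union> B) = signed_weight g J * signed_weight g B"
      unfolding signed_weight_def card_Un_disjoint[OF J(1-3)]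
        perm_sign_on_invariant_union[OF J(1-3) inj J(4) B(2)] by (simp add: power_add mult_ac)
    then show ?thesis using wB by simp
  qed
  have "(\<Sum>J\<in>invariant_subsets g W. w J * signed_weight g J)
    = (\<Sum>J\<in>?A. w J * signed_weight g J) + (\<Sum>J\<in>?A. w (J \<union> B) * signed_weight g (J \<union> B))"
    unfolding split using fA disj by (simp add: sum.union_disjoint sum.reindex[OF injU])
  also have "(\<Sum>J\<in>?A. w (J \<union> B) * signed_weight g (J \<union> B)) = (\<Sum>J\<in>?A. - w (J \<union> B) * signed_weight g J)"
    by (rule sum.cong) (auto simp: sw)
  finally show ?thesis by (simp add: left_diff_distrib sum_subtractf sum_negf)
qed

lemma sum_signed_weight_invariant_subsets:
  assumes fin: "finite W" and g: "permutation g" and W: "g ` W = W" "W \<noteq> {}"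
  shows "(\<Sum>J\<in>invariant_subsets g W. signed_weight g J) = 0"
proof -
  obtain x where x: "x \<in> W" using W by auto
  note o = orbit_properties[OF fin g W(1) x]
  have ne: "set (support g x) \<noteq> {}" by (metis o(1) empty_iff)
  show ?thesis using invariant_subsets_toggle[OF fin g o(2,3) ne o(4,5), of "\<lambda>_. 1"] by simp
qed

text \<open>Toggling the orbit of \<open>x\<close> turns the factor linear in \<open>card J\<close>
  into a constant; a second orbit, present because the first is not all of \<open>V\<close>, then
  makes the sum 0. The sum is the determinant of \<open>1 - g\<close> on the standard
  representation.\<close>

lemma sum_complement_signed_weight:
  assumes fin: "finite V" and g: "g permutes V"
    and x: "x \<in> V" and B: "set (support g x) \<noteq> V"
  shows "(\<Sum>J\<in>invariant_subsets g V. real (card V - card J) * signed_weight g J) = 0"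
proof -
  let ?B = "set (support g x)"
  have p: "permutation g" using fin g by (auto simp: permutation_permutes)
  have gV: "g ` V = V" using g by (rule permutes_image)
  note o = orbit_properties[OF fin p gV x]
  have ne: "?B \<noteq> {}" by (metis o(1) empty_iff)
  have finB: "finite ?B" by simp
  have "(\<Sum>J\<in>invariant_subsets g V. real (card V - card J) * signed_weight g J)
    = (\<Sum>J\<in>invariant_subsets g (V - ?B). (real (card V - card J) - real (card V - card (J \<union> ?B))) * signed_weight g J)"
    by (rule invariant_subsets_toggle[OF fin p o(2,3) ne o(4,5)])
  also have "\<dots> = (\<Sum>J\<in>invariant_subsets g (V - ?B). real (card ?B) * signed_weight g J)"
  proof (rule sum.cong[OF refl])
    fix J assume J: "J \<in> invariant_subsets g (V - ?B)"
    then have J': "finite J" "J \<inter> ?B = {}" "J \<union> ?B \<subseteq> V"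
      using fin o(2) by (auto simp: invariant_subsets_def intro: finite_subset)
    have "card (J \<union> ?B) = card J + card ?B" "card (J \<union> ?B) \<le> card V"
      by (rule card_Un_disjoint[OF J'(1) finB J'(2)], rule card_mono[OF fin J'(3)])
    then have "real (card V - card J) - real (card V - card (J \<union> ?B)) = real (card ?B)" by linarith
    then show "(real (card V - card J) - real (card V - card (J \<union> ?B))) * signed_weight g J
        = real (card ?B) * signed_weight g J" by (simp only:)
  qed
  also have "\<dots> = real (card ?B) * (\<Sum>J\<in>invariant_subsets g (V - ?B). signed_weight g J)"
    by (simp add: sum_distrib_left)
  also have "(\<Sum>J\<in>invariant_subsets g (V - ?B). signed_weight g J) = 0"
  proof (rule sum_signed_weight_invariant_subsets[OF _ p])
    show "g ` (V - ?B) = V - ?B"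
      using image_set_diff[OF permutes_inj[OF g], of V ?B] gV o(3) by simp
    show "V - ?B \<noteq> {}" using B o(2) by blast
  qed (use fin in auto)
  finally show ?thesis by simp
qed

section \<open>Values of the characters of the exterior powers and their alternating sum\<close>

context signed_subsets
begin

text \<open>The character of the \<open>k\<close>-th exterior power of the permutation
  module.\<close>

definition fixed_trace :: "nat \<Rightarrow> ('a \<Rightarrow> 'a) \<Rightarrow> real" where
  "fixed_trace k g = (\<Sum>J\<in>level k. if g ` J = J then perm_sign_on g J else 0)"

text \<open>The permutation module is the standard representation plus a trivial one, so its
  exterior power of degree \<open>Suc k\<close> splits into those of degrees \<open>Suc k\<close>
  and \<open>k\<close> of the standard one. In matrices, \<open>Dt D\<close> on level
  \<open>Suc k\<close> and \<open>D Dt\<close> on level \<open>k\<close> have the same trace against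
  \<open>g\<close>, and \<open>laplace_sum\<close> gives the total.\<close>

lemma hook_char_Suc:
  assumes g: "g permutes V"
  shows "hook_char (Suc k) g + hook_char k g = card V * fixed_trace (Suc k) g"
proof -
  let ?s = "perm_sign_on g"
  have sub: "g ` J \<subseteq> V" if "J \<in> level m" for J m
    using perm_image_sub[OF g level_sub[OF that]] .
  have z: "D K J = 0" if "J \<subseteq> V" "card J \<noteq> Suc (card K)" for K J
    using contraction_card[of K J] that by blast
  have "(\<Sum>J\<in>level (Suc k). (Dt \<bullet> D) J (g ` J) * ?s J)
    = (\<Sum>J\<in>level (Suc k). \<Sum>K\<in>level k. D (g ` K) J * ?s K * D K J)"
  proof (rule sum.cong[OF refl])
    fix J assume J: "J \<in> level (Suc k)"
    have "(Dt \<bullet> D) J (g ` J) = (\<Sum>K\<in>Pow V. D (g ` K) J * D (g ` K) (g ` J))"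
      unfolding kernel_mult_def using sum_Pow_perm[OF g] by (rule sym)
    also have "\<dots> = (\<Sum>K\<in>Pow V. D (g ` K) J * ?s K * D K J * ?s J)"
      by (rule sum.cong) (use invariantD[OF invariant_contraction g _ level_sub[OF J]] in \<open>auto simp: mult_ac\<close>)
    also have "\<dots> = (\<Sum>K\<in>level k. D (g ` K) J * ?s K * D K J * ?s J)"
      by (rule sum.mono_neutral_right) (use fin J contraction_card[OF _ level_sub[OF J]] in \<open>auto simp: level_def\<close>)
    finally show "(Dt \<bullet> D) J (g ` J) * ?s J = (\<Sum>K\<in>level k. D (g ` K) J * ?s K * D K J)"
      by (simp add: sum_distrib_left sum_distrib_right mult_ac)
  qed
  also have "\<dots> = (\<Sum>K\<in>level k. \<Sum>J\<in>level (Suc k). D (g ` K) J * ?s K * D K J)"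
    by (rule sum.swap)
  also have "\<dots> = (\<Sum>K\<in>level k. laplace K (g ` K) * ?s K)"
  proof (rule sum.cong[OF refl])
    fix K assume K: "K \<in> level k"
    have "(\<Sum>J\<in>level (Suc k). D (g ` K) J * ?s K * D K J) = (\<Sum>J\<in>Pow V. D (g ` K) J * ?s K * D K J)"
      by (rule sum.mono_neutral_left) (use fin K z in \<open>auto simp: level_def\<close>)
    then show "(\<Sum>J\<in>level (Suc k). D (g ` K) J * ?s K * D K J) = laplace K (g ` K) * ?s K"
      by (simp add: laplace_def kernel_mult_def sum_distrib_left sum_distrib_right mult_ac)
  qed
  finally have "hook_char k g = (\<Sum>J\<in>level (Suc k). (Dt \<bullet> D) J (g ` J) * ?s J)"
    by (simp add: hook_char_def)
  then have "hook_char (Suc k) g + hook_char k g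
      = (\<Sum>J\<in>level (Suc k). (laplace J (g ` J) + (Dt \<bullet> D) J (g ` J)) * ?s J)"
    by (simp add: hook_char_def sum.distrib distrib_right)
  also have "\<dots> = (\<Sum>J\<in>level (Suc k). card V * (if g ` J = J then ?s J else 0))"
  proof (rule sum.cong[OF refl])
    fix J assume J: "J \<in> level (Suc k)"
    show "(laplace J (g ` J) + (Dt \<bullet> D) J (g ` J)) * ?s J = card V * (if g ` J = J then ?s J else 0)"
      unfolding laplace_sum[OF level_sub[OF J] sub[OF J]] by simp
  qed
  finally show ?thesis by (simp add: fixed_trace_def sum_distrib_left)
qed

lemma level_0: "level 0 = {{}}"
  by (auto simp: level_def)

lemma level_card_V: "level (card V) = {V}"
  by (auto simp: level_def dest: card_subset_eq[OF fin])

lemma hook_char_0: "hook_char 0 g = card V"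
  using laplace_diag[of "{}"] by (simp add: hook_char_def level_0)

lemma hook_char_card:
  assumes "g permutes V"
  shows "hook_char (card V) g = 0"
  using laplace_diag[of V] permutes_image[OF assms] by (simp add: hook_char_def level_card_V)

lemma level_trace_eq: "level_trace k = real (card V choose k) * real (card V - k)"
proof -
  have "level_trace k = (\<Sum>J\<in>level k. real (card V - k))"
    unfolding level_trace_def by (rule sum.cong) (auto simp: laplace_diag level_def)
  moreover have "card (level k) = card V choose k"
    using n_subsets[OF fin, of k] by (simp add: level_def)
  ultimately show ?thesis by simp
qed

definition fixed_points :: "('a \<Rightarrow> 'a) \<Rightarrow> nat" where
  "fixed_points g = card {x \<in> V. g x = x}"

lemma fixed_trace_1: "fixed_trace 1 g = fixed_points g"
proof -
  have lev: "level 1 = (\<lambda>x. {x}) ` V"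
    by (auto simp: level_def card_1_singleton_iff)
  have s: "perm_sign_on g {x} = 1" for x
  proof -
    have "{e. e \<subseteq> {x} \<and> card e = 2} = {}" by (auto simp: subset_singleton_iff)
    then show ?thesis by (simp only: perm_sign_on_def prod.empty)
  qed
  have "fixed_trace 1 g = (\<Sum>x\<in>V. if g x = x then 1 else 0)"
    unfolding fixed_trace_def lev by (auto simp: sum.reindex s intro!: sum.cong)
  then show ?thesis using fin by (simp add: fixed_points_def sum.If_cases Int_def)
qed

text \<open>The complement of a point is invariant exactly if the point is fixed, and deleting a
  fixed point does not change the sign.\<close>

lemma fixed_trace_complement:
  assumes g: "g permutes V" and n: "card V = Suc m"
  shows "fixed_trace m g = perm_sign_on g V * fixed_points g"
proof -
  have lev: "level m = (\<lambda>x. V - {x}) ` V"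
  proof (intro equalityI subsetI)
    fix J assume J: "J \<in> level m"
    then have "card (V - J) = 1" using fin n by (simp add: level_def card_Diff_subset)
    then obtain x where "V - J = {x}" by (auto simp: card_1_singleton_iff)
    then have "x \<in> V" "J = V - {x}" using level_sub[OF J] by auto
    then show "J \<in> (\<lambda>x. V - {x}) ` V" by blast
  next
    fix J assume "J \<in> (\<lambda>x. V - {x}) ` V"
    then show "J \<in> level m" using fin n by (auto simp: level_def)
  qed
  have inj: "inj_on (\<lambda>x. V - {x}) V" by (auto simp: inj_on_def)
  have gV: "g ` V = V" using g by (rule permutes_image)
  have eq: "(if g ` (V - {x}) = V - {x} then perm_sign_on g (V - {x}) else 0)
      = (if g x = x then perm_sign_on g V else 0)" if x: "x \<in> V" for x
  proof -
    have im: "g ` (V - {x}) = V - {g x}"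
      using image_set_diff[OF permutes_inj[OF g], of V "{x}"] gV by simp
    have "g x \<in> V" using x gV by blast
    then have iff: "V - {g x} = V - {x} \<longleftrightarrow> g x = x" using x by auto
    have "perm_sign_on g (V - {x}) = perm_sign_on g V" if "g x = x"
    proof -
      have "position_sign x V = perm_sign_on g V * perm_sign_on g (V - {x}) * position_sign x V"
        using position_sign_image[OF fin perm_inj_on[OF g] x] gV that by simp
      then have "perm_sign_on g V * perm_sign_on g (V - {x}) = 1"
        using position_sign_square[of x V] by (metis mult_cancel_right2 mult_zero_left zero_neq_one)
      then have "perm_sign_on g V * (perm_sign_on g V * perm_sign_on g (V - {x})) = perm_sign_on g V" by simp
      then show ?thesis by simp
    qed
    then show ?thesis unfolding im iff by simp
  qed
  have "fixed_trace m g = (\<Sum>x\<in>V. if g x = x then perm_sign_on g V else 0)"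
    unfolding fixed_trace_def lev by (simp add: sum.reindex[OF inj] eq)
  then show ?thesis using fin by (simp add: fixed_points_def sum.If_cases Int_def)
qed

lemma hook_char_1:
  assumes "g permutes V"
  shows "hook_char 1 g = card V * (real (fixed_points g) - 1)"
  using hook_char_Suc[OF assms, of 0] fixed_trace_1[of g] hook_char_0[of g]
  by (simp add: algebra_simps)

lemma hook_char_top:
  assumes g: "g permutes V" and n: "card V = Suc m"
  shows "hook_char m g = card V * perm_sign_on g V"
proof -
  have "fixed_trace (card V) g = perm_sign_on g V"
    using permutes_image[OF g] by (simp add: fixed_trace_def level_card_V)
  then show ?thesis using hook_char_Suc[OF g, of m] hook_char_card[OF g] n by simp
qed

text \<open>The counterpart of \<open>hook_char_1\<close> under the duality that exchanges
  complementary degrees and multiplies by the sign.\<close>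

lemma hook_char_subtop:
  assumes g: "g permutes V" and n: "card V = Suc (Suc m)"
  shows "hook_char m g = card V * perm_sign_on g V * (real (fixed_points g) - 1)"
  using hook_char_Suc[OF g, of m] hook_char_top[OF g n] fixed_trace_complement[OF g n]
  by (simp add: algebra_simps)

lemma alternating_hook_char_partial:
  assumes g: "g permutes V"
  shows "(-1) ^ k * hook_char k g = card V * (\<Sum>j\<le>k. (-1) ^ j * fixed_trace j g)"
proof (induction k)
  case 0
  then show ?case by (simp add: hook_char_0 fixed_trace_def level_0)
next
  case (Suc k)
  have "hook_char (Suc k) g = card V * fixed_trace (Suc k) g - hook_char k g"
    using hook_char_Suc[OF g, of k] by simp
  then have "(-1) ^ Suc k * hook_char (Suc k) g
      = (-1) ^ Suc k * (card V * fixed_trace (Suc k) g) + (-1) ^ k * hook_char k g"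
    by (simp only:) (simp add: algebra_simps)
  then show ?case using Suc by (simp add: algebra_simps)
qed

text \<open>\<open>fixed_trace j\<close> enters the partial sums with \<open>j \<le> k < m\<close>,
  which are \<open>m - j\<close> in number.\<close>

lemma alternating_hook_char_sum:
  assumes g: "g permutes V"
  shows "(\<Sum>k<m. (-1) ^ k * hook_char k g) = card V * (\<Sum>j\<le>m. real (m - j) * ((-1) ^ j * fixed_trace j g))"
proof (induction m)
  case (Suc m)
  have "(\<Sum>j\<le>Suc m. real (Suc m - j) * ((-1) ^ j * fixed_trace j g))
    = (\<Sum>j\<le>m. real (m - j) * ((-1) ^ j * fixed_trace j g)) + (\<Sum>j\<le>m. (-1) ^ j * fixed_trace j g)"
    unfolding sum.distrib[symmetric] by (auto simp: Suc_diff_le algebra_simps intro!: sum.cong)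
  then show ?case using Suc alternating_hook_char_partial[OF g, of m] by (simp add: distrib_left)
qed simp

text \<open>For \<open>m = card V\<close> the coefficient \<open>m - j\<close> is the factor in
  \<open>sum_complement_signed_weight\<close>, once the invariant subsets are grouped by
  size.\<close>

lemma alternating_hook_char_zero:
  assumes g: "g permutes V" and x: "x \<in> V" "set (support g x) \<noteq> V"
  shows "(\<Sum>k<card V. (-1) ^ k * hook_char k g) = 0"
proof -
  let ?n = "card V" and ?A = "invariant_subsets g V"
  have fA: "finite ?A" using fin by (simp add: invariant_subsets_def)
  have "(\<Sum>j\<le>?n. real (?n - j) * ((-1) ^ j * fixed_trace j g))
    = (\<Sum>j\<le>?n. \<Sum>J\<in>{J \<in> ?A. card J = j}. real (?n - card J) * signed_weight g J)"
  proof (rule sum.cong[OF refl])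
    fix j
    have "fixed_trace j g = (\<Sum>J\<in>{J \<in> ?A. card J = j}. perm_sign_on g J)"
      unfolding fixed_trace_def
      by (rule sum.mono_neutral_cong_right) (auto simp: level_def invariant_subsets_def fin)
    then show "real (?n - j) * ((-1) ^ j * fixed_trace j g)
        = (\<Sum>J\<in>{J \<in> ?A. card J = j}. real (?n - card J) * signed_weight g J)"
      by (auto simp: sum_distrib_left signed_weight_def intro!: sum.cong)
  qed
  also have "\<dots> = (\<Sum>J\<in>?A. real (?n - card J) * signed_weight g J)"
    by (rule sum.group[OF fA]) (auto simp: invariant_subsets_def fin intro: card_mono)
  also have "\<dots> = 0" by (rule sum_complement_signed_weight[OF fin g x])
  finally show ?thesis using alternating_hook_char_sum[OF g, of ?n] by simp
qed

end

section \<open>The bound for cycle-free families\<close>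

lemma less_binomial_middle:
  assumes "2 \<le> k" "k + 2 \<le> m"
  shows "m < m choose k"
proof (cases "2 * k \<le> m")
  case True
  then have "m choose 1 < m choose k" using assms by (intro binomial_strict_mono) auto
  then show ?thesis by simp
next
  case False
  then have "m choose 1 < m choose (m - k)" using assms by (intro binomial_strict_mono) auto
  then show ?thesis using assms binomial_symmetric[of k m] by simp
qed

definition full_cycles :: "'a set \<Rightarrow> ('a \<Rightarrow> 'a) set" where
  "full_cycles V = {cycle_of_list cs | cs. cycle cs \<and> set cs = V}"

lemma full_cycles_support:
  assumes "finite V" "g permutes V" "set (support g x) = V"
  shows "g \<in> full_cycles V"
proof -
  let ?cs = "support g x"
  have p: "permutation g" using assms by (auto simp: permutation_permutes)
  have "g y = cycle_of_list ?cs y" for y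
  proof (cases "y \<in> set ?cs")
    case True then show ?thesis by (rule cycle_restrict[OF p])
  next
    case False
    then have "y \<notin> V" using assms(3) by simp
    then show ?thesis using id_outside_supp[OF False] permutes_not_in[OF assms(2)] by simp
  qed
  then have "g = cycle_of_list ?cs" by (rule ext)
  then show ?thesis unfolding full_cycles_def using cycle_of_permutation[OF p, of x] assms(3) by blast
qed

locale cycle_free_family = signed_subsets V for V :: "'a::linorder set" +
  fixes S :: "('a \<Rightarrow> 'a) set"
  assumes S_perm: "p \<in> S \<Longrightarrow> p permutes V"
    and S_even: "p \<in> S \<Longrightarrow> perm_sign_on p V = 1"
    and S_cycle_free: "p \<in> S \<Longrightarrow> q \<in> S \<Longrightarrow> p \<circ> inv' q \<notin> full_cycles V"
    and odd_card: "odd (card V)" and card_ge: "card V \<ge> 5"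
begin

abbreviation "N \<equiv> card V"

lemma V_nonempty [simp]: "V \<noteq> {}"
  using card_ge by auto

lemma finite_S [simp]: "finite S"
  using finite_subset[of S Perms] finite_Perms S_perm by blast

text \<open>The convolution of the indicator of \<open>S\<close> with the character. Multiplied by
  \<open>hook_dim k / (N * fact N)\<close> it is the projection of the indicator onto the isotypic
  part of degree \<open>k\<close>.\<close>

definition translate_sum :: "nat \<Rightarrow> ('a \<Rightarrow> 'a) \<Rightarrow> real" where
  "translate_sum k h = (\<Sum>p\<in>S. hook_char k (h \<circ> inv' p))"

text \<open>This is \<open>N\<close> times the \<open>Q\<^sub>k\<close> of the overview, because
  \<open>hook_char\<close> carries that factor.\<close>

definition energy :: "nat \<Rightarrow> real" where
  "energy k = (\<Sum>q\<in>S. translate_sum k q)"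

definition hook_dim :: "nat \<Rightarrow> real" where
  "hook_dim k = real ((N - 1) choose k)"

lemma hook_dim_pos: "k < N \<Longrightarrow> hook_dim k > 0"
  by (simp add: hook_dim_def zero_less_binomial_iff)

lemma level_trace_hook_dim: "level_trace k = N * hook_dim k"
proof (cases "k < N")
  case True
  have "(N - k) * (N choose k) = N * ((N - 1) choose k)"
    using binomial_absorb_comp[of N k] .
  then have "real (N - k) * real (N choose k) = real N * real ((N - 1) choose k)"
    by (simp only: of_nat_mult[symmetric])
  then show ?thesis by (simp add: level_trace_eq hook_dim_def mult.commute)
next
  case False
  then show ?thesis using card_ge by (simp add: level_trace_eq hook_dim_def binomial_eq_0)
qed

text \<open>Orthogonality of the isotypic parts. For \<open>k = l\<close> it exhibits the energy as
  a multiple of a squared norm, which is why it is nonnegative.\<close>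

lemma inner_translate_sum:
  "hook_dim k * (\<Sum>h\<in>Perms. translate_sum k h * translate_sum l h)
    = (if k = l then real N * fact N * energy k else 0)"
proof -
  have shift: "(\<Sum>h\<in>Perms. hook_char k (h \<circ> inv' p) * hook_char l (h \<circ> inv' q))
      = (\<Sum>g\<in>Perms. hook_char k g * hook_char l (g \<circ> (p \<circ> inv' q)))" if p: "p \<in> S" for p q
  proof -
    have pi: "p \<circ> inv' p = id" using S_perm[OF p] by (rule permutes_inv_o)
    have "(\<Sum>h\<in>Perms. hook_char k (h \<circ> inv' p) * hook_char l (h \<circ> inv' q))
      = (\<Sum>g\<in>Perms. hook_char k (g \<circ> p \<circ> inv' p) * hook_char l (g \<circ> p \<circ> inv' q))"
      by (rule sum_permutations_compose_right[OF S_perm[OF p]])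
    then show ?thesis by (simp only: comp_assoc pi comp_id)
  qed
  have "level_trace k * (\<Sum>h\<in>Perms. translate_sum k h * translate_sum l h)
    = level_trace k * (\<Sum>h\<in>Perms. \<Sum>p\<in>S. \<Sum>q\<in>S. hook_char k (h \<circ> inv' p) * hook_char l (h \<circ> inv' q))"
    unfolding translate_sum_def sum_product ..
  also have "(\<Sum>h\<in>Perms. \<Sum>p\<in>S. \<Sum>q\<in>S. hook_char k (h \<circ> inv' p) * hook_char l (h \<circ> inv' q))
    = (\<Sum>p\<in>S. \<Sum>h\<in>Perms. \<Sum>q\<in>S. hook_char k (h \<circ> inv' p) * hook_char l (h \<circ> inv' q))"
    by (rule sum.swap)
  also have "\<dots> = (\<Sum>p\<in>S. \<Sum>q\<in>S. \<Sum>h\<in>Perms. hook_char k (h \<circ> inv' p) * hook_char l (h \<circ> inv' q))"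
    by (intro sum.cong refl sum.swap)
  also have "\<dots> = (\<Sum>p\<in>S. \<Sum>q\<in>S. \<Sum>g\<in>Perms. hook_char k g * hook_char l (g \<circ> (p \<circ> inv' q)))"
    by (intro sum.cong refl shift)
  also have "level_trace k * \<dots> = (\<Sum>p\<in>S. \<Sum>q\<in>S. level_trace k * (\<Sum>g\<in>Perms. hook_char k g * hook_char l (g \<circ> (p \<circ> inv' q))))"
    by (simp only: sum_distrib_left)
  also have "\<dots> = (\<Sum>p\<in>S. \<Sum>q\<in>S. if k = l then (real N)\<^sup>2 * fact N * hook_char k (p \<circ> inv' q) else 0)"
    by (intro sum.cong refl hook_char_convolution permutes_compose permutes_inv S_perm)
  also have "\<dots> = N * (if k = l then real N * fact N * energy k else 0)"
    by (simp add: energy_def translate_sum_def sum_distrib_left power2_eq_square mult_ac)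
  finally show ?thesis using card_ge unfolding level_trace_hook_dim by simp
qed

lemma energy_nonneg:
  assumes "k < N"
  shows "energy k \<ge> 0"
proof -
  have "0 \<le> hook_dim k * (\<Sum>h\<in>Perms. translate_sum k h * translate_sum k h)"
    using hook_dim_pos[OF assms] by (intro mult_nonneg_nonneg[OF _ sum_nonneg]) auto
  then have "0 \<le> real N * fact N * energy k" using inner_translate_sum[of k k] by simp
  moreover have "real N * fact N > 0" using card_ge by simp
  ultimately show ?thesis by (simp add: zero_le_mult_iff)
qed

lemma translate_sum_zero:
  assumes "k < N" "energy k = 0" "h \<in> Perms"
  shows "translate_sum k h = 0"
proof -
  have "(\<Sum>h\<in>Perms. translate_sum k h * translate_sum k h) = 0"
    using inner_translate_sum[of k k] hook_dim_pos[OF assms(1)] assms(2) by simp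
  then show ?thesis using assms(3) finite_Perms by (simp add: sum_nonneg_eq_0_iff)
qed

definition residual :: "('a \<Rightarrow> 'a) \<Rightarrow> real" where
  "residual h = of_bool (h \<in> S) - (\<Sum>k<N. hook_dim k / (real N * fact N) * translate_sum k h)"

text \<open>Pythagoras: \<open>?F\<close> is an orthogonal projection of the indicator, so its inner
  products with the indicator and with itself agree. The residual is kept as an explicit term
  because equality in the bound will force it to vanish.\<close>

lemma bessel:
  "(\<Sum>h\<in>Perms. (residual h)\<^sup>2) = card S - (\<Sum>k<N. hook_dim k / (real N * fact N) * energy k)"
proof -
  let ?c = "\<lambda>k. hook_dim k / (real N * fact N)"
  let ?F = "\<lambda>h. \<Sum>k<N. ?c k * translate_sum k h"
  have SP: "S \<subseteq> Perms" using S_perm by auto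
  have ind: "(\<Sum>h\<in>Perms. of_bool (h \<in> S) * f h) = (\<Sum>h\<in>S. f h)" for f :: "('a \<Rightarrow> 'a) \<Rightarrow> real"
    using finite_Perms SP by (intro sum.mono_neutral_cong_right) auto
  have "(\<Sum>h\<in>Perms. of_bool (h \<in> S) * ?F h) = (\<Sum>k<N. ?c k * energy k)"
    unfolding ind energy_def by (simp only: sum_distrib_left) (rule sum.swap)
  moreover have "(\<Sum>h\<in>Perms. ?F h * ?F h) = (\<Sum>k<N. ?c k * energy k)"
  proof -
    have "(\<Sum>h\<in>Perms. ?F h * ?F h)
      = (\<Sum>h\<in>Perms. \<Sum>k<N. \<Sum>l<N. ?c k * ?c l * (translate_sum k h * translate_sum l h))"
      unfolding sum_product by (intro sum.cong refl) simp
    also have "\<dots> = (\<Sum>k<N. \<Sum>h\<in>Perms. \<Sum>l<N. ?c k * ?c l * (translate_sum k h * translate_sum l h))"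
      by (rule sum.swap)
    also have "\<dots> = (\<Sum>k<N. \<Sum>l<N. \<Sum>h\<in>Perms. ?c k * ?c l * (translate_sum k h * translate_sum l h))"
      by (intro sum.cong refl sum.swap)
    also have "\<dots> = (\<Sum>k<N. \<Sum>l<N. if l = k then ?c k * energy k else 0)"
    proof (intro sum.cong refl)
      fix k l assume "k \<in> {..<N}"
      have nz: "real N * fact N \<noteq> 0" using card_ge by simp
      have "(\<Sum>h\<in>Perms. ?c k * ?c l * (translate_sum k h * translate_sum l h))
        = ?c l / (real N * fact N) * (hook_dim k * (\<Sum>h\<in>Perms. translate_sum k h * translate_sum l h))"
        unfolding sum_distrib_left by (intro sum.cong refl) simp
      also have "\<dots> = ?c l / (real N * fact N) * (if k = l then real N * fact N * energy k else 0)"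
        by (simp only: inner_translate_sum)
      also have "\<dots> = (if l = k then ?c k * energy k else 0)" using nz by simp
      finally show "(\<Sum>h\<in>Perms. ?c k * ?c l * (translate_sum k h * translate_sum l h))
        = (if l = k then ?c k * energy k else 0)" .
    qed
    also have "\<dots> = (\<Sum>k<N. ?c k * energy k)" by simp
    finally show ?thesis .
  qed
  moreover have "(\<Sum>h\<in>Perms. of_bool (h \<in> S) * 1) = real (card S)" unfolding ind by simp
  moreover have "(residual h)\<^sup>2 = of_bool (h \<in> S) * 1 - 2 * (of_bool (h \<in> S) * ?F h) + ?F h * ?F h" for h
    by (simp add: residual_def power2_eq_square algebra_simps)
  ultimately show ?thesis
    by (simp only: sum.distrib sum_subtractf sum_distrib_left[symmetric])
qed

text \<open>The coefficient of \<open>energy k\<close> after \<open>N - 1\<close> times the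
  alternating relation is added to Bessel's sum.\<close>

definition weight :: "nat \<Rightarrow> real" where
  "weight k = hook_dim k + (real N - 1) * (-1) ^ k"

text \<open>In the middle degrees the binomial coefficient strictly exceeds \<open>N - 1\<close>, so
  even the sign -1 leaves something positive. Strictness later forces the middle energies to be
  0.\<close>

lemma weight_pos:
  assumes "2 \<le> k" "k + 3 \<le> N"
  shows "weight k > 0"
proof -
  have "N - 1 < (N - 1) choose k" using assms by (intro less_binomial_middle) auto
  then have "hook_dim k > real N - 1" unfolding hook_dim_def using card_ge by linarith
  moreover have "(-1::real) ^ k \<ge> -1" by (cases "even k") auto
  ultimately show ?thesis using card_ge mult_left_mono[of "-1" "(-1::real) ^ k" "real N - 1"]
    by (simp add: weight_def)
qed

lemma weight_1: "weight 1 = 0" and weight_subtop: "weight (N - 2) = 0"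
  and weight_0: "weight 0 = N" and weight_top: "weight (N - 1) = N"
proof -
  have dim: "hook_dim (N - 2) = real N - 1"
  proof -
    have "(N - 1) choose (N - 2) = N - 1"
      using binomial_symmetric[of 1 "N - 1"] card_ge by (simp add: numeral_2_eq_2)
    then show ?thesis using card_ge by (simp add: hook_dim_def)
  qed
  \<comment> \<open>Here the parity of \<open>N\<close> matters: degrees 1 and \<open>N - 2\<close>,
    both of dimension \<open>N - 1\<close>, carry the sign -1, and the two extreme degrees carry the
    sign 1.\<close>
  have "odd (N - 2)" "even (N - 1)" using odd_card card_ge by auto
  then show "weight (N - 2) = 0" "weight (N - 1) = N" "weight 1 = 0" "weight 0 = N"
    using card_ge dim by (auto simp: weight_def hook_dim_def)
qed

lemma weight_nonneg:
  assumes "k < N"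
  shows "weight k \<ge> 0"
proof -
  consider "k = 0" | "k = 1" | "k = N - 1" | "k = N - 2" | "2 \<le> k" "k + 3 \<le> N"
    using assms by linarith
  then show ?thesis
    using weight_0 weight_1 weight_top weight_subtop weight_pos[of k] by cases auto
qed

lemma perm_sign_on_translate:
  assumes "h permutes V" "perm_sign_on h V = 1" "p \<in> S"
  shows "perm_sign_on (h \<circ> inv' p) V = 1"
proof -
  have p: "p permutes V" "inv' p permutes V" using S_perm[OF assms(3)] permutes_inv by auto
  have "perm_sign_on (p \<circ> inv' p) V = perm_sign_on p V * perm_sign_on (inv' p) V"
    using p fin by (subst perm_sign_on_compose) (auto simp: permutes_image intro: perm_inj_on)
  moreover have "perm_sign_on (p \<circ> inv' p) V = 1"
    unfolding permutes_inv_o(1)[OF p(1)] using fin by (simp add: perm_sign_on_fixed)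
  ultimately have "perm_sign_on (inv' p) V = 1" using S_even[OF assms(3)] by simp
  moreover have "perm_sign_on (h \<circ> inv' p) V = perm_sign_on h V * perm_sign_on (inv' p) V"
    using p fin assms(1) by (subst perm_sign_on_compose) (auto simp: permutes_image intro: perm_inj_on)
  ultimately show ?thesis using assms(2) by simp
qed

text \<open>Complementary degrees differ by the sign character, which is invisible on even
  permutations; hence the agreement in pairs.\<close>

lemma translate_sum_extremes:
  assumes h: "h permutes V" "perm_sign_on h V = 1"
  shows "translate_sum 0 h = N * card S" "translate_sum (N - 1) h = N * card S"
    "translate_sum 1 h = N * (\<Sum>p\<in>S. real (fixed_points (h \<circ> inv' p)) - 1)"
    "translate_sum (N - 2) h = N * (\<Sum>p\<in>S. real (fixed_points (h \<circ> inv' p)) - 1)"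
proof -
  have g: "h \<circ> inv' p permutes V" "perm_sign_on (h \<circ> inv' p) V = 1" if "p \<in> S" for p
    using permutes_compose[OF permutes_inv[OF S_perm[OF that]] h(1)] perm_sign_on_translate[OF h that] by auto
  have N: "N = Suc (N - 1)" "N = Suc (Suc (N - 2))" using card_ge by auto
  show "translate_sum 0 h = N * card S" by (simp add: translate_sum_def hook_char_0)
  have "translate_sum (N - 1) h = (\<Sum>p\<in>S. real N)"
    unfolding translate_sum_def
    by (rule sum.cong[OF refl]) (use hook_char_top[OF g(1) N(1)] g(2) in simp)
  then show "translate_sum (N - 1) h = N * card S" by simp
  show "translate_sum 1 h = N * (\<Sum>p\<in>S. real (fixed_points (h \<circ> inv' p)) - 1)"
    unfolding translate_sum_def sum_distrib_left
    by (rule sum.cong[OF refl]) (rule hook_char_1[OF g(1)])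
  show "translate_sum (N - 2) h = N * (\<Sum>p\<in>S. real (fixed_points (h \<circ> inv' p)) - 1)"
    unfolding translate_sum_def sum_distrib_left
    by (rule sum.cong[OF refl]) (use hook_char_subtop[OF g(1) N(2)] g(2) in simp)
qed

lemma energy_extremes: "energy 0 = N * (real (card S))\<^sup>2" "energy (N - 1) = N * (real (card S))\<^sup>2"
  using translate_sum_extremes(1,2)[OF S_perm S_even]
  by (simp_all add: energy_def power2_eq_square)

text \<open>It holds term by term, since no \<open>q \<circ> inv' p\<close> is a full cycle.\<close>

lemma alternating_energy: "(\<Sum>k<N. (-1) ^ k * energy k) = 0"
proof -
  have "(\<Sum>k<N. (-1) ^ k * energy k) = (\<Sum>k<N. \<Sum>q\<in>S. \<Sum>p\<in>S. (-1) ^ k * hook_char k (q \<circ> inv' p))"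
    unfolding energy_def translate_sum_def by (simp only: sum_distrib_left)
  also have "\<dots> = (\<Sum>q\<in>S. \<Sum>k<N. \<Sum>p\<in>S. (-1) ^ k * hook_char k (q \<circ> inv' p))"
    by (rule sum.swap)
  also have "\<dots> = (\<Sum>q\<in>S. \<Sum>p\<in>S. \<Sum>k<N. (-1) ^ k * hook_char k (q \<circ> inv' p))"
    by (intro sum.cong refl sum.swap)
  also have "\<dots> = 0"
  proof (rule sum.neutral, rule ballI, rule sum.neutral, rule ballI)
    fix q p assume qp: "q \<in> S" "p \<in> S"
    obtain x where x: "x \<in> V" using V_nonempty by blast
    have perm: "q \<circ> inv' p permutes V" using qp by (intro permutes_compose permutes_inv S_perm)
    have "set (support (q \<circ> inv' p) x) \<noteq> V"
      using full_cycles_support[OF fin perm] S_cycle_free[OF qp] by metis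
    then show "(\<Sum>k<N. (-1) ^ k * hook_char k (q \<circ> inv' p)) = 0"
      using alternating_hook_char_zero[OF perm x] by blast
  qed
  finally show ?thesis .
qed

text \<open>An identity rather than an inequality, so that the bound and the case of equality are
  read off from the same nonnegative left side. The factor 2 on the right comes from degrees 0 and
  \<open>N - 1\<close>, moved across.\<close>

lemma weighted_energy:
  "(\<Sum>k\<in>{1..<N - 1}. weight k * energy k) + real N * fact N * (\<Sum>h\<in>Perms. (residual h)\<^sup>2)
    = N * real (card S) * (fact N - 2 * N * real (card S))"
proof -
  have nz: "real N * fact N \<noteq> 0" using card_ge by simp
  have "(\<Sum>k<N. weight k * energy k) = (\<Sum>k<N. hook_dim k * energy k) + (real N - 1) * (\<Sum>k<N. (-1) ^ k * energy k)"
    unfolding weight_def sum_distrib_left sum.distrib[symmetric]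
    by (intro sum.cong refl) (simp add: algebra_simps)
  also have "\<dots> = (\<Sum>k<N. hook_dim k * energy k)" by (simp add: alternating_energy)
  also have "\<dots> = real N * fact N * (\<Sum>k<N. hook_dim k / (real N * fact N) * energy k)"
    unfolding sum_distrib_left by (rule sum.cong) (use nz in auto)
  also have "\<dots> = real N * fact N * (card S - (\<Sum>h\<in>Perms. (residual h)\<^sup>2))"
    using bessel by simp
  finally have 1: "(\<Sum>k<N. weight k * energy k) = real N * fact N * (card S - (\<Sum>h\<in>Perms. (residual h)\<^sup>2))" .
  have set: "{..<N} = insert 0 (insert (N - 1) {1..<N - 1})" using card_ge by auto
  have "(\<Sum>k<N. weight k * energy k)
    = weight 0 * energy 0 + (weight (N - 1) * energy (N - 1) + (\<Sum>k\<in>{1..<N - 1}. weight k * energy k))"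
    unfolding set using card_ge by (subst sum.insert) auto
  then show ?thesis using 1 unfolding weight_0 weight_top energy_extremes
    by (simp add: algebra_simps power2_eq_square)
qed

lemma weighted_energy_nonneg: "(\<Sum>k\<in>{1..<N - 1}. weight k * energy k) \<ge> 0"
  by (intro sum_nonneg mult_nonneg_nonneg weight_nonneg energy_nonneg) auto

lemma card_bound: "2 * card S \<le> fact (N - 1)"
proof (cases "card S = 0")
  case False
  have "0 \<le> N * real (card S) * (fact N - 2 * N * real (card S))"
    unfolding weighted_energy[symmetric]
    by (intro add_nonneg_nonneg weighted_energy_nonneg mult_nonneg_nonneg sum_nonneg) auto
  moreover have "N * real (card S) > 0" using False fin by (simp add: card_gt_0_iff)
  ultimately have "2 * N * real (card S) \<le> fact N" by (simp add: zero_le_mult_iff)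
  moreover have "(fact N :: real) = real N * fact (N - 1)" using card_ge by (intro fact_reduce) auto
  ultimately have "N * (2 * real (card S)) \<le> real N * fact (N - 1)" by (simp add: mult_ac)
  then have "2 * real (card S) \<le> fact (N - 1)" using card_ge by simp
  then have "real (2 * card S) \<le> real (fact (N - 1))" by simp
  then show ?thesis by (simp only: of_nat_le_iff)
qed simp

text \<open>At equality the left side of \<open>weighted_energy\<close> is 0, so the residual and
  the energies of degrees 2 to \<open>N - 3\<close> vanish. The four remaining degrees agree in
  pairs on even permutations, whence the factors 2.\<close>

lemma indicator_formula:
  assumes eq: "2 * card S = fact (N - 1)" and h: "h permutes V" "perm_sign_on h V = 1"
  shows "fact N * of_bool (h \<in> S) =
    2 * real (card S) + 2 * (real N - 1) * (\<Sum>p\<in>S. real (fixed_points (h \<circ> inv' p)) - 1)"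
proof -
  have "(fact N :: real) = real N * fact (N - 1)" using card_ge by (intro fact_reduce) auto
  also have "(fact (N - 1) :: real) = 2 * real (card S)"
    by (metis eq of_nat_fact of_nat_mult of_nat_numeral)
  finally have "(\<Sum>k\<in>{1..<N - 1}. weight k * energy k) + real N * fact N * (\<Sum>h\<in>Perms. (residual h)\<^sup>2) = 0"
    unfolding weighted_energy by simp
  moreover have R: "(\<Sum>h\<in>Perms. (residual h)\<^sup>2) \<ge> 0" by (intro sum_nonneg) auto
  moreover have pos: "real N * fact N > 0" using card_ge by simp
  ultimately have E0: "(\<Sum>k\<in>{1..<N - 1}. weight k * energy k) = 0"
    and R0: "real N * fact N * (\<Sum>h\<in>Perms. (residual h)\<^sup>2) = 0"
    using weighted_energy_nonneg mult_nonneg_nonneg[of "real N * fact N" "\<Sum>h\<in>Perms. (residual h)\<^sup>2"] by linarith+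
  from R0 pos have "(\<Sum>h\<in>Perms. (residual h)\<^sup>2) = 0" by simp
  then have res: "residual h = 0" using h finite_Perms by (simp add: sum_nonneg_eq_0_iff)
  have e: "energy k = 0" if "2 \<le> k" "k + 3 \<le> N" for k
  proof -
    have "\<forall>k\<in>{1..<N - 1}. weight k * energy k = 0"
      using E0 by (subst (asm) sum_nonneg_eq_0_iff) (auto intro!: mult_nonneg_nonneg weight_nonneg energy_nonneg)
    then have "weight k * energy k = 0" using that by simp
    then show ?thesis using weight_pos[OF that] by simp
  qed
  let ?f = "\<lambda>k. hook_dim k / (real N * fact N) * translate_sum k h"
  have "(\<Sum>k<N. ?f k) = (\<Sum>k\<in>{0, 1, N - 2, N - 1}. ?f k)"
  proof (rule sum.mono_neutral_right)
    show "\<forall>k\<in>{..<N} - {0, 1, N - 2, N - 1}. ?f k = 0"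
    proof
      fix k assume "k \<in> {..<N} - {0, 1, N - 2, N - 1}"
      then have "2 \<le> k" "k + 3 \<le> N" "k < N" by auto
      then show "?f k = 0" using translate_sum_zero[OF _ e] h by simp
    qed
  qed (use card_ge in auto)
  also have "\<dots> = ?f 0 + ?f 1 + ?f (N - 2) + ?f (N - 1)"
  proof -
    have d: "0 \<notin> {1, N - 2, N - 1}" "1 \<notin> {N - 2, N - 1}" "N - 2 \<notin> {N - 1}" using card_ge by auto
    show ?thesis
      by (simp only: sum.insert[OF _ d(1)] sum.insert[OF _ d(2)] sum.insert[OF _ d(3)] finite_insert finite.emptyI) simp
  qed
  finally have ind: "of_bool (h \<in> S) = ?f 0 + ?f 1 + ?f (N - 2) + ?f (N - 1)"
    using res by (simp add: residual_def)
  have dims: "hook_dim 0 = 1" "hook_dim 1 = real N - 1" "hook_dim (N - 1) = 1"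
    using card_ge by (auto simp: hook_dim_def)
  have dim2: "hook_dim (N - 2) = real N - 1"
    using weight_subtop odd_card card_ge by (simp add: weight_def)
  have collect: "1 / c * A + a / c * B + a / c * B + 1 / c * A = (2 * A + 2 * (a * B)) / c" for a c A B :: real
    by (simp add: add_divide_distrib)
  have "of_bool (h \<in> S) = (2 * (N * real (card S)) +
      2 * ((real N - 1) * (N * (\<Sum>p\<in>S. real (fixed_points (h \<circ> inv' p)) - 1)))) / (real N * fact N)"
    unfolding ind dims dim2 translate_sum_extremes[OF h] collect by simp
  then have "of_bool (h \<in> S) * (real N * fact N) = N * (2 * real (card S) +
      2 * (real N - 1) * (\<Sum>p\<in>S. real (fixed_points (h \<circ> inv' p)) - 1))"
    using pos by (simp add: field_simps)
  then show ?thesis using card_ge by (simp add: mult_ac)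
qed

end

section \<open>Moments over the alternating group\<close>

text \<open>Double counting over \<open>G\<close> and \<open>T\<close>: by \<open>trans\<close> the
  sum over \<open>G\<close> is the same for every point of \<open>T\<close>, and by
  \<open>bij\<close> the sum over \<open>T\<close> is the same for every \<open>s\<close>. In the
  applications \<open>r\<close> is right composition with an element carrying \<open>t0\<close> to
  \<open>t\<close>.\<close>

lemma transitive_average:
  fixes F :: "'t \<Rightarrow> real"
  assumes fT: "finite T"
    and bij: "\<And>s. s \<in> G \<Longrightarrow> bij_betw (act s) T T"
    and trans: "\<And>t. t \<in> T \<Longrightarrow> \<exists>r. bij_betw r G G \<and> (\<forall>s\<in>G. act (r s) t0 = act s t)"
  shows "card T * (\<Sum>s\<in>G. F (act s t0)) = card G * (\<Sum>t\<in>T. F t)"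
proof -
  have inner: "(\<Sum>s\<in>G. F (act s t)) = (\<Sum>s\<in>G. F (act s t0))" if t: "t \<in> T" for t
  proof -
    obtain r where r: "bij_betw r G G" "\<forall>s\<in>G. act (r s) t0 = act s t" using trans[OF t] by blast
    have "(\<Sum>s\<in>G. F (act s t)) = (\<Sum>s\<in>G. F (act (r s) t0))" by (rule sum.cong) (use r(2) in auto)
    also have "\<dots> = (\<Sum>s\<in>G. F (act s t0))" by (rule sum.reindex_bij_betw[OF r(1)])
    finally show ?thesis .
  qed
  have "card T * (\<Sum>s\<in>G. F (act s t0)) = (\<Sum>t\<in>T. \<Sum>s\<in>G. F (act s t))" by (simp add: inner)
  also have "\<dots> = (\<Sum>s\<in>G. \<Sum>t\<in>T. F (act s t))" by (rule sum.swap)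
  also have "\<dots> = (\<Sum>s\<in>G. \<Sum>t\<in>T. F t)"
    by (rule sum.cong[OF refl]) (rule sum.reindex_bij_betw[OF bij])
  finally show ?thesis by simp
qed

definition distinct_pairs :: "'a set \<Rightarrow> ('a \<times> 'a) set" where
  "distinct_pairs V = (SIGMA i:V. V - {i})"

definition distinct_triples :: "'a set \<Rightarrow> ('a \<times> 'a \<times> 'a) set" where
  "distinct_triples V = (SIGMA i:V. SIGMA j:V - {i}. V - {i, j})"

lemma card_distinct_pairs: "finite V \<Longrightarrow> card (distinct_pairs V) = card V * (card V - 1)"
  by (simp add: distinct_pairs_def)

lemma card_distinct_triples:
  assumes "finite V"
  shows "card (distinct_triples V) = card V * (card V - 1) * (card V - 2)"
proof -
  have "card (SIGMA j:V - {i}. V - {i, j}) = (card V - 1) * (card V - 2)" if "i \<in> V" for i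
  proof -
    have "card (SIGMA j:V - {i}. V - {i, j}) = (\<Sum>j\<in>V - {i}. card V - 2)"
    proof (subst card_SigmaI)
      show "(\<Sum>j\<in>V - {i}. card (V - {i, j})) = (\<Sum>j\<in>V - {i}. card V - 2)"
        by (rule sum.cong) (use assms that in \<open>auto simp: card_Diff_subset\<close>)
    qed (use assms in auto)
    then show ?thesis using that assms by simp
  qed
  then show ?thesis unfolding distinct_triples_def using assms by simp
qed

lemma sum_distinct_pairs:
  fixes a b :: "'a \<Rightarrow> real"
  assumes "finite V"
  shows "(\<Sum>(i, j)\<in>distinct_pairs V. a i * b j) = sum a V * sum b V - (\<Sum>i\<in>V. a i * b i)"
proof -
  have "(\<Sum>(i, j)\<in>distinct_pairs V. a i * b j) = (\<Sum>i\<in>V. \<Sum>j\<in>V - {i}. a i * b j)"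
    unfolding distinct_pairs_def using assms by (intro sum.Sigma[symmetric]) auto
  also have "\<dots> = (\<Sum>i\<in>V. a i * sum b V - a i * b i)"
    by (rule sum.cong[OF refl]) (use assms in \<open>simp add: sum_distrib_left[symmetric] sum_diff1 algebra_simps\<close>)
  finally show ?thesis by (simp add: sum_subtractf sum_distrib_right)
qed

text \<open>Inclusion-exclusion over the coincidences of three indices; the total coincidence has
  the Moebius coefficient 2.\<close>

lemma sum_distinct_triples:
  fixes a b c :: "'a \<Rightarrow> real"
  assumes "finite V"
  shows "(\<Sum>(i, j, k)\<in>distinct_triples V. a i * b j * c k) =
    sum a V * sum b V * sum c V - (\<Sum>i\<in>V. a i * b i) * sum c V - (\<Sum>i\<in>V. a i * c i) * sum b V
    - sum a V * (\<Sum>i\<in>V. b i * c i) + 2 * (\<Sum>i\<in>V. a i * b i * c i)"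
proof -
  have "(\<Sum>(i, j, k)\<in>distinct_triples V. a i * b j * c k)
    = (\<Sum>i\<in>V. \<Sum>(j, k)\<in>(SIGMA j:V - {i}. V - {i, j}). a i * b j * c k)"
    unfolding distinct_triples_def using assms
    by (subst sum.Sigma[symmetric]) auto
  also have "\<dots> = (\<Sum>i\<in>V. \<Sum>j\<in>V - {i}. \<Sum>k\<in>V - {i, j}. a i * b j * c k)"
    by (rule sum.cong[OF refl]) (use assms in \<open>intro sum.Sigma[symmetric], auto\<close>)
  also have "\<dots> = (\<Sum>i\<in>V. a i * sum b V * sum c V - a i * b i * sum c V - a i * c i * sum b V
      - a i * (\<Sum>j\<in>V. b j * c j) + 2 * (a i * b i * c i))"
  proof (rule sum.cong[OF refl])
    fix i assume i: "i \<in> V"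
    have "(\<Sum>j\<in>V - {i}. \<Sum>k\<in>V - {i, j}. a i * b j * c k)
      = (\<Sum>j\<in>V - {i}. a i * (sum c V - c i) * b j - a i * (b j * c j))"
    proof (rule sum.cong[OF refl])
      fix j assume j: "j \<in> V - {i}"
      have "V - {i, j} = V - {i} - {j}" by auto
      then have "sum c (V - {i, j}) = sum c V - c i - c j" using assms i j by (simp add: sum_diff1)
      then show "(\<Sum>k\<in>V - {i, j}. a i * b j * c k) = a i * (sum c V - c i) * b j - a i * (b j * c j)"
        by (simp only: sum_distrib_left[symmetric]) (simp add: algebra_simps)
    qed
    also have "\<dots> = a i * (sum c V - c i) * (sum b V - b i) - a i * ((\<Sum>j\<in>V. b j * c j) - b i * c i)"
      using assms i by (simp add: sum_subtractf sum_distrib_left[symmetric] sum_diff1)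
    finally show "(\<Sum>j\<in>V - {i}. \<Sum>k\<in>V - {i, j}. a i * b j * c k)
      = a i * sum b V * sum c V - a i * b i * sum c V - a i * c i * sum b V
      - a i * (\<Sum>j\<in>V. b j * c j) + 2 * (a i * b i * c i)"
      by (simp add: algebra_simps)
  qed
  also have "\<dots> = sum a V * sum b V * sum c V - (\<Sum>i\<in>V. a i * b i) * sum c V - (\<Sum>i\<in>V. a i * c i) * sum b V
    - sum a V * (\<Sum>i\<in>V. b i * c i) + 2 * (\<Sum>i\<in>V. a i * b i * c i)"
    by (simp only: sum.distrib sum_subtractf sum_distrib_left[symmetric] sum_distrib_right[symmetric])
  finally show ?thesis .
qed

lemma permutes_three_points:
  assumes fin: "finite V" and V: "i \<in> V" "j \<in> V" "k \<in> V" "i' \<in> V" "j' \<in> V" "k' \<in> V"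
    and d: "i \<noteq> j" "i \<noteq> k" "j \<noteq> k" "i' \<noteq> j'" "i' \<noteq> k'" "j' \<noteq> k'"
  obtains g where "g permutes V" "g i = i'" "g j = j'" "g k = k'"
proof -
  have "card (V - {i, j, k}) = card (V - {i', j', k'})"
    using fin V d by (simp add: card_Diff_subset)
  then obtain h where h: "bij_betw h (V - {i, j, k}) (V - {i', j', k'})"
    using finite_same_card_bij[of "V - {i, j, k}" "V - {i', j', k'}"] fin by auto
  define g where "g x = (if x = i then i' else if x = j then j' else if x = k then k'
      else if x \<in> V then h x else x)" for x
  have b1: "bij_betw g {i, j, k} {i', j', k'}"
    using d by (auto simp: bij_betw_def inj_on_def g_def)
  have b2: "bij_betw g (V - {i, j, k}) (V - {i', j', k'})"
    using h by (rule bij_betw_cong[THEN iffD1, rotated]) (auto simp: g_def)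
  have "bij_betw g ({i, j, k} \<union> (V - {i, j, k})) ({i', j', k'} \<union> (V - {i', j', k'}))"
    by (rule bij_betw_combine[OF b1 b2]) auto
  moreover have "{i, j, k} \<union> (V - {i, j, k}) = V" "{i', j', k'} \<union> (V - {i', j', k'}) = V" using V by auto
  ultimately have "g permutes V" using V by (intro bij_imp_permutes) (auto simp: g_def)
  then show ?thesis using d by (intro that[of g]) (auto simp: g_def)
qed

section \<open>Three-transitivity of the alternating group and averages over it\<close>

context signed_subsets
begin

definition Alt :: "('a \<Rightarrow> 'a) set" where
  "Alt = {g. g permutes V \<and> perm_sign_on g V = 1}"

lemma Alt_perm: "g \<in> Alt \<Longrightarrow> g permutes V"
  by (simp add: Alt_def)

lemma finite_Alt [simp]: "finite Alt"
  using finite_Perms by (rule finite_subset[rotated]) (auto simp: Alt_def)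

lemma perm_sign_on_V_compose:
  assumes "g permutes V" "h permutes V"
  shows "perm_sign_on (g \<circ> h) V = perm_sign_on g V * perm_sign_on h V"
  using assms fin by (subst perm_sign_on_compose) (auto simp: permutes_image intro: perm_inj_on)

lemma perm_sign_on_cases: "perm_sign_on g J = 1 \<or> perm_sign_on g J = -1"
  using perm_sign_on_square[of g J] by (simp only: square_eq_1_iff)

lemma Alt_compose: "g \<in> Alt \<Longrightarrow> h \<in> Alt \<Longrightarrow> g \<circ> h \<in> Alt"
  by (simp add: Alt_def permutes_compose perm_sign_on_V_compose del: o_apply)

lemma Alt_inv: "g \<in> Alt \<Longrightarrow> inv' g \<in> Alt"
proof -
  assume g: "g \<in> Alt"
  then have p: "g permutes V" "inv' g permutes V" by (auto simp: Alt_def permutes_inv)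
  have "perm_sign_on (g \<circ> inv' g) V = 1"
    unfolding permutes_inv_o(1)[OF p(1)] using fin by (simp add: perm_sign_on_fixed)
  then show ?thesis using g p perm_sign_on_V_compose[OF p] by (simp add: Alt_def)
qed

lemma Alt_compose_bij:
  assumes g: "g \<in> Alt"
  shows "bij_betw (\<lambda>s. s \<circ> g) Alt Alt"
proof (rule bij_betwI[where g = "\<lambda>s. s \<circ> inv' g"])
  show "s \<circ> g \<circ> inv' g = s" "s \<circ> inv' g \<circ> g = s" for s
    by (simp_all only: comp_assoc permutes_inv_o[OF Alt_perm[OF g]] comp_id)
qed (use g Alt_compose Alt_inv in auto)

text \<open>An odd \<open>g\<close> is corrected by first swapping two points outside the triple;
  five points leave room for this.\<close>

lemma Alt_three_transitive:
  assumes n: "card V \<ge> 5" and t: "(i, j, k) \<in> distinct_triples V" "(i', j', k') \<in> distinct_triples V"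
  obtains g where "g \<in> Alt" "g i = i'" "g j = j'" "g k = k'"
proof -
  have V: "i \<in> V" "j \<in> V" "k \<in> V" "i' \<in> V" "j' \<in> V" "k' \<in> V"
    and d: "i \<noteq> j" "i \<noteq> k" "j \<noteq> k" "i' \<noteq> j'" "i' \<noteq> k'" "j' \<noteq> k'"
    using t by (auto simp: distinct_triples_def)
  obtain g where g: "g permutes V" "g i = i'" "g j = j'" "g k = k'"
    by (rule permutes_three_points[OF fin V d])
  show ?thesis
  proof (cases "perm_sign_on g V = 1")
    case True then show ?thesis using that g by (auto simp: Alt_def)
  next
    case False
    have "\<not> card (V - {i, j, k}) \<le> Suc 0" using n V d fin by (simp add: card_Diff_subset)
    moreover have "finite (V - {i, j, k})" using fin by simp
    ultimately have "\<not> (\<forall>x\<in>V - {i, j, k}. \<forall>y\<in>V - {i, j, k}. x = y)"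
      by (simp only: card_le_Suc0_iff_eq not_False_eq_True)
    then obtain x y where xy: "x \<in> V - {i, j, k}" "y \<in> V - {i, j, k}" "x \<noteq> y" by blast
    let ?t = "Transposition.transpose x y"
    have t: "?t permutes V" using xy by (intro permutes_swap_id) auto
    have "perm_sign_on (g \<circ> ?t) V = 1"
      using False perm_sign_on_cases[of g V] xy fin
      by (auto simp: perm_sign_on_V_compose[OF g(1) t] perm_sign_on_transpose)
    then have "g \<circ> ?t \<in> Alt" unfolding Alt_def using permutes_compose[OF t g(1)] by blast
    moreover have "(g \<circ> ?t) i = i'" "(g \<circ> ?t) j = j'" "(g \<circ> ?t) k = k'"
      using xy g by (auto simp: transpose_def)
    ultimately show ?thesis by (rule that)
  qed
qed

lemma exists_third: "card V \<ge> 5 \<Longrightarrow> \<exists>k. k \<in> V - {i, j}"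
proof -
  assume n: "card V \<ge> 5"
  have "card {i, j} \<le> 2" by (simp add: card_insert_if)
  then have "\<not> V \<subseteq> {i, j}" using n card_mono[of "{i, j}" V] by auto
  then show ?thesis by blast
qed

lemma average_triples:
  fixes F :: "'a \<Rightarrow> 'a \<Rightarrow> 'a \<Rightarrow> real"
  assumes n: "card V \<ge> 5" and t: "(i, j, k) \<in> distinct_triples V"
  shows "card (distinct_triples V) * (\<Sum>s\<in>Alt. F (s i) (s j) (s k))
    = card Alt * (\<Sum>(x, y, z)\<in>distinct_triples V. F x y z)"
proof -
  let ?act = "\<lambda>s. \<lambda>(x, y, z). (s x, s y, s z)"
  have "card (distinct_triples V) * (\<Sum>s\<in>Alt. (\<lambda>(x, y, z). F x y z) (?act s (i, j, k)))
    = card Alt * (\<Sum>t\<in>distinct_triples V. (\<lambda>(x, y, z). F x y z) t)"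
  proof (rule transitive_average)
    show "finite (distinct_triples V)" using fin by (auto simp: distinct_triples_def)
  next
    fix s assume "s \<in> Alt"
    then have s: "s permutes V" by (rule Alt_perm)
    show "bij_betw (?act s) (distinct_triples V) (distinct_triples V)"
    proof (rule bij_betwI[where g = "?act (inv' s)"])
      show "?act s \<in> distinct_triples V \<rightarrow> distinct_triples V"
        using s by (auto simp: distinct_triples_def permutes_in_image permutes_inj[THEN inj_eq])
      show "?act (inv' s) \<in> distinct_triples V \<rightarrow> distinct_triples V"
        using permutes_inv[OF s] by (auto simp: distinct_triples_def permutes_in_image permutes_inj[THEN inj_eq])
    qed (use s in \<open>auto simp: permutes_inverses\<close>)
  next
    fix t' assume t': "t' \<in> distinct_triples V"
    obtain i' j' k' where e: "t' = (i', j', k')" by (cases t')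
    obtain g where g: "g \<in> Alt" "g i = i'" "g j = j'" "g k = k'"
      by (rule Alt_three_transitive[OF n t t'[unfolded e]])
    show "\<exists>r. bij_betw r Alt Alt \<and> (\<forall>s\<in>Alt. ?act (r s) (i, j, k) = ?act s t')"
      by (intro exI[of _ "\<lambda>s. s \<circ> g"] conjI Alt_compose_bij g(1)) (simp add: e g)
  qed
  then show ?thesis by simp
qed

lemma average_pairs:
  fixes F :: "'a \<Rightarrow> 'a \<Rightarrow> real"
  assumes n: "card V \<ge> 5" and t: "(i, j) \<in> distinct_pairs V"
  shows "card (distinct_pairs V) * (\<Sum>s\<in>Alt. F (s i) (s j))
    = card Alt * (\<Sum>(x, y)\<in>distinct_pairs V. F x y)"
proof -
  let ?act = "\<lambda>s. \<lambda>(x, y). (s x, s y)"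
  have "card (distinct_pairs V) * (\<Sum>s\<in>Alt. (\<lambda>(x, y). F x y) (?act s (i, j)))
    = card Alt * (\<Sum>t\<in>distinct_pairs V. (\<lambda>(x, y). F x y) t)"
  proof (rule transitive_average)
    show "finite (distinct_pairs V)" using fin by (auto simp: distinct_pairs_def)
  next
    fix s assume "s \<in> Alt"
    then have s: "s permutes V" by (rule Alt_perm)
    show "bij_betw (?act s) (distinct_pairs V) (distinct_pairs V)"
    proof (rule bij_betwI[where g = "?act (inv' s)"])
      show "?act s \<in> distinct_pairs V \<rightarrow> distinct_pairs V"
        using s by (auto simp: distinct_pairs_def permutes_in_image permutes_inj[THEN inj_eq])
      show "?act (inv' s) \<in> distinct_pairs V \<rightarrow> distinct_pairs V"
        using permutes_inv[OF s] by (auto simp: distinct_pairs_def permutes_in_image permutes_inj[THEN inj_eq])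
    qed (use s in \<open>auto simp: permutes_inverses\<close>)
  next
    fix t' assume t': "t' \<in> distinct_pairs V"
    obtain i' j' where e: "t' = (i', j')" by (cases t')
    \<comment> \<open>Pairs are completed to triples, so that three-transitivity covers them as
      well.\<close>
    obtain k k' where k: "k \<in> V - {i, j}" "k' \<in> V - {i', j'}" using exists_third[OF n] by metis
    have T: "(i, j, k) \<in> distinct_triples V" "(i', j', k') \<in> distinct_triples V"
      using t t' e k by (auto simp: distinct_triples_def distinct_pairs_def)
    obtain g where g: "g \<in> Alt" "g i = i'" "g j = j'" "g k = k'"
      by (rule Alt_three_transitive[OF n T])
    show "\<exists>r. bij_betw r Alt Alt \<and> (\<forall>s\<in>Alt. ?act (r s) (i, j) = ?act s t')"
      by (intro exI[of _ "\<lambda>s. s \<circ> g"] conjI Alt_compose_bij g(1)) (simp add: e g)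
  qed
  then show ?thesis by simp
qed

lemma average_points:
  fixes F :: "'a \<Rightarrow> real"
  assumes n: "card V \<ge> 5" and i: "i \<in> V"
  shows "card V * (\<Sum>s\<in>Alt. F (s i)) = card Alt * (\<Sum>x\<in>V. F x)"
proof (rule transitive_average[OF fin])
  fix s assume "s \<in> Alt"
  then show "bij_betw s V V" by (simp add: Alt_def permutes_imp_bij)
next
  fix i' assume i': "i' \<in> V"
  obtain j j' where j: "j \<in> V - {i, i}" "j' \<in> V - {i', i'}" using exists_third[OF n] by metis
  obtain k k' where k: "k \<in> V - {i, j}" "k' \<in> V - {i', j'}" using exists_third[OF n] by metis
  have T: "(i, j, k) \<in> distinct_triples V" "(i', j', k') \<in> distinct_triples V"
    using i i' j k by (auto simp: distinct_triples_def)
  obtain g where g: "g \<in> Alt" "g i = i'" "g j = j'" "g k = k'"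
    by (rule Alt_three_transitive[OF n T])
  show "\<exists>r. bij_betw r Alt Alt \<and> (\<forall>s\<in>Alt. r s i = s i')"
    by (intro exI[of _ "\<lambda>s. s \<circ> g"] conjI Alt_compose_bij g(1)) (simp add: g)
qed

end

section \<open>Second and third moments of permutation sums of a matrix with zero row and column
  sums\<close>

context signed_subsets
begin

definition perm_sum :: "('a \<Rightarrow> 'a \<Rightarrow> real) \<Rightarrow> ('a \<Rightarrow> 'a) \<Rightarrow> real" where
  "perm_sum q s = (\<Sum>i\<in>V. q i (s i))"

context
  fixes q :: "'a \<Rightarrow> 'a \<Rightarrow> real"
  assumes n: "card V \<ge> 5"
    and row: "\<And>i. i \<in> V \<Longrightarrow> (\<Sum>j\<in>V. q i j) = 0"
    and col: "\<And>j. j \<in> V \<Longrightarrow> (\<Sum>i\<in>V. q i j) = 0"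
begin

lemma card_pairs_real: "real (card (distinct_pairs V)) = real (card V) * (real (card V) - 1)"
  and card_triples_real: "real (card (distinct_triples V)) = real (card V) * (real (card V) - 1) * (real (card V) - 2)"
  using n by (simp_all add: card_distinct_pairs[OF fin] card_distinct_triples[OF fin])

lemma power_sum_moment:
  fixes r :: nat
  shows "(\<Sum>s\<in>Alt. \<Sum>i\<in>V. q i (s i) ^ r) = card Alt / card V * (\<Sum>i\<in>V. \<Sum>j\<in>V. q i j ^ r)"
proof -
  have "(\<Sum>s\<in>Alt. \<Sum>i\<in>V. q i (s i) ^ r) = (\<Sum>i\<in>V. \<Sum>s\<in>Alt. q i (s i) ^ r)" by (rule sum.swap)
  also have "\<dots> = (\<Sum>i\<in>V. card Alt / card V * (\<Sum>j\<in>V. q i j ^ r))"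
  proof (rule sum.cong[OF refl])
    fix i assume "i \<in> V"
    then show "(\<Sum>s\<in>Alt. q i (s i) ^ r) = card Alt / card V * (\<Sum>j\<in>V. q i j ^ r)"
      using average_points[OF n, of i "\<lambda>j. q i j ^ r"] n
      by (simp add: field_simps del: card_0_eq)
  qed
  finally show ?thesis by (simp add: sum_distrib_left)
qed

text \<open>For fixed distinct points a vanishing row sum turns the sum over distinct values into
  minus the sum over equal values; a vanishing column sum then does the same for the points. The two
  signs cancel.\<close>

lemma pair_moment:
  fixes r :: nat
  shows "(\<Sum>s\<in>Alt. \<Sum>(i, j)\<in>distinct_pairs V. q i (s i) ^ r * q j (s j))
    = card Alt / card (distinct_pairs V) * (\<Sum>i\<in>V. \<Sum>j\<in>V. q i j ^ (r + 1))"
proof -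
  let ?c = "card Alt / card (distinct_pairs V)"
  have pos: "real (card (distinct_pairs V)) > 0" using n by (simp add: card_pairs_real)
  have "(\<Sum>s\<in>Alt. \<Sum>(i, j)\<in>distinct_pairs V. q i (s i) ^ r * q j (s j))
    = (\<Sum>(i, j)\<in>distinct_pairs V. \<Sum>s\<in>Alt. q i (s i) ^ r * q j (s j))"
    by (subst sum.swap) (simp add: case_prod_unfold)
  also have "\<dots> = (\<Sum>(i, j)\<in>distinct_pairs V. - ?c * (\<Sum>x\<in>V. q i x ^ r * q j x))"
  proof (rule sum.cong[OF refl], clarify)
    fix i j assume ij: "(i, j) \<in> distinct_pairs V"
    then have j: "j \<in> V" by (auto simp: distinct_pairs_def)
    have "card (distinct_pairs V) * (\<Sum>s\<in>Alt. q i (s i) ^ r * q j (s j))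
      = card Alt * (\<Sum>(x, y)\<in>distinct_pairs V. q i x ^ r * q j y)"
      by (rule average_pairs[OF n ij])
    also have "(\<Sum>(x, y)\<in>distinct_pairs V. q i x ^ r * q j y) = - (\<Sum>x\<in>V. q i x ^ r * q j x)"
      unfolding sum_distinct_pairs[OF fin] row[OF j] by simp
    finally show "(\<Sum>s\<in>Alt. q i (s i) ^ r * q j (s j)) = - ?c * (\<Sum>x\<in>V. q i x ^ r * q j x)"
      using pos by (simp add: field_simps)
  qed
  also have "\<dots> = - ?c * (\<Sum>(i, j)\<in>distinct_pairs V. \<Sum>x\<in>V. q i x ^ r * q j x)"
    by (simp only: sum_distrib_left case_prod_unfold)
  also have "(\<Sum>(i, j)\<in>distinct_pairs V. \<Sum>x\<in>V. q i x ^ r * q j x)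
    = (\<Sum>x\<in>V. \<Sum>(i, j)\<in>distinct_pairs V. q i x ^ r * q j x)"
    by (subst sum.swap) (simp add: case_prod_unfold)
  also have "\<dots> = (\<Sum>x\<in>V. - (\<Sum>i\<in>V. q i x ^ (r + 1)))"
  proof (rule sum.cong[OF refl])
    fix x assume x: "x \<in> V"
    show "(\<Sum>(i, j)\<in>distinct_pairs V. q i x ^ r * q j x) = - (\<Sum>i\<in>V. q i x ^ (r + 1))"
      using sum_distinct_pairs[OF fin, of "\<lambda>i. q i x ^ r" "\<lambda>j. q j x"] col[OF x] by (simp add: mult.commute)
  qed
  also have "\<dots> = - (\<Sum>i\<in>V. \<Sum>x\<in>V. q i x ^ (r + 1))"
    unfolding sum_negf by (subst sum.swap) (rule refl)
  finally show ?thesis by simp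
qed

text \<open>With zero row and column sums only the total coincidence survives in
  \<open>sum_distinct_triples\<close>. Its coefficient 2 occurs once for the values and once for the
  points, hence 4.\<close>

lemma triple_moment:
  "(\<Sum>s\<in>Alt. \<Sum>(i, j, k)\<in>distinct_triples V. q i (s i) * q j (s j) * q k (s k))
    = 4 * card Alt / card (distinct_triples V) * (\<Sum>i\<in>V. \<Sum>j\<in>V. q i j ^ 3)"
proof -
  let ?c = "card Alt / card (distinct_triples V)"
  have pos: "real (card (distinct_triples V)) > 0" using n by (simp add: card_triples_real)
  have "(\<Sum>s\<in>Alt. \<Sum>(i, j, k)\<in>distinct_triples V. q i (s i) * q j (s j) * q k (s k))
    = (\<Sum>(i, j, k)\<in>distinct_triples V. \<Sum>s\<in>Alt. q i (s i) * q j (s j) * q k (s k))"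
    by (subst sum.swap) (simp add: case_prod_unfold)
  also have "\<dots> = (\<Sum>(i, j, k)\<in>distinct_triples V. 2 * ?c * (\<Sum>x\<in>V. q i x * q j x * q k x))"
  proof (rule sum.cong[OF refl], clarify)
    fix i j k assume ijk: "(i, j, k) \<in> distinct_triples V"
    then have V: "i \<in> V" "j \<in> V" "k \<in> V" by (auto simp: distinct_triples_def)
    have "card (distinct_triples V) * (\<Sum>s\<in>Alt. q i (s i) * q j (s j) * q k (s k))
      = card Alt * (\<Sum>(x, y, z)\<in>distinct_triples V. q i x * q j y * q k z)"
      by (rule average_triples[OF n ijk])
    also have "(\<Sum>(x, y, z)\<in>distinct_triples V. q i x * q j y * q k z) = 2 * (\<Sum>x\<in>V. q i x * q j x * q k x)"
      unfolding sum_distinct_triples[OF fin] row[OF V(1)] row[OF V(2)] row[OF V(3)] by simp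
    finally show "(\<Sum>s\<in>Alt. q i (s i) * q j (s j) * q k (s k)) = 2 * ?c * (\<Sum>x\<in>V. q i x * q j x * q k x)"
      using pos by (simp add: field_simps)
  qed
  also have "\<dots> = 2 * ?c * (\<Sum>(i, j, k)\<in>distinct_triples V. \<Sum>x\<in>V. q i x * q j x * q k x)"
    by (simp only: sum_distrib_left case_prod_unfold)
  also have "(\<Sum>(i, j, k)\<in>distinct_triples V. \<Sum>x\<in>V. q i x * q j x * q k x)
    = (\<Sum>x\<in>V. \<Sum>(i, j, k)\<in>distinct_triples V. q i x * q j x * q k x)"
    by (subst sum.swap) (simp add: case_prod_unfold)
  also have "\<dots> = (\<Sum>x\<in>V. 2 * (\<Sum>i\<in>V. q i x ^ 3))"
  proof (rule sum.cong[OF refl])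
    fix x assume x: "x \<in> V"
    show "(\<Sum>(i, j, k)\<in>distinct_triples V. q i x * q j x * q k x) = 2 * (\<Sum>i\<in>V. q i x ^ 3)"
      using sum_distinct_triples[OF fin, of "\<lambda>i. q i x" "\<lambda>i. q i x" "\<lambda>i. q i x"] col[OF x]
      by (simp add: power3_eq_cube)
  qed
  also have "\<dots> = 2 * (\<Sum>i\<in>V. \<Sum>x\<in>V. q i x ^ 3)"
    unfolding sum_distrib_left[symmetric] by (subst sum.swap) (rule refl)
  finally show ?thesis by simp
qed

lemma second_moment:
  "(\<Sum>s\<in>Alt. (perm_sum q s)\<^sup>2) * (real (card V) - 1) = card Alt * (\<Sum>i\<in>V. \<Sum>j\<in>V. (q i j)\<^sup>2)"
proof -
  let ?n = "real (card V)" and ?Q = "\<Sum>i\<in>V. \<Sum>j\<in>V. (q i j)\<^sup>2"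
  have "(perm_sum q s)\<^sup>2 = (\<Sum>(i, j)\<in>distinct_pairs V. q i (s i) ^ 1 * q j (s j)) + (\<Sum>i\<in>V. q i (s i) ^ 2)" for s
    using sum_distinct_pairs[OF fin, of "\<lambda>i. q i (s i)" "\<lambda>i. q i (s i)"]
    by (simp add: perm_sum_def power2_eq_square)
  then have "(\<Sum>s\<in>Alt. (perm_sum q s)\<^sup>2)
    = (\<Sum>s\<in>Alt. \<Sum>(i, j)\<in>distinct_pairs V. q i (s i) ^ 1 * q j (s j)) + (\<Sum>s\<in>Alt. \<Sum>i\<in>V. q i (s i) ^ 2)"
    by (simp only: sum.distrib)
  also have "\<dots> = card Alt / card (distinct_pairs V) * ?Q + card Alt / ?n * ?Q"
    unfolding pair_moment power_sum_moment by (simp add: numeral_2_eq_2)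
  also have "\<dots> = card Alt * ?Q * (1 / (?n * (?n - 1)) + 1 / ?n)"
    unfolding card_pairs_real by (simp add: algebra_simps)
  also have "1 / (?n * (?n - 1)) + 1 / ?n = 1 / (?n - 1)"
    using n by (simp add: divide_simps del: card_0_eq)
  finally show ?thesis using n by simp
qed

text \<open>The cube splits by the coincidences of its three indices: all distinct, two equal in 3
  ways, all equal.\<close>

lemma third_moment:
  "(\<Sum>s\<in>Alt. (perm_sum q s) ^ 3) * ((real (card V) - 1) * (real (card V) - 2))
    = card Alt * card V * (\<Sum>i\<in>V. \<Sum>j\<in>V. (q i j) ^ 3)"
proof -
  let ?n = "real (card V)" and ?Q = "\<Sum>i\<in>V. \<Sum>j\<in>V. (q i j) ^ 3"
  have "(perm_sum q s) ^ 3 = (\<Sum>(i, j, k)\<in>distinct_triples V. q i (s i) * q j (s j) * q k (s k))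
    + 3 * (\<Sum>(i, j)\<in>distinct_pairs V. q i (s i) ^ 2 * q j (s j)) + (\<Sum>i\<in>V. q i (s i) ^ 3)" for s
    using sum_distinct_pairs[OF fin, of "\<lambda>i. q i (s i) ^ 2" "\<lambda>i. q i (s i)"]
      sum_distinct_triples[OF fin, of "\<lambda>i. q i (s i)" "\<lambda>i. q i (s i)" "\<lambda>i. q i (s i)"]
    by (simp add: perm_sum_def power2_eq_square power3_eq_cube algebra_simps)
  then have "(\<Sum>s\<in>Alt. (perm_sum q s) ^ 3)
    = (\<Sum>s\<in>Alt. \<Sum>(i, j, k)\<in>distinct_triples V. q i (s i) * q j (s j) * q k (s k))
     + 3 * (\<Sum>s\<in>Alt. \<Sum>(i, j)\<in>distinct_pairs V. q i (s i) ^ 2 * q j (s j)) + (\<Sum>s\<in>Alt. \<Sum>i\<in>V. q i (s i) ^ 3)"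
    by (simp only: sum.distrib sum_distrib_left)
  also have "\<dots> = 4 * card Alt / card (distinct_triples V) * ?Q + 3 * (card Alt / card (distinct_pairs V) * ?Q)
      + card Alt / ?n * ?Q"
    unfolding triple_moment pair_moment power_sum_moment by (simp add: numeral_3_eq_3)
  also have "\<dots> = card Alt * ?Q * (4 / (?n * (?n - 1) * (?n - 2)) + 3 / (?n * (?n - 1)) + 1 / ?n)"
    unfolding card_pairs_real card_triples_real by (simp add: algebra_simps)
  also have "4 / (?n * (?n - 1) * (?n - 2)) + 3 / (?n * (?n - 1)) + 1 / ?n = ?n / ((?n - 1) * (?n - 2))"
  proof -
    have "(a::real) \<ge> 5 \<Longrightarrow> 4 / (a * (a - 1) * (a - 2)) + 3 / (a * (a - 1)) + 1 / a = a / ((a - 1) * (a - 2))" for a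
      by (simp add: divide_simps) (simp add: algebra_simps)
    then show ?thesis using n by simp
  qed
  finally show ?thesis using n by (simp add: mult_ac)
qed

end

end

section \<open>Families attaining the bound\<close>

lemma cycle_of_list_funpow_hd:
  assumes "cycle cs" "k < length cs"
  shows "(cycle_of_list cs ^^ k) (hd cs) = cs ! k"
proof -
  have ne: "cs \<noteq> []" using assms by auto
  have "(cycle_of_list cs ^^ k) (hd cs) = hd (map (cycle_of_list cs ^^ k) cs)"
    using ne by (simp add: hd_map)
  also have "\<dots> = cs ! k"
    unfolding cyclic_rotation[OF assms(1)] using hd_rotate_conv_nth[OF ne] assms(2) by simp
  finally show ?thesis .
qed

text \<open>Listed from \<open>a\<close>, such a cycle continues with \<open>b\<close> and an
  arbitrary arrangement of the other points. The powers of the cycle at \<open>a\<close> read the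
  list back, so different arrangements give different cycles.\<close>

lemma card_full_cycles_ge:
  assumes fin: "finite V" and ab: "a \<in> V" "b \<in> V" "a \<noteq> b"
  shows "fact (card V - 2) \<le> card {c \<in> full_cycles V. c a = b}"
proof -
  let ?X = "permutations_of_set (V - {a, b})"
  let ?f = "\<lambda>xs. cycle_of_list (a # b # xs)"
  have cyc: "cycle (a # b # xs)" "set (a # b # xs) = V" "length xs = card (V - {a, b})" if "xs \<in> ?X" for xs
    using that ab by (auto simp: permutations_of_set_def distinct_card[symmetric])
  have inj: "inj_on ?f ?X"
  proof (rule inj_onI)
    fix xs ys assume X: "xs \<in> ?X" "ys \<in> ?X" and eq: "?f xs = ?f ys"
    have "a # b # xs = a # b # ys"
    proof (rule nth_equalityI)
      show len: "length (a # b # xs) = length (a # b # ys)" using cyc(3) X by simp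
      fix k assume k: "k < length (a # b # xs)"
      have "(?f xs ^^ k) a = (?f ys ^^ k) a" by (simp only: eq)
      then show "(a # b # xs) ! k = (a # b # ys) ! k"
        using cycle_of_list_funpow_hd[OF cyc(1)[OF X(1)] k]
          cycle_of_list_funpow_hd[OF cyc(1)[OF X(2)], of k] k len by simp
    qed
    then show "xs = ys" by simp
  qed
  have sub: "?f ` ?X \<subseteq> {c \<in> full_cycles V. c a = b}"
  proof
    fix c assume "c \<in> ?f ` ?X"
    then obtain xs where xs: "xs \<in> ?X" "c = ?f xs" by blast
    have "c a = b" using cycle_of_list_funpow_hd[OF cyc(1)[OF xs(1)], of 1] xs(2) by simp
    moreover have "c \<in> full_cycles V" unfolding full_cycles_def using xs cyc by blast
    ultimately show "c \<in> {c \<in> full_cycles V. c a = b}" by simp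
  qed
  have "full_cycles V \<subseteq> {g. g permutes V}" by (auto simp: full_cycles_def cycle_permutes)
  then have "finite {c \<in> full_cycles V. c a = b}"
    using finite_permutations[OF fin] by (auto intro: finite_subset)
  then have "card (?f ` ?X) \<le> card {c \<in> full_cycles V. c a = b}" using sub by (rule card_mono)
  moreover have "card (?f ` ?X) = fact (card V - 2)"
    unfolding card_image[OF inj] using fin ab by (simp add: card_Diff_subset numeral_2_eq_2)
  ultimately show ?thesis by simp
qed

lemma (in signed_subsets) card_Alt:
  assumes "card V \<ge> 2"
  shows "2 * card Alt = fact (card V)"
proof -
  have "\<not> card V \<le> Suc 0" using assms by simp
  then have "\<not> (\<forall>x\<in>V. \<forall>y\<in>V. x = y)" using fin by (simp only: card_le_Suc0_iff_eq not_False_eq_True)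
  then obtain x y where xy: "x \<in> V" "y \<in> V" "x \<noteq> y" by blast
  let ?t = "Transposition.transpose x y"
  have t: "?t permutes V" using xy by (intro permutes_swap_id)
  have s: "perm_sign_on (g \<circ> ?t) V = - perm_sign_on g V" if "g permutes V" for g
    using perm_sign_on_V_compose[OF that t] xy fin by (simp add: perm_sign_on_transpose)
  have "bij_betw (\<lambda>g. g \<circ> ?t) Alt (Perms - Alt)"
  proof (rule bij_betwI[where g = "\<lambda>g. g \<circ> ?t"])
    show "(\<lambda>g. g \<circ> ?t) \<in> Alt \<rightarrow> Perms - Alt"
      using s permutes_compose[OF t] by (auto simp: Alt_def simp del: o_apply)
    show "(\<lambda>g. g \<circ> ?t) \<in> Perms - Alt \<rightarrow> Alt"
    proof
      fix g assume g: "g \<in> Perms - Alt"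
      then have "perm_sign_on g V = -1" using perm_sign_on_cases[of g V] by (auto simp: Alt_def)
      then show "g \<circ> ?t \<in> Alt" using g s permutes_compose[OF t] by (simp add: Alt_def del: o_apply)
    qed
  qed (auto simp: comp_assoc)
  then have "card Alt = card (Perms - Alt)" by (rule bij_betw_same_card)
  moreover have sub: "Alt \<subseteq> Perms" by (auto simp: Alt_def)
  have "card (Perms - Alt) = card Perms - card Alt" "card Alt \<le> card Perms"
    by (rule card_Diff_subset[OF finite_Alt sub], rule card_mono[OF finite_Perms sub])
  moreover have "card Perms = fact (card V)" using fin by (simp add: card_permutations)
  ultimately show ?thesis by simp
qed

text \<open>This is \<open>average_points\<close> for the indicator of \<open>j\<close>.\<close>

lemma (in signed_subsets) card_Alt_point:
  assumes n: "card V \<ge> 5" and V: "i \<in> V" "j \<in> V"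
  shows "2 * card {p \<in> Alt. p i = j} = fact (card V - 1)"
proof -
  have "real (card V) * (\<Sum>s\<in>Alt. of_bool (s i = j)) = card Alt * (\<Sum>x\<in>V. of_bool (x = j) :: real)"
    by (rule average_points[OF n V(1)])
  moreover have "(\<Sum>s\<in>Alt. of_bool (s i = j)) = real (card {p \<in> Alt. p i = j})"
    by (simp add: of_bool_def sum.If_cases Int_def)
  moreover have "(\<Sum>x\<in>V. of_bool (x = j)) = (1::real)" using fin V by (simp add: of_bool_def)
  ultimately have "real (card V * card {p \<in> Alt. p i = j}) = real (card Alt)" by simp
  then have "card V * card {p \<in> Alt. p i = j} = card Alt" by (simp only: of_nat_eq_iff)
  then have "card V * (2 * card {p \<in> Alt. p i = j}) = fact (card V)"
    using card_Alt n by simp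
  also have "\<dots> = card V * fact (card V - 1)"
    using fact_reduce[of "card V", where 'a = nat] n by auto
  finally show ?thesis using n by auto
qed

section \<open>The density matrix of an extremal family and its rigidity\<close>

locale extremal_family = cycle_free_family +
  assumes extremal: "2 * card S = fact (card V - 1)"
begin

abbreviation "n \<equiv> real (card V)"
abbreviation "m \<equiv> real (card S)"

lemma n_ge: "n \<ge> 5" using card_ge by simp

lemma m_pos: "m > 0"
proof -
  have "2 * card S > 0" unfolding extremal by simp
  then show ?thesis by simp
qed

lemma S_nonempty [simp]: "S \<noteq> {}"
  using m_pos by auto

lemma card_Alt_eq: "real (card Alt) = n * m"
proof -
  have "2 * card Alt = card V * (2 * card S)"
    unfolding extremal using card_Alt card_ge fact_reduce[of "card V", where 'a = nat] by auto
  then have "card Alt = card V * card S" by simp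
  then show ?thesis by simp
qed

lemma S_Alt: "S \<subseteq> Alt"
  using S_perm S_even by (auto simp: Alt_def)

definition density :: "'a \<Rightarrow> 'a \<Rightarrow> real" where
  "density i j = card {p \<in> S. p i = j} / m"

text \<open>Subtracting the uniform value makes row and column sums vanish, as the moment formulas
  require.\<close>

definition centered :: "'a \<Rightarrow> 'a \<Rightarrow> real" where
  "centered i j = density i j - 1 / n"

lemma density_eq: "density i j = (\<Sum>p\<in>S. of_bool (p i = j)) / m"
  by (simp add: density_def of_bool_def sum.If_cases Int_def)

lemma density_row:
  assumes "i \<in> V" shows "(\<Sum>j\<in>V. density i j) = 1"
proof -
  have "(\<Sum>j\<in>V. \<Sum>p\<in>S. of_bool (p i = j)) = (\<Sum>p\<in>S. \<Sum>j\<in>V. of_bool (p i = j) :: real)"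
    by (rule sum.swap)
  also have "\<dots> = (\<Sum>p\<in>S. 1)"
  proof (rule sum.cong[OF refl])
    fix p assume "p \<in> S"
    then have "p i \<in> V" using S_perm assms by (simp add: permutes_in_image)
    then show "(\<Sum>j\<in>V. of_bool (p i = j) :: real) = 1" using fin by (simp add: of_bool_def)
  qed
  finally show ?thesis using m_pos by (simp add: density_eq sum_divide_distrib[symmetric])
qed

lemma density_col:
  assumes "j \<in> V" shows "(\<Sum>i\<in>V. density i j) = 1"
proof -
  have "(\<Sum>i\<in>V. \<Sum>p\<in>S. of_bool (p i = j)) = (\<Sum>p\<in>S. \<Sum>i\<in>V. of_bool (p i = j) :: real)"
    by (rule sum.swap)
  also have "\<dots> = (\<Sum>p\<in>S. 1)"
  proof (rule sum.cong[OF refl])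
    fix p assume "p \<in> S"
    then have p: "p permutes V" by (rule S_perm)
    have "(\<Sum>i\<in>V. of_bool (p i = j) :: real) = (\<Sum>i\<in>V. of_bool (i = j))"
      using sum.permute[OF p, of "\<lambda>i. of_bool (i = j) :: real"] by (simp add: comp_def)
    then show "(\<Sum>i\<in>V. of_bool (p i = j) :: real) = 1" using fin assms by (simp add: of_bool_def)
  qed
  finally show ?thesis using m_pos by (simp add: density_eq sum_divide_distrib[symmetric])
qed

lemma centered_row: "i \<in> V \<Longrightarrow> (\<Sum>j\<in>V. centered i j) = 0"
  and centered_col: "j \<in> V \<Longrightarrow> (\<Sum>i\<in>V. centered i j) = 0"
  by (simp_all add: centered_def sum_subtractf density_row density_col)

lemma fixed_points_translate:
  assumes "p permutes V"
  shows "real (fixed_points (s \<circ> inv' p)) = (\<Sum>i\<in>V. of_bool (p i = s i))"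
proof -
  have "real (fixed_points (s \<circ> inv' p)) = (\<Sum>x\<in>V. of_bool (s (inv' p x) = x))"
    using fin by (simp add: fixed_points_def of_bool_def sum.If_cases Int_def)
  also have "\<dots> = (\<Sum>i\<in>V. of_bool (s (inv' p (p i)) = p i))"
    using sum.permute[OF assms, of "\<lambda>x. of_bool (s (inv' p x) = x) :: real"] by (simp add: comp_def)
  finally show ?thesis by (simp add: permutes_inverses[OF assms] eq_commute)
qed

text \<open>Fixed points of \<open>s \<circ> inv' p\<close> are agreements of \<open>s\<close> and
  \<open>p\<close>, and summing agreements over \<open>S\<close> yields densities. The indicator
  formula thus becomes
  \<open>n * of_bool (s \<in> S) = 1 + (n - 1) * perm_sum centered s\<close>.\<close>

lemma perm_sum_centered:
  assumes s: "s \<in> Alt"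
  shows "perm_sum centered s = (if s \<in> S then 1 else - 1 / (n - 1))"
proof -
  have sp: "s permutes V" "perm_sign_on s V = 1" using s by (auto simp: Alt_def)
  have "(\<Sum>p\<in>S. real (fixed_points (s \<circ> inv' p)) - 1) = (\<Sum>p\<in>S. \<Sum>i\<in>V. of_bool (p i = s i)) - m"
    using fixed_points_translate[OF S_perm] by (simp add: sum_subtractf)
  also have "(\<Sum>p\<in>S. \<Sum>i\<in>V. of_bool (p i = s i)) = (\<Sum>i\<in>V. \<Sum>p\<in>S. of_bool (p i = s i) :: real)"
    by (rule sum.swap)
  also have "\<dots> = m * (\<Sum>i\<in>V. density i (s i))"
    using m_pos by (simp add: density_eq sum_divide_distrib[symmetric])
  also have "m * (\<Sum>i\<in>V. density i (s i)) - m = m * perm_sum centered s"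
    by (simp add: perm_sum_def centered_def sum_subtractf algebra_simps)
  finally have fp: "(\<Sum>p\<in>S. real (fixed_points (s \<circ> inv' p)) - 1) = m * perm_sum centered s" .
  have "fact N = (n * (2 * m) :: real)"
  proof -
    have "(fact N :: real) = n * fact (N - 1)" using card_ge by (intro fact_reduce) auto
    also have "(fact (N - 1) :: real) = 2 * m"
      by (metis extremal of_nat_fact of_nat_mult of_nat_numeral)
    finally show ?thesis .
  qed
  then have "n * (2 * m) * of_bool (s \<in> S) = 2 * m + 2 * (n - 1) * (m * perm_sum centered s)"
    using indicator_formula[OF extremal sp] fp by simp
  then have "2 * m * (n * of_bool (s \<in> S)) = 2 * m * (1 + (n - 1) * perm_sum centered s)"
    by (simp add: algebra_simps)
  then have "n * of_bool (s \<in> S) = 1 + (n - 1) * perm_sum centered s" using m_pos by simp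
  then have "perm_sum centered s = (n * of_bool (s \<in> S) - 1) / (n - 1)"
    using n_ge by (simp add: eq_divide_eq algebra_simps)
  then show ?thesis using n_ge by (cases "s \<in> S") auto
qed

text \<open>Only two values occur: 1 on the \<open>m\<close> members of \<open>S\<close>, and the
  other one on the remaining \<open>m * (n - 1)\<close> elements of \<open>Alt\<close>.\<close>

lemma sum_perm_sum_power:
  "(\<Sum>s\<in>Alt. perm_sum centered s ^ r) = m + m * (n - 1) * (- 1 / (n - 1)) ^ r"
proof -
  have "(\<Sum>s\<in>Alt. perm_sum centered s ^ r) = (\<Sum>s\<in>Alt. if s \<in> S then 1 else (- 1 / (n - 1)) ^ r)"
    by (rule sum.cong) (auto simp: perm_sum_centered)
  also have "\<dots> = m + real (card (Alt - S)) * (- 1 / (n - 1)) ^ r"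
  proof -
    have "Alt \<inter> S = S" "Alt \<inter> - S = Alt - S" using S_Alt by auto
    then show ?thesis by (simp add: sum.If_cases)
  qed
  also have "real (card (Alt - S)) = m * (n - 1)"
    using S_Alt card_Alt_eq card_mono[OF finite_Alt S_Alt] by (simp add: card_Diff_subset algebra_simps)
  finally show ?thesis .
qed

lemma sum_centered_square: "(\<Sum>i\<in>V. \<Sum>j\<in>V. (centered i j)\<^sup>2) = 1"
proof -
  have "(m + m * (n - 1) * (- 1 / (n - 1)) ^ 2) * (n - 1) = n * m * (\<Sum>i\<in>V. \<Sum>j\<in>V. (centered i j)\<^sup>2)"
    using second_moment[OF card_ge centered_row centered_col] sum_perm_sum_power[of 2] card_Alt_eq by simp
  moreover have "(m + m * (n - 1) * (- 1 / (n - 1)) ^ 2) * (n - 1) = n * m"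
  proof -
    have "(a + a * b * (- 1 / b) ^ 2) * b = (b + 1) * a" if "b > 0" for a b :: real
      using that by (simp add: power2_eq_square divide_simps) (simp add: algebra_simps)
    from this[of "n - 1" m] show ?thesis using n_ge by simp
  qed
  ultimately show ?thesis using n_ge m_pos by simp
qed

lemma sum_centered_cube: "(\<Sum>i\<in>V. \<Sum>j\<in>V. (centered i j) ^ 3) = (n - 2)\<^sup>2 / (n * (n - 1))"
proof -
  let ?Q = "\<Sum>i\<in>V. \<Sum>j\<in>V. (centered i j) ^ 3"
  have "(m + m * (n - 1) * (- 1 / (n - 1)) ^ 3) * ((n - 1) * (n - 2)) = n * m * n * ?Q"
    using third_moment[OF card_ge centered_row centered_col] sum_perm_sum_power[of 3] card_Alt_eq by simp
  moreover have "(m + m * (n - 1) * (- 1 / (n - 1)) ^ 3) * ((n - 1) * (n - 2)) = n * m * ((n - 2)\<^sup>2 / (n - 1))"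
  proof -
    have "(a + a * b * (- 1 / b) ^ 3) * (b * (b - 1)) = (b + 1) * a * ((b - 1)\<^sup>2 / b)" if "b > 0" for a b :: real
      using that by (simp add: power2_eq_square power3_eq_cube divide_simps) (simp add: algebra_simps)
    from this[of "n - 1" m] show ?thesis using n_ge by simp
  qed
  ultimately have "n * m * (n * ?Q) = n * m * ((n - 2)\<^sup>2 / (n - 1))" by (simp add: mult_ac)
  moreover have "n * m \<noteq> 0" using n_ge m_pos by simp
  ultimately have "n * ?Q = (n - 2)\<^sup>2 / (n - 1)" by (metis mult_left_cancel)
  then show ?thesis using n_ge by (simp add: field_simps)
qed

text \<open>The squares of the centered entries are weights with sum 1, and under them the entries
  average to the sum of cubes \<open>c\<close>; so some entry is at least \<open>c\<close>. The
  summand \<open>1 / n\<close> undoes the centering.\<close>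

lemma exists_dense_pair:
  obtains i j where "i \<in> V" "j \<in> V" "density i j \<ge> (n - 2)\<^sup>2 / (n * (n - 1)) + 1 / n"
proof -
  define c where "c = (n - 2)\<^sup>2 / (n * (n - 1))"
  have "\<exists>i\<in>V. \<exists>j\<in>V. centered i j \<ge> c"
  proof (rule ccontr)
    assume "\<not> ?thesis"
    then have less: "centered i j < c" if "i \<in> V" "j \<in> V" for i j using that by force
    let ?g = "\<lambda>i j. (centered i j)\<^sup>2 * (c - centered i j)"
    have nn: "?g i j \<ge> 0" if "i \<in> V" "j \<in> V" for i j using less[OF that] by simp
    have "(\<Sum>i\<in>V. \<Sum>j\<in>V. ?g i j) = c * (\<Sum>i\<in>V. \<Sum>j\<in>V. (centered i j)\<^sup>2) - (\<Sum>i\<in>V. \<Sum>j\<in>V. (centered i j) ^ 3)"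
      by (simp add: right_diff_distrib sum_subtractf sum_distrib_left power2_eq_square power3_eq_cube mult_ac)
    then have "(\<Sum>i\<in>V. \<Sum>j\<in>V. ?g i j) = 0" by (simp add: sum_centered_square sum_centered_cube c_def)
    then have "\<forall>i\<in>V. (\<Sum>j\<in>V. ?g i j) = 0"
      using fin nn by (subst (asm) sum_nonneg_eq_0_iff) (auto intro: sum_nonneg)
    then have "\<forall>i\<in>V. \<forall>j\<in>V. ?g i j = 0"
      using fin nn by (simp add: sum_nonneg_eq_0_iff del: mult_eq_0_iff)
    then have "centered i j = 0" if "i \<in> V" "j \<in> V" for i j using that less[OF that] by force
    then have "(\<Sum>i\<in>V. \<Sum>j\<in>V. (centered i j)\<^sup>2) = 0" by simp
    then show False using sum_centered_square by simp
  qed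
  then show ?thesis using that by (auto simp: centered_def c_def algebra_simps)
qed

text \<open>A cycle of odd length is even, so multiplication by a full cycle stays inside
  \<open>Alt\<close>.\<close>

lemma full_cycles_Alt: "full_cycles V \<subseteq> Alt"
proof
  fix c assume "c \<in> full_cycles V"
  then obtain cs where cs: "c = cycle_of_list cs" "cycle cs" "set cs = V" by (auto simp: full_cycles_def)
  have ne: "cs \<noteq> []" using cs(3) by auto
  have "length cs = N" using distinct_card[OF cs(2)] cs(3) by simp
  then have "sign c = 1" unfolding cs(1) sign_cycle_of_list[OF cs(2) ne] using odd_card by simp
  moreover have "c permutes V" using cycle_permutes[of cs] cs by simp
  ultimately show "c \<in> Alt" using perm_sign_on_eq_sign[OF fin] by (simp add: Alt_def)
qed

text \<open>If some member of the family misses the dense pair, then the images of that member under the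
  many full cycles that repair it are excluded from the family.\<close>

lemma density_le:
  assumes V: "i \<in> V" "j \<in> V" and s: "s \<in> S" "s i \<noteq> j"
  shows "density i j \<le> 1 - 2 / (n - 1)"
proof -
  let ?C = "{c \<in> full_cycles V. c (s i) = j}"
  have sp: "s permutes V" by (rule S_perm[OF s(1)])
  have si: "s i \<in> V" using sp V by (simp add: permutes_in_image)
  have img: "(\<lambda>c. c \<circ> s) ` ?C \<subseteq> {p \<in> Alt. p i = j} - {p \<in> S. p i = j}"
  proof
    fix p assume "p \<in> (\<lambda>c. c \<circ> s) ` ?C"
    then obtain c where c: "c \<in> full_cycles V" "c (s i) = j" "p = c \<circ> s" by blast
    have "p \<in> Alt" using c full_cycles_Alt S_Alt s Alt_compose by blast
    moreover have "p \<circ> inv' s = c" unfolding c(3) comp_assoc permutes_inv_o(1)[OF sp] by simp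
    then have "p \<notin> S" using S_cycle_free[of p s] s c(1) by auto
    ultimately show "p \<in> {p \<in> Alt. p i = j} - {p \<in> S. p i = j}" using c by simp
  qed
  have inj: "inj_on (\<lambda>c. c \<circ> s) ?C"
  proof (rule inj_onI)
    fix c d assume "c \<circ> s = d \<circ> s"
    then have "c \<circ> s \<circ> inv' s = d \<circ> s \<circ> inv' s" by simp
    then show "c = d" by (simp only: comp_assoc permutes_inv_o(1)[OF sp] comp_id)
  qed
  have "fact (N - 2) \<le> card ?C" using card_full_cycles_ge[OF fin si V(2) s(2)] .
  also have "\<dots> = card ((\<lambda>c. c \<circ> s) ` ?C)" using inj by (simp add: card_image)
  also have "\<dots> \<le> card ({p \<in> Alt. p i = j} - {p \<in> S. p i = j})" using img by (intro card_mono) auto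
  also have "\<dots> = card {p \<in> Alt. p i = j} - card {p \<in> S. p i = j}"
    using S_Alt by (intro card_Diff_subset) auto
  \<comment> \<open>By extremality, \<open>S\<close> has as many members as there are even
    permutations sending \<open>i\<close> to \<open>j\<close>.\<close>
  finally have "fact (N - 2) \<le> card S - card {p \<in> S. p i = j}" using card_Alt_point[OF card_ge V] extremal by simp
  moreover have "card {p \<in> S. p i = j} \<le> card S" by (intro card_mono) auto
  ultimately have "real (fact (N - 2)) \<le> m - real (card {p \<in> S. p i = j})" by linarith
  moreover have "2 * m = (n - 1) * fact (N - 2)"
  proof -
    have "2 * card S = (N - 1) * fact (N - 2)"
      unfolding extremal using card_ge fact_reduce[of "N - 1", where 'a = nat] by (simp add: numeral_2_eq_2)
    then have "real (2 * card S) = real ((N - 1) * fact (N - 2))" by simp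
    then show ?thesis using card_ge by (simp add: of_nat_diff)
  qed
  \<comment> \<open>The excluded permutations amount to the fraction \<open>2 / (n - 1)\<close> of
    the size of \<open>S\<close>; this is the constant in the claim.\<close>
  then have "fact (N - 2) = 2 / (n - 1) * m" using n_ge by (simp add: field_simps)
  ultimately have "real (card {p \<in> S. p i = j}) \<le> (1 - 2 / (n - 1)) * m" by (simp add: algebra_simps)
  then show ?thesis unfolding density_def using m_pos by (simp add: divide_le_eq)
qed

theorem S_point_coset: "\<exists>i\<in>V. \<exists>j\<in>V. S = {p \<in> Alt. p i = j}"
proof -
  obtain i j where V: "i \<in> V" "j \<in> V" and d: "density i j \<ge> (n - 2)\<^sup>2 / (n * (n - 1)) + 1 / n"
    by (rule exists_dense_pair)
  have "1 - 2 / (n - 1) < (n - 2)\<^sup>2 / (n * (n - 1)) + 1 / n"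
  proof -
    have "1 - 2 / (a - 1) < (a - 2)\<^sup>2 / (a * (a - 1)) + 1 / a" if "a \<ge> 5" for a :: real
    proof -
      \<comment> \<open>The exact gap between the density forced by the moments and the density
        allowed by \<open>density_le\<close>.\<close>
      have "(a - 2)\<^sup>2 / (a * (a - 1)) + 1 / a - (1 - 2 / (a - 1)) = 3 / (a * (a - 1))"
        using that by (simp add: power2_eq_square divide_simps) (simp add: algebra_simps)
      moreover have "3 / (a * (a - 1)) > 0" using that by simp
      ultimately show ?thesis by linarith
    qed
    then show ?thesis using n_ge by blast
  qed
  then have "s i = j" if "s \<in> S" for s using density_le[OF V that] d by force
  then have "S \<subseteq> {p \<in> Alt. p i = j}" using S_Alt by auto
  then have "S = {p \<in> Alt. p i = j}" using card_Alt_point[OF card_ge V] extremal by (intro card_subset_eq) auto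
  then show ?thesis using V by blast
qed

end

section \<open>Point stabilizers\<close>

lemma n_cycles_eq: "n_cycles n = full_cycles {1..n}"
proof -
  have "length cs = n \<and> set cs \<subseteq> {1..n} \<longleftrightarrow> set cs = {1..n}" if "cycle cs" for cs
  proof
    assume "length cs = n \<and> set cs \<subseteq> {1..n}"
    then show "set cs = {1..n}" using distinct_card[OF that] by (intro card_subset_eq) auto
  next
    assume "set cs = {1..n}"
    then show "length cs = n \<and> set cs \<subseteq> {1..n}" using distinct_card[OF that] by simp
  qed
  then show ?thesis unfolding n_cycles_def full_cycles_def by (intro Collect_cong ex_cong1) blast
qed

lemma signed_subsets_interval: "signed_subsets {1..n::nat}"
  by unfold_locales simp

lemma carrier_alt_group_eq: "carrier (alt_group n) = signed_subsets.Alt {1..n}"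
proof -
  interpret signed_subsets "{1..n}" by (rule signed_subsets_interval)
  have eq: "p permutes {1..n} \<and> evenperm p \<longleftrightarrow> p permutes {1..n} \<and> perm_sign_on p {1..n} = 1" for p
    using perm_sign_on_eq_sign[of "{1..n}" p] by (auto simp: sign_def simp del: One_nat_def split: if_splits)
  show ?thesis by (rule Set.set_eqI) (unfold alt_group_carrier Alt_def mem_Collect_eq, rule eq)
qed

lemma point_stabilizer_eq: "point_stabilizer n i = {p \<in> carrier (alt_group n). p i = i}"
  by (simp add: point_stabilizer_def stabilizer_def)

lemma point_stabilizer_l_coset:
  assumes g: "g \<in> carrier (alt_group n)"
  shows "g <#\<^bsub>alt_group n\<^esub> point_stabilizer n i = {p \<in> carrier (alt_group n). p i = g i}"
proof (intro equalityI subsetI)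
  interpret group "alt_group n" by (rule alt_group_is_group)
  fix p assume "p \<in> g <#\<^bsub>alt_group n\<^esub> point_stabilizer n i"
  then obtain h where h: "h \<in> carrier (alt_group n)" "h i = i" "p = g \<circ> h"
    by (auto simp: l_coset_def point_stabilizer_eq alt_group_mult)
  have "p \<in> carrier (alt_group n)" using m_closed[OF g h(1)] h(3) by (simp add: alt_group_mult)
  then show "p \<in> {p \<in> carrier (alt_group n). p i = g i}" using h by simp
next
  interpret group "alt_group n" by (rule alt_group_is_group)
  fix p assume p: "p \<in> {p \<in> carrier (alt_group n). p i = g i}"
  have gp: "g permutes {1..n}" using g by (simp add: alt_group_carrier)
  have ig: "inv' g \<in> carrier (alt_group n)" using alt_group_inv_closed[OF g] .
  have "inv' g \<circ> p \<in> carrier (alt_group n)" using m_closed[OF ig] p by (simp add: alt_group_mult)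
  moreover have "(inv' g \<circ> p) i = i" using p permutes_inverses[OF gp] by simp
  moreover have "p = g \<circ> (inv' g \<circ> p)" unfolding comp_assoc[symmetric] permutes_inv_o(1)[OF gp] by simp
  ultimately show "p \<in> g <#\<^bsub>alt_group n\<^esub> point_stabilizer n i"
    unfolding l_coset_def point_stabilizer_eq alt_group_mult by blast
qed

lemma point_stabilizer_r_coset:
  assumes g: "g \<in> carrier (alt_group n)"
  shows "point_stabilizer n i #>\<^bsub>alt_group n\<^esub> g = {p \<in> carrier (alt_group n). p (inv' g i) = i}"
proof (intro equalityI subsetI)
  interpret group "alt_group n" by (rule alt_group_is_group)
  have gp: "g permutes {1..n}" using g by (simp add: alt_group_carrier)
  fix p assume "p \<in> point_stabilizer n i #>\<^bsub>alt_group n\<^esub> g"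
  then obtain h where h: "h \<in> carrier (alt_group n)" "h i = i" "p = h \<circ> g"
    by (auto simp: r_coset_def point_stabilizer_eq alt_group_mult)
  have "p \<in> carrier (alt_group n)" using m_closed[OF h(1) g] h(3) by (simp add: alt_group_mult)
  then show "p \<in> {p \<in> carrier (alt_group n). p (inv' g i) = i}" using h permutes_inverses[OF gp] by simp
next
  interpret group "alt_group n" by (rule alt_group_is_group)
  fix p assume p: "p \<in> {p \<in> carrier (alt_group n). p (inv' g i) = i}"
  have gp: "g permutes {1..n}" using g by (simp add: alt_group_carrier)
  have ig: "inv' g \<in> carrier (alt_group n)" using alt_group_inv_closed[OF g] .
  have "p \<circ> inv' g \<in> carrier (alt_group n)" using m_closed[OF _ ig] p by (simp add: alt_group_mult)
  moreover have "(p \<circ> inv' g) i = i" using p by simp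
  moreover have "p = (p \<circ> inv' g) \<circ> g" unfolding comp_assoc permutes_inv_o(2)[OF gp] by simp
  ultimately show "p \<in> point_stabilizer n i #>\<^bsub>alt_group n\<^esub> g"
    unfolding r_coset_def point_stabilizer_eq alt_group_mult by blast
qed

text \<open>A left coset by \<open>g\<close> of the stabilizer of \<open>i\<close> belongs to the
  pair of \<open>i\<close> and \<open>g i\<close>, a right coset to the pair of
  \<open>inv' g i\<close> and \<open>i\<close>. Conversely a left coset always serves; its
  representative exists because the set of even permutations sending \<open>i\<close> to
  \<open>j\<close> has positive size.\<close>

lemma is_point_stabilizer_coset_iff:
  assumes n: "n \<ge> 5"
  shows "is_point_stabilizer_coset n S \<longleftrightarrow>
    (\<exists>i\<in>{1..n}. \<exists>j\<in>{1..n}. S = {\<pi> \<in> carrier (alt_group n). \<pi> i = j})"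
proof
  assume "is_point_stabilizer_coset n S"
  then obtain i g where i: "i \<in> {1..n}" and g: "g \<in> carrier (alt_group n)"
    and S: "S = {p \<in> carrier (alt_group n). p i = g i} \<or> S = {p \<in> carrier (alt_group n). p (inv' g i) = i}"
    unfolding is_point_stabilizer_coset_def by (auto simp: point_stabilizer_l_coset point_stabilizer_r_coset)
  have gp: "g permutes {1..n}" using g by (simp add: alt_group_carrier)
  have "g i \<in> {1..n}" "inv' g i \<in> {1..n}"
    using permutes_in_image[OF gp] permutes_in_image[OF permutes_inv[OF gp]] i by blast+
  then show "\<exists>i\<in>{1..n}. \<exists>j\<in>{1..n}. S = {\<pi> \<in> carrier (alt_group n). \<pi> i = j}" using S i by blast
next
  assume "\<exists>i\<in>{1..n}. \<exists>j\<in>{1..n}. S = {\<pi> \<in> carrier (alt_group n). \<pi> i = j}"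
  then obtain i j where ij: "i \<in> {1..n}" "j \<in> {1..n}" and S: "S = {\<pi> \<in> carrier (alt_group n). \<pi> i = j}" by blast
  interpret signed_subsets "{1..n}" by (rule signed_subsets_interval)
  have "2 * card {p \<in> Alt. p i = j} = fact (card {1..n} - 1)"
    using n ij by (intro card_Alt_point) auto
  then have "card {p \<in> Alt. p i = j} \<noteq> 0" by (intro notI) simp
  then have "{p \<in> Alt. p i = j} \<noteq> {}" by (metis card.empty)
  then obtain g where g: "g \<in> carrier (alt_group n)" "g i = j"
    unfolding carrier_alt_group_eq by blast
  then have "S = g <#\<^bsub>alt_group n\<^esub> point_stabilizer n i" by (simp add: point_stabilizer_l_coset S)
  then show "is_point_stabilizer_coset n S"
    unfolding is_point_stabilizer_coset_def using ij g by blast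
qed

theorem theorem7p25:
  fixes n :: nat and S :: "(nat \<Rightarrow> nat) set"
  assumes "n \<ge> 5" and "odd n"
    and "S \<subseteq> carrier (alt_group n)"
    and "\<not> (\<exists>\<pi> \<in> S. \<exists>\<sigma> \<in> S. \<pi> \<otimes>\<^bsub>sym_group n\<^esub> inv\<^bsub>sym_group n\<^esub> \<sigma> \<in> n_cycles n)"
  shows "real (card S) \<le> fact (n - 1) / 2
    \<and> (real (card S) = fact (n - 1) / 2 \<longleftrightarrow> is_point_stabilizer_coset n S)
    \<and> (is_point_stabilizer_coset n S \<longleftrightarrow>
         (\<exists>i \<in> {1..n}. \<exists>j \<in> {1..n}. S = {\<pi> \<in> carrier (alt_group n). \<pi> i = j}))"
proof -
  interpret signed_subsets "{1..n}" by (rule signed_subsets_interval)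
  have SA: "S \<subseteq> Alt" using assms(3) by (simp add: carrier_alt_group_eq)
  interpret cycle_free_family "{1..n}" S
  proof
    fix p q assume pq: "p \<in> S" "q \<in> S"
    then have "q \<in> carrier (sym_group n)" using SA Alt_perm by (auto simp: sym_group_carrier)
    then have e: "p \<otimes>\<^bsub>sym_group n\<^esub> inv\<^bsub>sym_group n\<^esub> q = p \<circ> inv' q"
      by (simp add: sym_group_mult)
    have "p \<otimes>\<^bsub>sym_group n\<^esub> inv\<^bsub>sym_group n\<^esub> q \<notin> n_cycles n" using assms(4) pq by blast
    then show "p \<circ> inv' q \<notin> full_cycles {1..n}" by (simp only: e n_cycles_eq not_False_eq_True)
  qed (use SA assms(1,2) in \<open>auto simp: Alt_def simp del: One_nat_def\<close>)
  have bound: "2 * card S \<le> fact (n - 1)" using card_bound by simp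
  have "real (2 * card S) \<le> real (fact (n - 1))" using bound by (simp only: of_nat_le_iff)
  then have le: "real (card S) \<le> fact (n - 1) / 2" by simp
  have card_iff: "real (card S) = fact (n - 1) / 2 \<longleftrightarrow> 2 * card S = fact (n - 1)"
  proof -
    have "2 * card S = fact (n - 1) \<longleftrightarrow> real (2 * card S) = real (fact (n - 1))" by (simp only: of_nat_eq_iff)
    then show ?thesis by auto
  qed
  have "2 * card S = fact (n - 1) \<longleftrightarrow> (\<exists>i\<in>{1..n}. \<exists>j\<in>{1..n}. S = {\<pi> \<in> carrier (alt_group n). \<pi> i = j})"
  proof
    assume "2 * card S = fact (n - 1)"
    then interpret extremal_family "{1..n}" S by unfold_locales simp
    show "\<exists>i\<in>{1..n}. \<exists>j\<in>{1..n}. S = {\<pi> \<in> carrier (alt_group n). \<pi> i = j}"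
      using S_point_coset by (simp only: carrier_alt_group_eq)
  next
    assume "\<exists>i\<in>{1..n}. \<exists>j\<in>{1..n}. S = {\<pi> \<in> carrier (alt_group n). \<pi> i = j}"
    then obtain i j where "i \<in> {1..n}" "j \<in> {1..n}" "S = {p \<in> Alt. p i = j}"
      by (auto simp: carrier_alt_group_eq)
    then show "2 * card S = fact (n - 1)" using card_Alt_point[of i j] assms(1) by simp
  qed
  then show ?thesis using le card_iff is_point_stabilizer_coset_iff[OF assms(1)] by blast
qed

end
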